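(* Let $p\ge 11$ be a prime. Then the following two congruences hold modulo $p$ (all terms on the right-hand sides are $p$-adic integers, most of them integers given as Hensel digits): (i) \begin{align*} \mathcal{T}(p-3)\equiv\;&3\big(\mathcal{C}(p-3)\big)_1-\tfrac{11}{4}\mathcal{B}_{p-5}+6\big(\mathcal{B}_{3p-5}-3\mathcal{B}_{2p-4}+2\mathcal{B}_{p-3}\big)_2\\ &+\Big[6(\mathcal{B}_{p-3}-\mathcal{B}_{2p-4})_1\Big]_1+\Big[3\big(2(\mathcal{B}_{2p-4}-\mathcal{B}_{p-3})_1+2(w_p)_0\mathcal{B}_{p-3}\big)_0\Big]_1\\ &+(w_p)_1\Big[-6\mathcal{B}_{p-3}\Big]_0+(w_p)_0\Big[6(\mathcal{B}_{2p-4}-2\mathcal{B}_{p-3})\Big]_1+\Big[(w_p)_0(-6\mathcal{B}_{p-3})_0\Big]_1\\ &+\Big\{\Big[6(\mathcal{B}_{p-3}-\mathcal{B}_{2p-4})_1\Big]_0+\Big[-6(w_p)_0\mathcal{B}_{p-3}\Big]_0+\Big[3\big(2(\mathcal{B}_{2p-4}-\mathcal{B}_{p-3})_1+2(w_p)_0\mathcal{B}_{p-3}\big)_0\Big]_0\Big\}_1 \pmod p; \end{align*} (ii) \begin{align*} \mathcal{T}(p-5)\equiv\;&3\big(\mathcal{C}(p-5)\big)_1-\tfrac{15}{4}\mathcal{B}_{p-7}+\big[3(\mathcal{B}_{p-3})_0^2\big]_1+6\mathcal{B}_{p-3}\big(2\mathcal{B}_{p-3}-\mathcal{B}_{2p-4}\big)_1\\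 &+6\big(\mathcal{B}_{3p-7}-3\mathcal{B}_{2p-6}+2\mathcal{B}_{p-5}\big)_2+\Big[6(\mathcal{B}_{p-5}-\mathcal{B}_{2p-6})_1\Big]_1\\ &+(w_p)_0(-6\mathcal{B}_{p-5})_1+(w_p)_1(-6\mathcal{B}_{p-5})_0+\Big((w_p)_0(-6\mathcal{B}_{p-5})_0\Big)_1+\Big(-6(w_p)_0^2\mathcal{B}_{p-5}\Big)_0\\ &+\Big[3(w_p)_0\big(2(w_p)_0\mathcal{B}_{p-5}+2(\mathcal{B}_{2p-6}-\mathcal{B}_{p-5})_1-\mathcal{B}_{p-3}^2\big)_0\Big]_0\\ &+\Big[3\big(2(w_p)_0\mathcal{B}_{p-5}+2(\mathcal{B}_{2p-6}-\mathcal{B}_{p-5})_1-\mathcal{B}_{p-3}^2\big)_0\Big]_1\\ &+\Big\{\Big[3(\mathcal{B}_{p-3})_0^2\Big]_0+\Big[6(\mathcal{B}_{p-5}-\mathcal{B}_{2p-6})_1\Big]_0+\Big[-6(w_p)_0(\mathcal{B}_{p-5})_0\Big]_0\\ &\qquad+\Big[3\big(2(w_p)_0\mathcal{B}_{p-5}+2(\mathcal{B}_{2p-6}-\mathcal{B}_{p-5})_1-\mathcal{B}_{p-3}^2\big)_0\Big]_0\Big\}_1 \pmod p. \end{align*}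
   Context: $B_n$ denotes the $n$-th Bernoulli number, and for $n\ge1$ the divided Bernoulli number is $\mathcal{B}_n:=B_n/n$ (a rational number, viewed in $\mathbb{Q}_p$). For an even integer $n\ge4$, $\mathcal{C}(n):=\sum_{i=2}^{n-2}\mathcal{B}_i\mathcal{B}_{n-i}$, and $\mathcal{T}(n):=\sum_{i=2}^{n-4}\mathcal{B}_i\,\mathcal{C}(n-i)$ is the sum of products $\mathcal{B}_i\mathcal{B}_j\mathcal{B}_k$ over ordered triples $(i,j,k)$ with $i,j,k\ge2$ and $i+j+k=n$ (empty sums are $0$). The Wilson quotient is $w_p:=\frac{(p-1)!+1}{p}\in\mathbb{Z}$. Hensel digit notation: every $x\in\mathbb{Q}_p$ has a unique expansion $x=\sum_{i\ge -m}x_ip^i$ with $x_i\in\{0,1,\dots,p-1\}$; for an integer $i$, $(x)_i$, $[x]_i$ and $\{x\}_i$ all denote the digit $x_i$ (an integer), and these are applied iteratively to expressions built from such digits. In particular $(\mathcal{B}_{p-3})_0^2$ means $\big((\mathcal{B}_{p-3})_0\big)^2$ and $(w_p)_0,(w_p)_1$ are the first two $p$-adic digits of $w_p$. A congruence modulo $p$ between elements of $\mathbb{Z}_p$ means their difference lies in $p\mathbb{Z}_p$. *)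

theory Defs
  imports Complex_Main "HOL-Number_Theory.Cong"
begin

text \<open>
  The recursion $\sum_{k=0}^{n} {n+1 \choose k} B_k = 0$ for $n \ge 1$. It gives $B_1 = -1/2$; the
  sign of $B_1$ plays no role below.
\<close>

fun bernoulli :: "nat \<Rightarrow> rat" where
  "bernoulli 0 = 1"
| "bernoulli (Suc n) =
     - (\<Sum>k\<le>n. of_nat (Suc (Suc n) choose k) * bernoulli k) / of_nat (Suc (Suc n))"

definition divided_bernoulli :: "nat \<Rightarrow> rat" ("\<B>")
  where "\<B> n = bernoulli n / of_nat n"

definition conv2 :: "nat \<Rightarrow> rat" ("\<C>")
  where "\<C> n = (\<Sum>i = 2..n - 2. \<B> i * \<B> (n - i))"

definition conv3 :: "nat \<Rightarrow> rat" ("\<T>")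
  where "\<T> n = (\<Sum>i = 2..n - 4. \<B> i * \<C> (n - i))"

definition wilson_quotient :: "nat \<Rightarrow> rat"
  where "wilson_quotient p = (fact (p - 1) + 1) / of_nat p"

text \<open>
  Every $p$-adic number considered here is rational. So instead of the completion $\mathbb{Q}_p$
  we use its dense subfield $\mathbb{Q}$ with the $p$-adic norm. A Hensel expansion of a rational
  number is a series of rational terms converging to it in that norm, and the $p$-adic integers
  that are rational are the rational numbers of norm at most $1$.
\<close>

definition padic_val :: "nat \<Rightarrow> rat \<Rightarrow> int"
  where "padic_val p x = (case quotient_of x of (u, v) \<Rightarrow>
           int (multiplicity (int p) u) - int (multiplicity (int p) v))"

definition padic_norm :: "nat \<Rightarrow> rat \<Rightarrow> real"
  where "padic_norm p x = (if x = 0 then 0 else real p powi (- padic_val p x))"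

definition padic_integers :: "nat \<Rightarrow> rat set"
  where "padic_integers p = {x. padic_norm p x \<le> 1}"

definition padic_cong :: "nat \<Rightarrow> rat \<Rightarrow> rat \<Rightarrow> bool"
  where "padic_cong p x y \<longleftrightarrow> x \<in> padic_integers p \<and> y \<in> padic_integers p \<and>
           (\<exists>z\<in>padic_integers p. x - y = of_nat p * z)"

definition hensel_expansion :: "nat \<Rightarrow> rat \<Rightarrow> (int \<Rightarrow> int) \<Rightarrow> bool"
  where "hensel_expansion p x a \<longleftrightarrow> (\<forall>i. a i \<in> {0..<int p}) \<and>
           (\<exists>m. (\<forall>i<m. a i = 0) \<and>
             ((\<lambda>N. padic_norm p (x - (\<Sum>i = m..N. of_int (a i) * of_nat p powi i)))
                \<longlongrightarrow> 0) at_top)"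

definition hensel_digit :: "nat \<Rightarrow> rat \<Rightarrow> int \<Rightarrow> int"
  where "hensel_digit p x = (THE a. hensel_expansion p x a)"

text \<open>The digit as a rational number, so that digits can be nested.\<close>

abbreviation dig :: "nat \<Rightarrow> rat \<Rightarrow> int \<Rightarrow> rat"
  where "dig p x i \<equiv> of_int (hensel_digit p x i)"

abbreviation wdig :: "nat \<Rightarrow> int \<Rightarrow> rat"
  where "wdig p \<equiv> dig p (wilson_quotient p)"


text \<open>Existence and uniqueness of Hensel expansions, which justify the definite description.\<close>

context
  fixes p :: nat
  assumes p: "prime p"
begin

private definition R :: "int \<Rightarrow> rat \<Rightarrow> bool" where
  "R k x \<longleftrightarrow> (\<exists>u v. \<not> int p dvd v \<and> x = of_nat p powi k * of_int u / of_int v)"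

private lemma pp: "prime (int p)" and p0: "(of_nat p :: rat) \<noteq> 0" and p1: "1 < real p"
  using p prime_gt_1_nat[OF p] by auto

private lemma R_add:
  assumes "R k x" "R k y" shows "R k (x + y)"
proof -
  obtain u v u' v' where h: "\<not> int p dvd v" "x = of_nat p powi k * of_int u / of_int v"
     "\<not> int p dvd v'" "y = of_nat p powi k * of_int u' / of_int v'"
    using assms unfolding R_def by blast
  have "v \<noteq> 0" "v' \<noteq> 0" using h by auto
  hence "x + y = of_nat p powi k * of_int (u * v' + u' * v) / of_int (v * v')"
    by (simp add: h field_simps)
  moreover have "\<not> int p dvd v * v'" using h pp prime_dvd_mult_iff by blast
  ultimately show ?thesis unfolding R_def by blast
qed

private lemma R_uminus: assumes "R k x" shows "R k (- x)"
proof -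
  obtain u v where h: "\<not> int p dvd v" "x = of_nat p powi k * of_int u / of_int v"
    using assms unfolding R_def by blast
  hence "- x = of_nat p powi k * of_int (- u) / of_int v" by simp
  thus ?thesis using h unfolding R_def by blast
qed

private lemma R_diff: "R k x \<Longrightarrow> R k y \<Longrightarrow> R k (x - y)"
  using R_add[of k x "- y"] R_uminus[of k y] by simp

private lemma R_term: assumes "k \<le> i" shows "R k (of_int c * of_nat p powi i)"
proof -
  have "(of_nat p :: rat) powi i = of_nat p powi k * of_nat p powi (i - k)"
    using p0 by (simp flip: power_int_add)
  also have "of_nat p powi (i - k) = (of_int (int p ^ nat (i - k)) :: rat)"
    using assms by (simp add: power_int_def)
  finally have "of_int c * of_nat p powi i
      = of_nat p powi k * of_int (c * int p ^ nat (i - k)) / (of_int 1 :: rat)" by simp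
  moreover have "\<not> int p dvd 1" using pp not_prime_unit by blast
  ultimately show ?thesis unfolding R_def by blast
qed

private lemma R_sum: "(\<And>i. i \<in> A \<Longrightarrow> R k (f i)) \<Longrightarrow> R k (\<Sum>i\<in>A. f i)"
proof (induction A rule: infinite_finite_induct)
  case (insert x F) thus ?case by (simp add: R_add)
qed (use R_term[of k k 0] in auto)

private lemma val_decomp:
  assumes "x \<noteq> 0"
  obtains u v where "\<not> int p dvd u" "\<not> int p dvd v"
    "x = of_nat p powi (padic_val p x) * of_int u / of_int v"
proof -
  obtain a b where q: "quotient_of x = (a, b)" by force
  have x: "x = of_int a / of_int b" and b: "b > 0"
    using quotient_of_div[OF q] quotient_of_denom_pos[OF q] by auto
  have a: "a \<noteq> 0" using assms x by auto
  have nu: "\<not> is_unit (int p)" using pp not_prime_unit by blast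
  obtain u where u: "a = int p ^ multiplicity (int p) a * u" "\<not> int p dvd u"
    using multiplicity_decompose'[OF a nu] by metis
  have "b \<noteq> 0" using b by simp
  from multiplicity_decompose'[OF this nu]
  obtain v where v: "b = int p ^ multiplicity (int p) b * v" "\<not> int p dvd v" by metis
  have "x = of_int (int p ^ multiplicity (int p) a * u) / of_int (int p ^ multiplicity (int p) b * v)"
    using x u(1) v(1) by simp
  also have "\<dots> = of_nat p powi (padic_val p x) * of_int u / of_int v"
    using p0 by (simp add: padic_val_def q power_int_diff)
  finally show ?thesis using that u v by blast
qed

private lemma norm_le_iff: "padic_norm p x \<le> real p powi (- k) \<longleftrightarrow> R k x"
proof (cases "x = 0")
  case True
  thus ?thesis using R_term[of k k 0] p1 by (simp add: padic_norm_def)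
next
  case False
  from val_decomp[OF False] obtain u v where h: "\<not> int p dvd u" "\<not> int p dvd v"
    "x = of_nat p powi (padic_val p x) * of_int u / of_int v" by blast
  let ?n = "padic_val p x"
  have "padic_norm p x \<le> real p powi (- k) \<longleftrightarrow> k \<le> ?n"
    using False p1 power_int_strict_increasing[of "- ?n" "- k" "real p"]
      power_int_strict_increasing[of "- k" "- ?n" "real p"]
      power_int_increasing[of "- ?n" "- k" "real p"]
    by (auto simp: padic_norm_def not_le[symmetric]) 
  also have "\<dots> \<longleftrightarrow> R k x"
  proof
    assume k: "k \<le> ?n"
    have "R k (of_int u * of_nat p powi ?n)" by (rule R_term[OF k])
    then obtain u' v' where h': "\<not> int p dvd v'"
      "of_int u * of_nat p powi ?n = (of_nat p powi k * of_int u' / of_int v' :: rat)"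
      unfolding R_def by blast
    have "x = of_nat p powi k * of_int u' / of_int (v' * v)"
      using h(3) h'(2) by (simp add: mult.commute)
    moreover have "\<not> int p dvd v' * v" using h h' pp prime_dvd_mult_iff by blast
    ultimately show "R k x" unfolding R_def by blast
  next
    assume "R k x"
    then obtain u' v' where h': "\<not> int p dvd v'" "x = of_nat p powi k * of_int u' / of_int v'"
      unfolding R_def by blast
    show "k \<le> ?n"
    proof (rule ccontr)
      assume n: "\<not> k \<le> ?n"
      have nz: "v \<noteq> 0" "v' \<noteq> 0" using h h' by auto
      have "of_nat p powi ?n * of_int u / of_int v
          = (of_nat p powi k * of_int u' / of_int v' :: rat)" using h h' by simp
      moreover have "(of_nat p :: rat) powi k = of_nat p powi ?n * of_nat p powi (k - ?n)"
        using p0 by (simp flip: power_int_add)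
      moreover have "of_nat p powi (k - ?n) = (of_int (int p ^ nat (k - ?n)) :: rat)"
        using n by (simp add: power_int_def)
      ultimately have "(of_int (u * v') :: rat) = of_int (int p ^ nat (k - ?n) * u' * v)"
        using nz p0 by (simp add: field_simps)
      hence "u * v' = int p ^ nat (k - ?n) * u' * v" by (simp only: of_int_eq_iff)
      moreover have "int p dvd int p ^ nat (k - ?n)" using n by (simp add: dvd_power)
      ultimately have "int p dvd u * v'" by simp
      thus False using h h' pp prime_dvd_mult_iff by blast
    qed
  qed
  finally show ?thesis .
qed

private lemma R_mono: "k \<le> l \<Longrightarrow> R l x \<Longrightarrow> R k x"
  using power_int_increasing[of "- l" "- k" "real p"] p1
  unfolding norm_le_iff[symmetric] by linarith

private lemma tendsto_R:
  assumes "((\<lambda>N. padic_norm p (f N)) \<longlongrightarrow> 0) F"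
  shows "eventually (\<lambda>N. R k (f N)) F"
proof -
  have "0 < real p powi (- k)" using p1 by simp
  from order_tendstoD(2)[OF assms this] show ?thesis
    by eventually_elim (simp flip: norm_le_iff)
qed

lemma hensel_expansion_unique:
  assumes "hensel_expansion p x a" "hensel_expansion p x b"
  shows "a = b"
proof (rule ccontr)
  assume ne: "a \<noteq> b"
  let ?s = "\<lambda>a m N. \<Sum>i = m..N. (of_int (a i) * of_nat p powi i :: rat)"
  obtain m where m: "\<forall>i<m. a i = 0" "((\<lambda>N. padic_norm p (x - ?s a m N)) \<longlongrightarrow> 0) at_top"
    using assms(1) unfolding hensel_expansion_def by blast
  obtain n where n: "\<forall>i<n. b i = 0" "((\<lambda>N. padic_norm p (x - ?s b n N)) \<longlongrightarrow> 0) at_top"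
    using assms(2) unfolding hensel_expansion_def by blast
  define l where "l = min m n"
  have sa: "?s a m N = ?s a l N" for N
    by (rule sum.mono_neutral_left) (use m l_def in auto)
  have sb: "?s b n N = ?s b l N" for N
    by (rule sum.mono_neutral_left) (use n l_def in auto)
  obtain j where j: "a j \<noteq> b j" using ne by auto
  have jl: "j \<ge> l" using j m(1) n(1) unfolding l_def by (metis min_less_iff_conj not_le)
  define t where "t = (LEAST t. a (l + int t) \<noteq> b (l + int t))"
  define D where "D = l + int t"
  have ex: "a (l + int (nat (j - l))) \<noteq> b (l + int (nat (j - l)))" using j jl by simp
  have D: "a D \<noteq> b D" unfolding D_def t_def using LeastI[where P = "\<lambda>t. a (l + int t) \<noteq> b (l + int t)", OF ex] .
  have less: "a i = b i" if "l \<le> i" "i < D" for i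
  proof -
    have "nat (i - l) < t" using that unfolding D_def by linarith
    from not_less_Least[OF this[unfolded t_def]] show ?thesis using that by simp
  qed
  have "eventually (\<lambda>N. R (D + 1) (x - ?s a l N) \<and> R (D + 1) (x - ?s b l N) \<and> N \<ge> D) at_top"
    using tendsto_R[OF m(2)] tendsto_R[OF n(2)] by (simp add: sa sb eventually_conj_iff eventually_ge_at_top)
  then obtain N where N: "R (D + 1) (x - ?s a l N)" "R (D + 1) (x - ?s b l N)" "N \<ge> D"
    using eventually_happens'[OF trivial_limit_at_top_linorder] by blast
  have "R (D + 1) ((x - ?s b l N) - (x - ?s a l N))" by (rule R_diff[OF N(2,1)])
  also have "(x - ?s b l N) - (x - ?s a l N) = (\<Sum>i = l..N. of_int (a i - b i) * of_nat p powi i)"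
    by (simp add: sum_subtractf algebra_simps)
  also have "\<dots> = (\<Sum>i = D..N. of_int (a i - b i) * of_nat p powi i)"
    by (rule sum.mono_neutral_right) (use less D_def in auto)
  also have "\<dots> = of_int (a D - b D) * of_nat p powi D
      + (\<Sum>i = D+1..N. of_int (a i - b i) * of_nat p powi i)"
  proof -
    have "{D..N} = insert D {D+1..N}" using N(3) by auto
    thus ?thesis by simp
  qed
  finally have "R (D + 1) (of_int (a D - b D) * of_nat p powi D
      + (\<Sum>i = D+1..N. of_int (a i - b i) * of_nat p powi i))" .
  moreover have "R (D + 1) (\<Sum>i = D+1..N. of_int (a i - b i) * of_nat p powi i)"
    by (rule R_sum, rule R_term) auto
  ultimately have "R (D + 1) (of_int (a D - b D) * of_nat p powi D)"
    using R_diff by (metis add_diff_cancel_right')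
  then obtain u v where h: "\<not> int p dvd v"
    "of_int (a D - b D) * of_nat p powi D = (of_nat p powi (D + 1) * of_int u / of_int v :: rat)"
    unfolding R_def by blast
  have v0: "v \<noteq> 0" using h by auto
  define e :: rat where "e = of_nat p powi D"
  have "e \<noteq> 0" using p0 by (simp add: e_def)
  moreover have "of_int (a D - b D) * e = e * of_nat p * of_int u / of_int v"
    using h(2) p0 by (simp add: e_def power_int_add)
  ultimately have "of_int (a D - b D) = (of_nat p * of_int u / of_int v :: rat)"
    by (metis mult.assoc mult.commute mult_cancel_left times_divide_eq_right)
  hence "(of_int ((a D - b D) * v) :: rat) = of_int (int p * u)"
    using v0 by simp
  hence "(a D - b D) * v = int p * u" by (simp only: of_int_eq_iff)
  hence "int p dvd a D - b D" using h(1) pp by (metis dvd_triv_left prime_dvd_mult_iff)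
  moreover have "a D \<in> {0..<int p}" "b D \<in> {0..<int p}"
    using assms unfolding hensel_expansion_def by auto
  ultimately show False using D
    by (metis atLeastLessThan_iff mod_eq_dvd_iff mod_pos_pos_trivial)
qed

lemma hensel_expansion_exists: "\<exists>a. hensel_expansion p x a"
proof -
  obtain m u v where h: "\<not> int p dvd v" "x = of_nat p powi m * of_int u / of_int v"
  proof (cases "x = 0")
    case True
    thus ?thesis using that[of 1 0 0] pp not_prime_unit by auto
  next
    case False
    thus ?thesis using val_decomp[OF False] that by metis
  qed
  have v0: "v \<noteq> 0" using h by auto
  have "coprime v (int p)" using h(1) pp prime_imp_coprime coprime_commute by blast
  then obtain w where w: "[v * w = 1] (mod int p)"
    using cong_solve_coprime_int by blast
  define y where "y = rec_nat u (\<lambda>n y. (y - (y * w mod int p) * v) div int p)"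
  define d where "d n = y n * w mod int p" for n
  have y0: "y 0 = u" by (simp add: y_def)
  have ys: "int p * y (Suc n) = y n - d n * v" for n
  proof -
    have "[d n * v = y n * w * v] (mod int p)"
      unfolding d_def by (simp add: cong_def mod_simps)
    also have "[y n * w * v = y n * (v * w)] (mod int p)" by (simp add: algebra_simps)
    also have "[y n * (v * w) = y n * 1] (mod int p)" by (intro cong_mult w cong_refl)
    finally have "int p dvd y n - d n * v" by (simp add: cong_iff_dvd_diff dvd_diff_commute)
    moreover have "y (Suc n) = (y n - d n * v) div int p" by (simp add: y_def d_def)
    ultimately show ?thesis by simp
  qed
  have uv: "u = v * (\<Sum>i<n. d i * int p ^ i) + int p ^ n * y n" for n
  proof (induction n)
    case (Suc n)
    have "int p ^ Suc n * y (Suc n) = int p ^ n * (y n - d n * v)"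
      using ys[of n] by (simp add: mult.assoc mult.left_commute)
    thus ?case using Suc by (simp add: algebra_simps)
  qed (simp add: y0)
  define a where "a i = (if i < m then 0 else d (nat (i - m)))" for i
  have pos: "0 < int p" using prime_gt_0_nat[OF p] by simp
  have a1: "a i \<in> {0..<int p}" for i using pos by (simp add: a_def d_def)
  have rem: "R (N + 1) (x - (\<Sum>i = m..N. of_int (a i) * of_nat p powi i))" if N: "N \<ge> m" for N
  proof -
    define n where "n = nat (N + 1 - m)"
    have Nn: "N + 1 = m + int n" using N by (simp add: n_def)
    have "(\<Sum>i = m..N. of_int (a i) * of_nat p powi i)
        = (\<Sum>i<n. of_int (d i) * (of_nat p powi (m + int i) :: rat))"
      by (rule sum.reindex_bij_witness[of _ "\<lambda>i. m + int i" "\<lambda>i. nat (i - m)"])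
         (use Nn in \<open>auto simp: a_def\<close>)
    also have "\<dots> = of_nat p powi m * of_int (\<Sum>i<n. d i * int p ^ i)"
      using p0 by (simp add: power_int_add sum_distrib_left mult_ac)
    finally have "x - (\<Sum>i = m..N. of_int (a i) * of_nat p powi i)
        = of_nat p powi m * (of_int u - of_int v * of_int (\<Sum>i<n. d i * int p ^ i)) / of_int v"
      using v0 by (simp add: h(2) field_simps)
    also have "of_int u - of_int v * of_int (\<Sum>i<n. d i * int p ^ i)
        = (of_int (int p ^ n * y n) :: rat)"
      unfolding of_int_mult[symmetric] of_int_diff[symmetric] using uv[of n] by simp
    also have "of_nat p powi m * (of_int (int p ^ n * y n) :: rat) / of_int v
        = of_nat p powi (N + 1) * of_int (y n) / of_int v"
      using p0 by (simp add: Nn power_int_add)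
    finally show ?thesis using h(1) unfolding R_def by blast
  qed
  have "((\<lambda>N. padic_norm p (x - (\<Sum>i = m..N. of_int (a i) * of_nat p powi i))) \<longlongrightarrow> 0) at_top"
  proof (rule order_tendstoI)
    fix e :: real assume e: "e < 0"
    show "\<forall>\<^sub>F N in at_top. e < padic_norm p (x - (\<Sum>i = m..N. of_int (a i) * of_nat p powi i))"
      using e by (intro always_eventually) (auto simp: padic_norm_def intro: less_le_trans)
  next
    fix e :: real assume e: "0 < e"
    obtain n where n: "inverse e < real p ^ n" using real_arch_pow[OF p1] by blast
    have ne: "real p powi (- int n) < e"
      using less_imp_inverse_less[OF n] e by (simp add: power_int_minus)
    show "\<forall>\<^sub>F N in at_top. padic_norm p (x - (\<Sum>i = m..N. of_int (a i) * of_nat p powi i)) < e"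
      using eventually_ge_at_top[of "max m (int n)"]
    proof eventually_elim
      case (elim N)
      have "R (int n) (x - (\<Sum>i = m..N. of_int (a i) * of_nat p powi i))"
        by (rule R_mono[OF _ rem]) (use elim in auto)
      thus ?case using ne norm_le_iff by (meson le_less_trans)
    qed
  qed
  moreover have "\<forall>i<m. a i = 0" by (simp add: a_def)
  ultimately show ?thesis using a1 unfolding hensel_expansion_def by blast
qed

lemma hensel_expansion_hensel_digit: "hensel_expansion p x (hensel_digit p x)"
proof -
  obtain a where "hensel_expansion p x a" using hensel_expansion_exists by blast
  thus ?thesis unfolding hensel_digit_def
    using hensel_expansion_unique by (intro theI[where P = "hensel_expansion p x" and a = a])
qed

end

end

theory Submission
  imports Defs "HOL-Computational_Algebra.Computational_Algebra" "HOL-Number_Theory.Number_Theory"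
begin

text \<open>
  Let $P(X) = \prod_{a<p} (1 - aX)$. The coefficient of $X^m$ in $\log P$ is minus the $m$-th power
  sum of $1, \dots, p-1$ divided by $m$, and by Bernoulli's formula this is $-p\mathcal{B}_m$ up to
  higher powers of $p$. On the other hand $P$ is congruent to $1 - X^{p-1}$ modulo $p$; writing
  $P = (1 - X^{p-1})(1 + y)$ with $p \mid y$, we may replace $\log (1 + y)$ by
  $y - y^2/2 + y^3/3$ modulo $p^4$. Comparing the coefficients of $X^n$, $X^{n+(p-1)}$ and
  $X^{n+2(p-1)}$ and eliminating the coefficients of $P$ gives Kummer's congruences, a formula for
  $\mathcal{C}(n)$ modulo $p$, and one for $3\mathcal{C}(n) - p\mathcal{T}(n)$ modulo $p^2$. The Wilson
  quotient enters through the leading coefficient $(p-1)! = pw_p - 1$ of $P$. The remaining work is to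
  read these congruences digit by digit: in the stated right-hand sides the digits with index 1 and
  the last brace (a carry) just encode a sum that is divisible by $p$, divided by $p$.
\<close>

section \<open>Divisibility by powers of a prime and Hensel digits\<close>

text \<open>Since \<T>(n) carries a factor p^3 in L^3, knowing it modulo p takes precision p^4
  everywhere. Let s be the part of P in degrees 1 to p - 2. To this precision the three coefficients
  of log P, and those of L^2 and L^3 at n, are linear in the coefficients of s, s^2, s^3 at n, of
  s^2, s^3 at n + (p - 1) and of s^3 at n + 2(p - 1). Elimination leaves two of them over: s^2 at n
  + (p - 1) and s^3 at n + 2(p - 1). This is why the indices are p - 3 and p - 5: so close to the
  top, the index sums force factors of s at p - 2 or p - 4, and coefficients at odd index gain a
  further p because odd Bernoulli numbers vanish. For p - 3 both leftovers disappear; for p - 5 the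
  pair (p - 3) + (p - 3) survives and produces the terms with \<B>(p - 3). The corrections from
  Faulhaber's formula and from B_1 add up to (n/2 - 5/4) \<B>(n - 2), which is the source of -11/4
  and -15/4. They need Kummer's congruence at n - 2, and p \<ge> 11 ensures n - 2 \<ge> 4.\<close>

definition pdvd :: "nat \<Rightarrow> nat \<Rightarrow> rat \<Rightarrow> bool"
  where "pdvd p k x \<longleftrightarrow> (\<exists>z\<in>padic_integers p. x = of_nat p ^ k * z)"

locale padic_prime =
  fixes p :: nat
  assumes p: "prime p"
begin

lemma prime_int_p: "prime (int p)" and p_nonzero: "(of_nat p :: rat) \<noteq> 0" and one_less_p: "1 < real p"
  using p prime_gt_1_nat[OF p] by auto

lemma padic_val_decomp:
  assumes "x \<noteq> 0"
  obtains u v where "\<not> int p dvd v" "x = of_nat p powi padic_val p x * of_int u / of_int v"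
proof -
  obtain a b where q: "quotient_of x = (a, b)" by force
  have x: "x = of_int a / of_int b" and b: "b \<noteq> 0"
    using quotient_of_div[OF q] quotient_of_denom_pos[OF q] by auto
  have nu: "\<not> is_unit (int p)" using prime_int_p not_prime_unit by blast
  have a: "a \<noteq> 0" using assms x by auto
  obtain u where u: "a = int p ^ multiplicity (int p) a * u" "\<not> int p dvd u"
    using multiplicity_decompose'[OF a nu] by metis
  obtain v where v: "b = int p ^ multiplicity (int p) b * v" "\<not> int p dvd v"
    using multiplicity_decompose'[OF b nu] by metis
  have "x = of_int (int p ^ multiplicity (int p) a * u) / of_int (int p ^ multiplicity (int p) b * v)"
    using x u(1) v(1) by simp
  also have "\<dots> = of_nat p powi padic_val p x * of_int u / of_int v"
    using p_nonzero by (simp add: padic_val_def q power_int_diff)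
  finally show ?thesis using that v by blast
qed

text \<open>Replaces the norm by a fraction that need not be reduced, so that closure under sums and
  products is a matter of multiplying denominators. Conversely the reduced denominator stays prime
  to p, as otherwise p would divide the numerator too.\<close>

lemma padic_integers_iff:
  "x \<in> padic_integers p \<longleftrightarrow> (\<exists>u v. \<not> int p dvd v \<and> x = of_int u / of_int v)"
proof
  assume x: "x \<in> padic_integers p"
  show "\<exists>u v. \<not> int p dvd v \<and> x = of_int u / of_int v"
  proof (cases "x = 0")
    case True
    thus ?thesis using prime_int_p not_prime_unit by (intro exI[of _ 0] exI[of _ 1]) auto
  next
    case False
    have "real p powi (- padic_val p x) \<le> real p powi 0"
      using x False by (simp add: padic_integers_def padic_norm_def)
    hence val: "padic_val p x \<ge> 0"
      using power_int_strict_increasing[of 0 "- padic_val p x" "real p"] one_less_p by force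
    obtain u v where uv: "\<not> int p dvd v" "x = of_nat p powi padic_val p x * of_int u / of_int v"
      using padic_val_decomp[OF False] .
    have "x = of_int (int p ^ nat (padic_val p x) * u) / of_int v"
      using val by (subst uv(2)) (simp add: power_int_def)
    thus ?thesis using uv(1) by blast
  qed
next
  assume "\<exists>u v. \<not> int p dvd v \<and> x = of_int u / of_int v"
  then obtain u v where uv: "\<not> int p dvd v" "x = of_int u / of_int v" by blast
  obtain a b where q: "quotient_of x = (a, b)" by force
  have x: "x = of_int a / of_int b" and b: "b \<noteq> 0" and cop: "coprime a b"
    using quotient_of_div[OF q] quotient_of_denom_pos[OF q] quotient_of_coprime[OF q] by auto
  have "(of_int (a * v) :: rat) = of_int (u * b)"
    using uv x b by (auto simp: field_simps)
  hence av: "a * v = u * b" by (simp only: of_int_eq_iff)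
  have "\<not> int p dvd b"
  proof
    assume "int p dvd b"
    hence "int p dvd a" using av uv(1) prime_int_p by (metis dvd_mult prime_dvd_mult_iff)
    thus False using \<open>int p dvd b\<close> cop prime_int_p not_prime_unit coprime_common_divisor by blast
  qed
  hence "padic_val p x \<ge> 0" by (simp add: padic_val_def q not_dvd_imp_multiplicity_0)
  hence "real p powi (- padic_val p x) \<le> 1"
    using power_int_increasing[of "- padic_val p x" 0 "real p"] one_less_p by simp
  thus "x \<in> padic_integers p" by (simp add: padic_integers_def padic_norm_def)
qed

lemma padic_integers_of_int: "of_int m \<in> padic_integers p"
  unfolding padic_integers_iff using prime_int_p not_prime_unit
  by (intro exI[of _ m] exI[of _ 1]) auto

lemma padic_integers_add:
  assumes "x \<in> padic_integers p" "y \<in> padic_integers p"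
  shows "x + y \<in> padic_integers p"
proof -
  obtain u v u' v' where h: "\<not> int p dvd v" "x = of_int u / of_int v"
     "\<not> int p dvd v'" "y = of_int u' / of_int v'"
    using assms unfolding padic_integers_iff by blast
  have "v \<noteq> 0" "v' \<noteq> 0" using h by auto
  hence "x + y = of_int (u * v' + u' * v) / of_int (v * v')" by (simp add: h field_simps)
  moreover have "\<not> int p dvd v * v'" using h prime_int_p prime_dvd_mult_iff by blast
  ultimately show ?thesis unfolding padic_integers_iff by blast
qed

lemma padic_integers_mult:
  assumes "x \<in> padic_integers p" "y \<in> padic_integers p"
  shows "x * y \<in> padic_integers p"
proof -
  obtain u v u' v' where h: "\<not> int p dvd v" "x = of_int u / of_int v"
     "\<not> int p dvd v'" "y = of_int u' / of_int v'"
    using assms unfolding padic_integers_iff by blast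
  have "x * y = of_int (u * u') / of_int (v * v')" by (simp add: h)
  moreover have "\<not> int p dvd v * v'" using h prime_int_p prime_dvd_mult_iff by blast
  ultimately show ?thesis unfolding padic_integers_iff by blast
qed

lemma padic_integers_inverse:
  assumes "\<not> int p dvd c" shows "1 / of_int c \<in> padic_integers p"
  unfolding padic_integers_iff using assms by (intro exI[of _ 1] exI[of _ c]) auto

lemma pdvd_0_iff: "pdvd p 0 x \<longleftrightarrow> x \<in> padic_integers p"
  by (auto simp: pdvd_def)

lemma pdvd_of_int: "pdvd p 0 (of_int m)"
  by (simp add: pdvd_0_iff padic_integers_of_int)

lemma pdvd_of_nat: "pdvd p 0 (of_nat m)"
  using pdvd_of_int[of "int m"] by simp

lemma pdvd_numeral: "pdvd p 0 (numeral m)" "pdvd p 0 1" "pdvd p 0 (- numeral m)"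
  using pdvd_of_int[of "numeral m"] pdvd_of_int[of 1] pdvd_of_int[of "- numeral m"] by auto

lemma pdvd_power_self: "pdvd p k (of_nat p ^ k)"
  using padic_integers_of_int[of 1] unfolding pdvd_def by (intro bexI[of _ 1]) simp_all

lemma pdvd_self: "pdvd p 1 (of_nat p)"
  using pdvd_power_self[of 1] by simp

lemma pdvd_mult: "pdvd p j x \<Longrightarrow> pdvd p k y \<Longrightarrow> pdvd p (j + k) (x * y)"
  unfolding pdvd_def
proof (elim bexE)
  fix z z' assume "z \<in> padic_integers p" "x = of_nat p ^ j * z" "z' \<in> padic_integers p" "y = of_nat p ^ k * z'"
  thus "\<exists>z\<in>padic_integers p. x * y = of_nat p ^ (j + k) * z"
    by (intro bexI[of _ "z * z'"]) (auto simp: power_add padic_integers_mult)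
qed

lemma pdvd_lmult: "pdvd p 0 x \<Longrightarrow> pdvd p k y \<Longrightarrow> pdvd p k (x * y)"
  using pdvd_mult[of 0 x k y] by simp

lemma pdvd_rmult: "pdvd p k x \<Longrightarrow> pdvd p 0 y \<Longrightarrow> pdvd p k (x * y)"
  using pdvd_mult[of k x 0 y] by simp

lemma pdvd_mono:
  assumes "pdvd p k x" "j \<le> k" shows "pdvd p j x"
proof -
  obtain z where z: "z \<in> padic_integers p" "x = of_nat p ^ k * z"
    using assms(1) unfolding pdvd_def by blast
  have "x = of_nat p ^ j * (of_int (int p ^ (k - j)) * z)"
    using assms(2) by (simp add: z(2) flip: power_add mult.assoc)
  thus ?thesis unfolding pdvd_def using z(1) padic_integers_of_int padic_integers_mult by blast
qed

lemma pdvd_add: "pdvd p k x \<Longrightarrow> pdvd p k y \<Longrightarrow> pdvd p k (x + y)"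
  unfolding pdvd_def
proof (elim bexE)
  fix z z' assume "z \<in> padic_integers p" "x = of_nat p ^ k * z" "z' \<in> padic_integers p" "y = of_nat p ^ k * z'"
  thus "\<exists>z\<in>padic_integers p. x + y = of_nat p ^ k * z"
    by (intro bexI[of _ "z + z'"]) (auto simp: distrib_left padic_integers_add)
qed

lemma pdvd_uminus: "pdvd p k x \<Longrightarrow> pdvd p k (- x)"
  using pdvd_lmult[OF pdvd_of_int[of "- 1"], of k x] by simp

lemma pdvd_uminus_iff: "pdvd p k (- x) \<longleftrightarrow> pdvd p k x"
  using pdvd_uminus[of k x] pdvd_uminus[of k "- x"] by auto

lemma pdvd_diff: "pdvd p k x \<Longrightarrow> pdvd p k y \<Longrightarrow> pdvd p k (x - y)"
  using pdvd_add[of k x "- y"] pdvd_uminus[of k y] by simp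

lemma pdvd_zero: "pdvd p k 0"
  using padic_integers_of_int[of 0] unfolding pdvd_def by (intro bexI[of _ 0]) simp_all

lemma pdvd_sum: "(\<And>i. i \<in> A \<Longrightarrow> pdvd p k (f i)) \<Longrightarrow> pdvd p k (sum f A)"
  by (induction A rule: infinite_finite_induct) (auto simp: pdvd_zero pdvd_add)

lemma pdvd_divide:
  assumes "pdvd p k x" "\<not> int p dvd c" shows "pdvd p k (x / of_int c)"
  using pdvd_rmult[OF assms(1), of "1 / of_int c"] padic_integers_inverse[OF assms(2)]
  by (simp add: pdvd_0_iff)

lemma pdvd_divide_nat: "pdvd p k x \<Longrightarrow> \<not> p dvd c \<Longrightarrow> pdvd p k (x / of_nat c)"
  using pdvd_divide[of k x "int c"] by simp

lemma pdvd_divide_nat_iff: "\<not> p dvd c \<Longrightarrow> pdvd p k (of_nat c * x) \<longleftrightarrow> pdvd p k x"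
proof
  assume c: "\<not> p dvd c" and "pdvd p k (of_nat c * x)"
  from pdvd_divide_nat[OF this(2,1)] c show "pdvd p k x" by (cases "c = 0") simp_all
qed (rule pdvd_lmult[OF pdvd_of_nat])

lemma pdvd_power_mult_iff: "pdvd p (j + k) (of_nat p ^ j * x) \<longleftrightarrow> pdvd p k x"
  using p_nonzero by (auto simp: pdvd_def power_add mult.assoc)

lemma pdvd_divide_power: "pdvd p (j + k) x \<Longrightarrow> pdvd p k (x / of_nat p ^ j)"
  using p_nonzero pdvd_power_mult_iff[of j k "x / of_nat p ^ j"] by simp

text \<open>The exact power p^e in c satisfies p^e \<le> c < p^(k+1), hence e \<le> k. This controls
  the denominators i + 1 in Faulhaber's formula.\<close>

lemma pdvd_divide_nat_power:
  assumes "0 < c" "c < p ^ (k + 1)" shows "pdvd p 0 (of_nat p ^ k / of_nat c)"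
proof -
  have nu: "\<not> is_unit p" using p not_prime_unit by blast
  obtain v where v: "c = p ^ multiplicity p c * v" "\<not> p dvd v"
    using multiplicity_decompose'[of c p] nu assms(1) by (metis less_numeral_extra(3))
  define e where "e = multiplicity p c"
  have "v > 0" using v assms(1) by (cases v) auto
  hence "p ^ e * 1 \<le> p ^ e * v" by (intro mult_le_mono) auto
  also have "\<dots> = c" using v(1) e_def by simp
  also have "\<dots> < p ^ (k + 1)" by fact
  finally have "p ^ e < p ^ (k + 1)" by simp
  hence "e < k + 1" by (rule power_less_imp_less_exp[OF prime_gt_1_nat[OF p]])
  hence "(of_nat p :: rat) ^ k / of_nat c = of_nat (p ^ (k - e)) / of_nat v"
    using p_nonzero v(1) e_def[symmetric] \<open>v > 0\<close>
    by (simp add: field_simps flip: power_add of_nat_mult of_nat_power)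
  thus ?thesis using pdvd_divide_nat[OF pdvd_of_nat v(2), of "p ^ (k - e)"] by simp
qed

lemma pdvd_of_int_iff: "pdvd p 1 (of_int m) \<longleftrightarrow> int p dvd m"
proof
  assume "pdvd p 1 (of_int m)"
  then obtain z where z: "z \<in> padic_integers p" "of_int m = of_nat p * z"
    unfolding pdvd_def by auto
  then obtain u v where h: "\<not> int p dvd v" "of_int m = of_nat p * (of_int u / of_int v :: rat)"
    unfolding padic_integers_iff by blast
  have "v \<noteq> 0" using h(1) by auto
  hence "(of_int (m * v) :: rat) = of_int (int p * u)" using h(2) by (simp add: field_simps)
  hence "m * v = int p * u" by (simp only: of_int_eq_iff)
  thus "int p dvd m" using h(1) prime_int_p by (metis dvd_triv_left prime_dvd_mult_iff)
next
  assume "int p dvd m"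
  then obtain k where "m = int p * k" by blast
  thus "pdvd p 1 (of_int m)" using pdvd_mult[OF pdvd_self pdvd_of_int[of k]] by simp
qed

lemma padic_cong_iff:
  "padic_cong p x y \<longleftrightarrow> pdvd p 0 x \<and> pdvd p 0 y \<and> pdvd p 1 (x - y)"
  by (auto simp: padic_cong_def pdvd_def)

lemma pdvd_of_norm_le:
  assumes "padic_norm p x \<le> real p powi (- int k)" shows "pdvd p k x"
proof (cases "x = 0")
  case False
  have "real p powi (- padic_val p x) \<le> real p powi (- int k)"
    using assms False by (simp add: padic_norm_def)
  hence le: "int k \<le> padic_val p x"
    using power_int_strict_increasing[of "- int k" "- padic_val p x" "real p"] one_less_p by force
  obtain u v where uv: "\<not> int p dvd v" "x = of_nat p powi padic_val p x * of_int u / of_int v"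
    using padic_val_decomp[OF False] .
  have "x = of_nat p ^ nat (padic_val p x) * (of_int u / of_int v)"
    using le by (subst uv(2)) (simp add: power_int_def)
  moreover have "of_int u / of_int v \<in> padic_integers p"
    using uv(1) unfolding padic_integers_iff by blast
  ultimately have "pdvd p (nat (padic_val p x)) x" unfolding pdvd_def by blast
  thus ?thesis by (rule pdvd_mono) (use le in auto)
qed (simp add: pdvd_zero)

section \<open>Hensel digits as congruences\<close>

lemma hensel_digit_bounds: "0 \<le> hensel_digit p x i" "hensel_digit p x i < int p"
  using hensel_expansion_hensel_digit[OF p, of x] unfolding hensel_expansion_def by auto

lemma pdvd_dig: "pdvd p 0 (dig p x i)"
  by (rule pdvd_of_int)

lemma hensel_partial_sum:
  obtains m N where "m \<le> 0" "N \<ge> int k" "\<And>i. i < m \<Longrightarrow> hensel_digit p x i = 0"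
    "pdvd p k (x - (\<Sum>i = m..N. dig p x i * of_nat p powi i))"
proof -
  let ?a = "hensel_digit p x"
  obtain m0 where m0: "\<forall>i<m0. ?a i = 0"
    "((\<lambda>N. padic_norm p (x - (\<Sum>i = m0..N. of_int (?a i) * of_nat p powi i))) \<longlongrightarrow> 0) at_top"
    using hensel_expansion_hensel_digit[OF p, of x] unfolding hensel_expansion_def by blast
  \<comment> \<open>The lower end is moved to a nonpositive index, padding with zero digits, so that
    the digits 0 to k - 1 all lie in the range.\<close>
  define m where "m = min m0 0"
  have eq: "(\<Sum>i = m0..N. of_int (?a i) * of_nat p powi i :: rat)
      = (\<Sum>i = m..N. of_int (?a i) * of_nat p powi i)" for N
    by (rule sum.mono_neutral_left) (use m0 m_def in auto)
  have "0 < real p powi (- int k)" using one_less_p by simp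
  from eventually_conj[OF order_tendstoD(2)[OF m0(2) this] eventually_ge_at_top[of "int k"]]
  obtain N where N: "padic_norm p (x - (\<Sum>i = m0..N. of_int (?a i) * of_nat p powi i))
      < real p powi (- int k)" "N \<ge> int k"
    using eventually_happens'[OF trivial_limit_at_top_linorder] by blast
  show ?thesis
  proof (rule that[of m N])
    show "pdvd p k (x - (\<Sum>i = m..N. dig p x i * of_nat p powi i))"
      using N(1) unfolding eq by (intro pdvd_of_norm_le) simp
  qed (use N m0 m_def in auto)
qed

lemma pdvd_powi_sum:
  assumes "\<And>i. i \<in> A \<Longrightarrow> int k \<le> i"
  shows "pdvd p k (\<Sum>i\<in>A. of_int (c i) * of_nat p powi i)"
proof (rule pdvd_sum)
  fix i assume "i \<in> A"
  hence i: "int k \<le> i" by (rule assms)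
  have "pdvd p (nat i) (of_nat p powi i)"
    using pdvd_power_self[of "nat i"] i by (simp add: power_int_def)
  thus "pdvd p k (of_int (c i) * of_nat p powi i)"
    using i by (intro pdvd_lmult pdvd_of_int) (rule pdvd_mono, auto)
qed

text \<open>Take the lowest nonzero digit, at D < 0, and scale the expansion by p^(-D). Then x and
  all terms above D become divisible by p, so this digit would be divisible by p, against its
  bounds.\<close>

lemma hensel_digit_negative:
  assumes x: "pdvd p 0 x" and "j < 0"
  shows "hensel_digit p x j = 0"
proof (rule ccontr)
  let ?a = "hensel_digit p x"
  assume nz: "?a j \<noteq> 0"
  obtain m N where mN: "m \<le> 0" "N \<ge> int 0" "\<And>i. i < m \<Longrightarrow> ?a i = 0"
    "pdvd p 0 (x - (\<Sum>i = m..N. dig p x i * of_nat p powi i))"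
    using hensel_partial_sum[of 0 x] by metis
  define P where "P t \<longleftrightarrow> ?a (m + int t) \<noteq> 0" for t
  have jm: "j \<ge> m" using mN(3) nz by force
  hence Pj: "P (nat (j - m))" using nz by (simp add: P_def)
  define t where "t = (LEAST t. P t)"
  define D where "D = m + int t"
  have PD: "?a D \<noteq> 0" using LeastI[of P, OF Pj] by (simp add: P_def D_def t_def)
  have D0: "D < 0" using Least_le[of P, OF Pj] \<open>j < 0\<close> jm by (simp add: D_def t_def)
  have zero: "?a i = 0" if "m \<le> i" "i < D" for i
  proof -
    have "nat (i - m) < t" using that by (auto simp: D_def)
    from not_less_Least[OF this[unfolded t_def]] show ?thesis using that by (simp add: P_def)
  qed
  have "(\<Sum>i = m..N. dig p x i * of_nat p powi i) = (\<Sum>i = D..N. dig p x i * of_nat p powi i)"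
    by (rule sum.mono_neutral_right) (use zero D_def in auto)
  also have "\<dots> = dig p x D * of_nat p powi D + (\<Sum>i = D+1..N. dig p x i * of_nat p powi i)"
  proof -
    have "{D..N} = insert D {D+1..N}" using mN(2) D0 by auto
    thus ?thesis by simp
  qed
  finally have "pdvd p 0 (dig p x D * of_nat p powi D + (\<Sum>i = D+1..N. dig p x i * of_nat p powi i))"
    using pdvd_diff[OF x mN(4)] by simp
  from pdvd_rmult[OF pdvd_power_self[of "nat (- D)"] this]
  have total: "pdvd p (nat (- D)) (of_nat p ^ nat (- D) * (dig p x D * of_nat p powi D)
      + of_nat p ^ nat (- D) * (\<Sum>i = D+1..N. dig p x i * of_nat p powi i))"
    by (simp add: distrib_left)
  have "of_nat p ^ nat (- D) * (of_nat p powi i) = (of_nat p powi (i - D) :: rat)" for i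
  proof -
    have "(of_nat p :: rat) powi (i - D) = of_nat p powi i * of_nat p powi (- D)"
      using p_nonzero by (simp flip: power_int_add)
    thus ?thesis using D0 by (simp add: power_int_def)
  qed
  hence shift: "of_nat p ^ nat (- D) * (c * of_nat p powi i) = c * (of_nat p powi (i - D) :: rat)" for i c
    by (simp add: mult.left_commute)
  have "pdvd p 1 (\<Sum>i = 1..N - D. of_int (?a (i + D)) * of_nat p powi i)"
    by (rule pdvd_powi_sum) auto
  also have "(\<Sum>i = 1..N - D. of_int (?a (i + D)) * of_nat p powi i)
      = (\<Sum>i = D+1..N. dig p x i * (of_nat p powi (i - D) :: rat))"
    by (rule sum.reindex_bij_witness[of _ "\<lambda>i. i - D" "\<lambda>i. i + D"]) auto
  also have "\<dots> = of_nat p ^ nat (- D) * (\<Sum>i = D+1..N. dig p x i * of_nat p powi i)"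
    by (simp add: sum_distrib_left shift)
  finally have "pdvd p 1 (of_nat p ^ nat (- D) * (\<Sum>i = D+1..N. dig p x i * of_nat p powi i))" .
  from pdvd_diff[OF _ this, of "of_nat p ^ nat (- D) * (dig p x D * of_nat p powi D)
      + of_nat p ^ nat (- D) * (\<Sum>i = D+1..N. dig p x i * of_nat p powi i)"]
    pdvd_mono[OF total, of 1] D0
  have "pdvd p 1 (of_nat p ^ nat (- D) * (dig p x D * of_nat p powi D))" by simp
  hence "pdvd p 1 (of_int (?a D))" unfolding shift by simp
  hence "int p dvd ?a D" by (simp only: pdvd_of_int_iff)
  thus False using hensel_digit_bounds[of x D] PD zdvd_imp_le[of "int p" "?a D"] by simp
qed

text \<open>The bridge to congruences: from here on digits enter only through such truncations and
  through their bounds.\<close>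

lemma hensel_truncation:
  assumes x: "pdvd p 0 x"
  shows "pdvd p k (x - (\<Sum>i<k. dig p x (int i) * of_nat p ^ i))"
proof -
  let ?a = "hensel_digit p x"
  obtain m N where mN: "m \<le> 0" "N \<ge> int k" "\<And>i. i < m \<Longrightarrow> ?a i = 0"
    "pdvd p k (x - (\<Sum>i = m..N. dig p x i * of_nat p powi i))"
    using hensel_partial_sum[of k x] by metis
  have "(\<Sum>i = m..N. dig p x i * (of_nat p powi i :: rat)) = (\<Sum>i = 0..N. dig p x i * of_nat p powi i)"
    by (rule sum.mono_neutral_right) (use mN(1) hensel_digit_negative[OF x] in auto)
  also have "{0..N} = {0..<int k} \<union> {int k..N}" using mN(2) by auto
  also have "(\<Sum>i\<in>{0..<int k} \<union> {int k..N}. dig p x i * (of_nat p powi i :: rat))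
      = (\<Sum>i = 0..<int k. dig p x i * of_nat p powi i) + (\<Sum>i = int k..N. dig p x i * of_nat p powi i)"
    by (rule sum.union_disjoint) auto
  also have "(\<Sum>i = 0..<int k. dig p x i * (of_nat p powi i :: rat)) = (\<Sum>i<k. dig p x (int i) * of_nat p ^ i)"
    by (rule sum.reindex_bij_witness[of _ int nat]) (auto simp: power_int_def)
  finally have "pdvd p k (x - ((\<Sum>i<k. dig p x (int i) * of_nat p ^ i)
      + (\<Sum>i = int k..N. dig p x i * of_nat p powi i)))" using mN(4) by simp
  from pdvd_add[OF this pdvd_powi_sum[of "{int k..N}" k ?a]] show ?thesis by simp
qed

lemma dig_cong:
  assumes "pdvd p 0 x"
  shows "pdvd p 1 (x - dig p x 0)" "pdvd p 2 (x - (dig p x 0 + of_nat p * dig p x 1))"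
    "pdvd p 3 (x - (dig p x 0 + of_nat p * dig p x 1 + of_nat p ^ 2 * dig p x 2))"
  using hensel_truncation[OF assms, of 1] hensel_truncation[OF assms, of 2]
    hensel_truncation[OF assms, of 3]
  by (simp_all add: numeral_2_eq_2 numeral_3_eq_3 lessThan_Suc algebra_simps)

lemma dig_0_eq_0:
  assumes "pdvd p 1 x" shows "hensel_digit p x 0 = 0"
proof -
  have "pdvd p 1 (x - (x - dig p x 0))"
    using assms by (intro pdvd_diff dig_cong(1)) (auto intro: pdvd_mono)
  hence "int p dvd hensel_digit p x 0" by (simp add: pdvd_of_int_iff del: One_nat_def)
  thus ?thesis using hensel_digit_bounds[of x 0] zdvd_imp_le[of "int p" "hensel_digit p x 0"] by force
qed

lemma hensel_digit_eqI:
  assumes "pdvd p 1 (dig p x i - dig p x' j)"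
  shows "hensel_digit p x i = hensel_digit p x' j"
proof -
  have "pdvd p 1 (of_int (hensel_digit p x i - hensel_digit p x' j))" using assms by simp
  hence "int p dvd hensel_digit p x i - hensel_digit p x' j" by (simp only: pdvd_of_int_iff)
  thus ?thesis using hensel_digit_bounds[of x i] hensel_digit_bounds[of x' j]
    by (metis mod_eq_dvd_iff mod_pos_pos_trivial)
qed

lemma dig_1_cong:
  assumes "pdvd p 1 x" shows "pdvd p 2 (x - of_nat p * dig p x 1)"
  using dig_cong(2)[OF pdvd_mono[OF assms, of 0]] dig_0_eq_0[OF assms] by simp

lemma dig_0_eqI: "pdvd p 0 x \<Longrightarrow> pdvd p 0 x' \<Longrightarrow> pdvd p 1 (x - x') \<Longrightarrow> hensel_digit p x 0 = hensel_digit p x' 0"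
proof (rule hensel_digit_eqI)
  assume "pdvd p 0 x" "pdvd p 0 x'" and d: "pdvd p 1 (x - x')"
  from pdvd_diff[OF pdvd_add[OF d dig_cong(1)[OF this(2)]] dig_cong(1)[OF this(1)]]
  show "pdvd p 1 (dig p x 0 - dig p x' 0)" by (simp add: algebra_simps)
qed

text \<open>\<open>digit_carry\<close> has four summands; the case p - 3 has only three and pads
  with 0.\<close>

lemma dig_zero: "dig p 0 0 = 0" "dig p 0 1 = 0"
proof -
  show "dig p 0 0 = 0" using dig_0_eq_0[OF pdvd_zero] by simp
  have "hensel_digit p 0 1 = hensel_digit p 0 0"
  proof (rule hensel_digit_eqI)
    have "pdvd p (1 + 1) (of_nat p ^ 1 * dig p 0 1)"
      using pdvd_uminus[OF dig_1_cong[OF pdvd_zero]] by (simp add: numeral_2_eq_2)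
    thus "pdvd p 1 (dig p 0 1 - dig p 0 0)"
      unfolding pdvd_power_mult_iff using dig_0_eq_0[OF pdvd_zero] by simp
  qed
  thus "dig p 0 1 = 0" using dig_0_eq_0[OF pdvd_zero] by simp
qed

text \<open>The last summand in the parentheses is the carry from the lowest digits.\<close>

lemma digit_carry:
  assumes int: "pdvd p 0 x1" "pdvd p 0 x2" "pdvd p 0 x3" "pdvd p 0 x4"
    and sum: "pdvd p 1 (x1 + x2 + x3 + x4)"
  shows "pdvd p 2 (x1 + x2 + x3 + x4 - of_nat p * (dig p x1 1 + dig p x2 1 + dig p x3 1 + dig p x4 1
    + dig p (dig p x1 0 + dig p x2 0 + dig p x3 0 + dig p x4 0) 1))"
proof -
  let ?c = "dig p x1 0 + dig p x2 0 + dig p x3 0 + dig p x4 0"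
  note d0 = dig_cong(1)[OF int(1)] dig_cong(1)[OF int(2)] dig_cong(1)[OF int(3)] dig_cong(1)[OF int(4)]
  note d1 = dig_cong(2)[OF int(1)] dig_cong(2)[OF int(2)] dig_cong(2)[OF int(3)] dig_cong(2)[OF int(4)]
  have "pdvd p 1 ((x1 + x2 + x3 + x4)
      - ((x1 - dig p x1 0) + (x2 - dig p x2 0) + (x3 - dig p x3 0) + (x4 - dig p x4 0)))"
    by (intro pdvd_diff pdvd_add sum d0)
  hence "pdvd p 1 ?c" by (simp add: algebra_simps)
  hence "pdvd p 2 (?c - of_nat p * dig p ?c 1)" by (rule dig_1_cong)
  from pdvd_add[OF pdvd_add[OF pdvd_add[OF pdvd_add[OF d1(1) d1(2)] d1(3)] d1(4)] this]
  show ?thesis by (simp add: algebra_simps)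
qed

end

section \<open>Bernoulli numbers and power sums\<close>

text \<open>The series X/(e^X - 1); \<open>bernoulli_egf_mult\<close> says so without a
  quotient.\<close>

definition bernoulli_egf :: "rat fps"
  where "bernoulli_egf = Abs_fps (\<lambda>k. bernoulli k / fact k)"

lemma sum_binomial_bernoulli: "(\<Sum>k\<le>n. of_nat (n + 1 choose k) * bernoulli k) = (if n = 0 then 1 else 0)"
proof (cases n)
  case (Suc m)
  have "(\<Sum>k\<le>m. of_nat (m + 2 choose k) * bernoulli k) + of_nat (m + 2) * bernoulli (m + 1) = 0"
    by simp
  thus ?thesis using Suc by (simp add: atMost_Suc del: bernoulli.simps)
qed simp

lemma bernoulli_egf_mult: "bernoulli_egf * (fps_exp 1 - 1) = fps_X"
proof (rule fps_ext)
  fix n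
  show "(bernoulli_egf * (fps_exp 1 - 1)) $ n = fps_X $ n"
  proof (cases n)
    case (Suc m)
    have "(bernoulli_egf * (fps_exp 1 - 1)) $ n
        = (\<Sum>k\<le>n. bernoulli k / fact k * (1 / fact (n - k) - (if n - k = 0 then 1 else 0)))"
      by (simp add: fps_mult_nth bernoulli_egf_def fps_exp_def fps_one_nth atLeast0AtMost)
    also have "\<dots> = (\<Sum>k\<le>m. bernoulli k / fact k * (1 / fact (n - k)))"
      using Suc by (simp add: atMost_Suc mult.commute)
    also have "\<dots> = (\<Sum>k\<le>m. of_nat (m + 1 choose k) * bernoulli k) / fact n"
      unfolding sum_divide_distrib
      by (intro sum.cong) (use Suc in \<open>auto simp: binomial_fact field_simps simp del: fact_Suc binomial_Suc_Suc\<close>)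
    also have "\<dots> = fps_X $ n" unfolding sum_binomial_bernoulli using Suc by (auto simp: fps_X_def)
    finally show ?thesis .
  qed (simp add: fps_mult_nth)
qed

lemma fps_exp_1_minus_1_neq_0: "fps_exp (1 :: rat) - 1 \<noteq> 0"
proof
  assume "fps_exp (1 :: rat) - 1 = 0"
  from arg_cong[OF this, of "\<lambda>f. f $ 1"] show False by simp
qed

text \<open>For f = X/(e^X - 1), substituting -X and multiplying by e^X gives f(-X) = f(X) + X, so f
  is even up to its linear term.\<close>

lemma bernoulli_odd:
  assumes "odd n" "n \<noteq> 1" shows "bernoulli n = 0"
proof -
  let ?m = "fps_const (- 1) * fps_X :: rat fps"
  have "(bernoulli_egf oo ?m) * ((fps_exp 1 - 1) oo ?m) = fps_X oo ?m"
    unfolding bernoulli_egf_mult[symmetric] by (rule fps_compose_mult_distrib[symmetric]) simp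
  hence "(bernoulli_egf oo ?m) * (fps_exp (- 1) - 1) = - fps_X"
    by (simp add: fps_compose_sub_distrib fps_exp_compose_linear)
  hence "(bernoulli_egf oo ?m) * (fps_exp (- 1) - 1) * fps_exp 1 = - fps_X * fps_exp 1" by simp
  hence "(bernoulli_egf oo ?m) * (fps_exp (- 1) * fps_exp 1) - (bernoulli_egf oo ?m) * fps_exp 1
      = - fps_X * fps_exp 1"
    by (simp only: left_diff_distrib right_diff_distrib mult_1_left mult_1_right mult.assoc)
  moreover have "fps_exp (- 1) * fps_exp (1 :: rat) = 1"
    by (simp flip: fps_exp_add_mult)
  ultimately have "(bernoulli_egf oo ?m) * 1 - (bernoulli_egf oo ?m) * fps_exp 1 = - fps_X * fps_exp 1"
    by (simp only:)
  hence "(bernoulli_egf oo ?m) * (fps_exp 1 - 1) = fps_X * fps_exp 1"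
    by (simp add: algebra_simps)
  also have "\<dots> = bernoulli_egf * (fps_exp 1 - 1) + fps_X * (fps_exp 1 - 1)"
    unfolding bernoulli_egf_mult by (simp add: algebra_simps)
  finally have "(bernoulli_egf oo ?m) * (fps_exp 1 - 1) = (bernoulli_egf + fps_X) * (fps_exp 1 - 1)"
    by (simp add: algebra_simps)
  hence "bernoulli_egf oo ?m = bernoulli_egf + fps_X" using fps_exp_1_minus_1_neq_0 by simp
  hence "(bernoulli_egf oo ?m) $ n = (bernoulli_egf + fps_X) $ n" by simp
  thus ?thesis using assms by (simp add: fps_compose_linear bernoulli_egf_def fps_X_nth)
qed

lemma sum_fps_exp: "(\<Sum>a<N. fps_exp (of_nat a :: rat)) * (fps_exp 1 - 1) = fps_exp (of_nat N) - 1"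
proof (induction N)
  case (Suc N)
  have "fps_exp (of_nat (Suc N) :: rat) = fps_exp (of_nat N) * fps_exp 1"
    by (simp add: add.commute flip: fps_exp_add_mult)
  thus ?case using Suc by (simp add: algebra_simps)
qed simp

definition power_sum :: "nat \<Rightarrow> nat \<Rightarrow> rat"
  where "power_sum N m = (\<Sum>a<N. of_nat a ^ m)"

text \<open>Faulhaber's formula, from multiplying the geometric sum of the e^(aX) by X/(e^X - 1). It
  is ordered by powers of N because N = p later on: the term i = 0 is then p B_m and the others
  carry higher powers of p.\<close>

lemma power_sum_bernoulli:
  "power_sum N m = (\<Sum>i\<le>m. of_nat (m choose i) * bernoulli (m - i) * of_nat N ^ (i + 1) / of_nat (i + 1))"
proof -
  let ?S = "\<Sum>a<N. fps_exp (of_nat a :: rat)"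
  have "?S * fps_X * (fps_exp 1 - 1) = bernoulli_egf * (fps_exp (of_nat N) - 1) * (fps_exp 1 - 1)"
    unfolding sum_fps_exp[symmetric] bernoulli_egf_mult[symmetric] by (simp only: mult_ac)
  hence "?S * fps_X = bernoulli_egf * (fps_exp (of_nat N) - 1)"
    using fps_exp_1_minus_1_neq_0 by simp
  hence "(?S * fps_X) $ (m + 1) = (bernoulli_egf * (fps_exp (of_nat N) - 1)) $ (m + 1)" by simp
  also have "(?S * fps_X) $ (m + 1) = power_sum N m / fact m"
    by (simp add: fps_sum_nth power_sum_def sum_divide_distrib)
  also have "(bernoulli_egf * (fps_exp (of_nat N) - 1)) $ (m + 1)
      = (\<Sum>k\<le>m + 1. bernoulli k / fact k * (of_nat N ^ (m + 1 - k) / fact (m + 1 - k)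
          - (if m + 1 - k = 0 then 1 else 0)))"
    by (simp add: fps_mult_nth bernoulli_egf_def fps_one_nth atLeast0AtMost)
  also have "\<dots> = (\<Sum>k\<le>m. bernoulli k / fact k * (of_nat N ^ (m + 1 - k) / fact (m + 1 - k)))"
    by (simp add: atMost_Suc mult.commute)
  also have "\<dots> = (\<Sum>i\<le>m. bernoulli (m - i) / fact (m - i) * (of_nat N ^ (i + 1) / fact (i + 1)))"
    by (rule sum.reindex_bij_witness[of _ "\<lambda>i. m - i" "\<lambda>i. m - i"]) (auto simp: Suc_diff_le)
  finally have "power_sum N m = fact m * \<dots>" by (simp add: field_simps)
  also have "\<dots> = (\<Sum>i\<le>m. of_nat (m choose i) * bernoulli (m - i) * of_nat N ^ (i + 1) / of_nat (i + 1))"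
    unfolding sum_distrib_left by (intro sum.cong) (auto simp: binomial_fact field_simps)
  finally show ?thesis .
qed

text \<open>The 5 is tuned to precision p^4: for j \<le> 4 and j \<le> i it yields i + 1 < p^(i - j
  + 1).\<close>

lemma linear_less_power:
  assumes "q \<ge> (11 :: nat)" shows "k + 5 < q ^ (k + 1)"
proof (induction k)
  case (Suc k)
  have "Suc k + 5 \<le> 2 * (k + 5)" by simp
  also have "\<dots> \<le> q * (k + 5)" using assms by (intro mult_le_mono1) simp
  also have "\<dots> < q * q ^ (k + 1)" using Suc assms by simp
  finally show ?case by simp
qed (use assms in simp)

context padic_prime
begin

lemma not_dvd_small: "0 < m \<Longrightarrow> m < p \<Longrightarrow> \<not> p dvd m"
  by (auto dest: dvd_imp_le)

text \<open>The recursion for B_k divides only by k + 1 < p.\<close>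

lemma pdvd_bernoulli_small: "k < p - 1 \<Longrightarrow> pdvd p 0 (bernoulli k)"
proof (induction k rule: less_induct)
  case (less k)
  show ?case
  proof (cases k)
    case 0 thus ?thesis using pdvd_of_int[of 1] by simp
  next
    case (Suc n)
    have "pdvd p 0 (- (\<Sum>k\<le>n. of_nat (Suc (Suc n) choose k) * bernoulli k))"
      using less Suc by (intro pdvd_uminus pdvd_sum pdvd_lmult pdvd_of_nat) auto
    hence "pdvd p 0 (- (\<Sum>k\<le>n. of_nat (Suc (Suc n) choose k) * bernoulli k) / of_nat (Suc (Suc n)))"
      by (rule pdvd_divide_nat) (use less.prems Suc in \<open>intro not_dvd_small, auto\<close>)
    thus ?thesis using Suc by simp
  qed
qed

lemma pdvd_power_sum: "pdvd p 0 (power_sum N m)"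
  unfolding power_sum_def by (intro pdvd_sum) (use pdvd_of_nat in \<open>simp flip: of_nat_power\<close>)

lemma power_sum_fermat:
  assumes "m \<ge> 1" shows "pdvd p 1 (power_sum p (m + (p - 1)) - power_sum p m)"
proof -
  have "pdvd p 1 (of_nat a ^ (m + (p - 1)) - of_nat a ^ m)" if "a < p" for a
  proof -
    have "[a ^ (m + (p - 1)) = a ^ m] (mod p)"
    proof (cases "a = 0")
      \<comment> \<open>For a = 0 the congruence rests on m \<ge> 1, as 0^0 = 1.\<close>
      case True
      thus ?thesis using assms by (cases m) simp_all
    next
      case False
      hence "[a ^ (p - 1) = 1] (mod p)" using that p by (intro fermat_theorem not_dvd_small) auto
      from cong_scalar_left[OF this, of "a ^ m"] show ?thesis by (simp add: power_add)
    qed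
    hence "[int (a ^ (m + (p - 1))) = int (a ^ m)] (mod int p)" by (simp only: cong_int_iff)
    hence "int p dvd int (a ^ (m + (p - 1))) - int (a ^ m)" by (simp only: cong_iff_dvd_diff)
    hence "pdvd p 1 (of_int (int (a ^ (m + (p - 1))) - int (a ^ m)))" by (simp only: pdvd_of_int_iff)
    thus ?thesis by simp
  qed
  thus ?thesis unfolding power_sum_def sum_subtractf[symmetric] by (intro pdvd_sum) auto
qed

end

section \<open>Faulhaber's formula at N = p up to precision p^4\<close>

locale padic_large_prime = padic_prime +
  assumes p_ge_11: "p \<ge> 11"
begin

lemma pdvd_2: "pdvd p k x \<Longrightarrow> pdvd p k (x / 2)" and pdvd_3: "pdvd p k x \<Longrightarrow> pdvd p k (x / 3)"
  and pdvd_4: "pdvd p k x \<Longrightarrow> pdvd p k (x / 4)" and pdvd_6: "pdvd p k x \<Longrightarrow> pdvd p k (x / 6)"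
  using pdvd_divide_nat[OF _ not_dvd_small, of k x 2] pdvd_divide_nat[OF _ not_dvd_small, of k x 3]
    pdvd_divide_nat[OF _ not_dvd_small, of k x 4] pdvd_divide_nat[OF _ not_dvd_small, of k x 6] p_ge_11 by auto

text \<open>Since i + 1 < p^(i - j + 1), dividing by i + 1 costs at most i - j of the i factors
  p.\<close>

lemma pdvd_power_divide:
  assumes "j \<le> 4" "j \<le> i" shows "pdvd p j (of_nat p ^ i / of_nat (i + 1))"
proof -
  have "i + 1 \<le> (i - j) + 5" using assms by simp
  also have "\<dots> < p ^ (i - j + 1)" by (rule linear_less_power[OF p_ge_11])
  finally have "pdvd p 0 (of_nat p ^ (i - j) / of_nat (i + 1))"
    by (intro pdvd_divide_nat_power) auto
  hence "pdvd p (j + 0) (of_nat p ^ j * (of_nat p ^ (i - j) / of_nat (i + 1)))"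
    by (simp only: pdvd_power_mult_iff)
  thus ?thesis using assms by (simp flip: power_add)
qed

text \<open>A weak form of von Staudt's theorem, by induction: in Faulhaber's formula for the
  integer \<open>power_sum p m\<close>, every term after p B_m is a binomial coefficient times (p
  B_(m-i)) p^i / (i + 1).\<close>

lemma pdvd_p_bernoulli: "pdvd p 0 (of_nat p * bernoulli m)"
proof (induction m rule: less_induct)
  case (less m)
  have "power_sum p m = of_nat p * bernoulli m + (\<Sum>i\<in>{1..m}. of_nat (m choose i)
      * bernoulli (m - i) * of_nat p ^ (i + 1) / of_nat (i + 1))"
    unfolding power_sum_bernoulli atMost_atLeast0 by (simp add: sum.atLeast_Suc_atMost)
  moreover have "pdvd p 0 (\<Sum>i\<in>{1..m}. of_nat (m choose i)
      * bernoulli (m - i) * of_nat p ^ (i + 1) / of_nat (i + 1))"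
  proof (rule pdvd_sum)
    fix i assume i: "i \<in> {1..m}"
    have "pdvd p 0 (of_nat (m choose i) * ((of_nat p * bernoulli (m - i)) * (of_nat p ^ i / of_nat (i + 1))))"
      by (rule pdvd_lmult[OF pdvd_of_nat pdvd_lmult[OF less pdvd_power_divide]]) (use i in auto)
    thus "pdvd p 0 (of_nat (m choose i) * bernoulli (m - i) * of_nat p ^ (i + 1) / of_nat (i + 1))"
      by (simp add: mult_ac)
  qed
  ultimately show ?case using pdvd_diff[OF pdvd_power_sum[of p m]] by fastforce
qed

lemma pdvd_bernoulli_term:
  assumes "j \<le> 4" "j \<le> i"
  shows "pdvd p j (of_nat (m choose i) * bernoulli (m - i) * of_nat p ^ (i + 1) / of_nat (i + 1))"
proof -
  have "pdvd p j (of_nat (m choose i) * ((of_nat p * bernoulli (m - i)) * (of_nat p ^ i / of_nat (i + 1))))"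
    using assms by (intro pdvd_lmult pdvd_of_nat pdvd_p_bernoulli pdvd_power_divide)
  thus ?thesis by (simp add: mult_ac)
qed

text \<open>One power of p more than in \<open>pdvd_bernoulli_term\<close>, because no factor p is
  spent on the denominator of the Bernoulli number.\<close>

lemma pdvd_bernoulli_term':
  assumes "j \<le> 4" "j \<le> i + 1" "pdvd p 0 (bernoulli (m - i))"
  shows "pdvd p j (of_nat (m choose i) * bernoulli (m - i) * of_nat p ^ (i + 1) / of_nat (i + 1))"
proof (cases j)
  case 0
  thus ?thesis using pdvd_bernoulli_term[of 0 i m] by simp
next
  case (Suc l)
  have "pdvd p (1 + l) (of_nat (m choose i) * (bernoulli (m - i) * (of_nat p * (of_nat p ^ i / of_nat (i + 1)))))"
    using assms Suc by (intro pdvd_lmult pdvd_of_nat pdvd_mult[OF pdvd_self] pdvd_power_divide) auto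
  thus ?thesis using Suc by (simp add: mult_ac)
qed

lemma power_sum_mod_p: "pdvd p 1 (power_sum p m - of_nat p * bernoulli m)"
proof -
  have "power_sum p m - of_nat p * bernoulli m = (\<Sum>i\<in>{1..m}. of_nat (m choose i)
      * bernoulli (m - i) * of_nat p ^ (i + 1) / of_nat (i + 1))"
    unfolding power_sum_bernoulli atMost_atLeast0 by (simp add: sum.atLeast_Suc_atMost)
  moreover have "pdvd p 1 (\<Sum>i\<in>{1..m}. of_nat (m choose i)
      * bernoulli (m - i) * of_nat p ^ (i + 1) / of_nat (i + 1))"
    by (rule pdvd_sum, rule pdvd_bernoulli_term) auto
  ultimately show ?thesis by simp
qed

text \<open>Fermat's theorem lowers the exponent to its nonzero residue r < p - 1, where B_r is
  p-integral and the power sum is p B_r modulo p.\<close>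

lemma pdvd_1_power_sum:
  assumes "\<not> (p - 1) dvd m" shows "pdvd p 1 (power_sum p m)"
proof -
  have "pdvd p 1 (power_sum p (r + (p - 1) * q))" if r: "0 < r" "r < p - 1" for r q
  proof (induction q)
    case 0
    have "pdvd p 1 (of_nat p * bernoulli r)"
      using pdvd_mult[OF pdvd_self pdvd_bernoulli_small[OF r(2)]] by simp
    from pdvd_add[OF this power_sum_mod_p[of r]] show ?case by simp
  next
    case (Suc q)
    have "r + (p - 1) * Suc q = r + (p - 1) * q + (p - 1)" by simp
    thus ?case using pdvd_add[OF Suc power_sum_fermat[of "r + (p - 1) * q"]] r by simp
  qed
  moreover have "0 < m mod (p - 1)" using assms by (simp add: dvd_eq_mod_eq_0)
  moreover have "m mod (p - 1) < p - 1" using p_ge_11 by simp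
  ultimately show ?thesis by (metis mod_mult_div_eq)
qed

lemma pdvd_bernoulli:
  assumes "\<not> (p - 1) dvd m" shows "pdvd p 0 (bernoulli m)"
proof -
  have "pdvd p 1 (of_nat p * bernoulli m)"
    using pdvd_diff[OF pdvd_1_power_sum[OF assms] power_sum_mod_p[of m]] by simp
  thus ?thesis using pdvd_power_mult_iff[of 1 0 "bernoulli m"] by simp
qed

text \<open>Below p - 1 all Bernoulli numbers are p-integral, so the terms i \<ge> 2 vanish modulo
  p^3. Odd m is included on purpose: for m \<ge> 3 the term with B_(m-1) is then the leading one,
  which later bounds the odd coefficients of P.\<close>

lemma power_sum_mod_p3:
  assumes "1 \<le> m" "m < p - 1"
  shows "pdvd p 3 (power_sum p m - (of_nat p * bernoulli m + of_nat m * of_nat p ^ 2 / 2 * bernoulli (m - 1)))"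
proof -
  let ?t = "\<lambda>i. of_nat (m choose i) * bernoulli (m - i) * of_nat p ^ (i + 1) / of_nat (i + 1)"
  have "power_sum p m = sum ?t {0, 1} + sum ?t {2..m}"
  proof -
    have "{..m} = {0, 1} \<union> {2..m}" using assms by auto
    thus ?thesis unfolding power_sum_bernoulli by (simp only: sum.union_disjoint) (subst sum.union_disjoint, auto)
  qed
  moreover have "pdvd p 3 (sum ?t {2..m})"
    using assms by (intro pdvd_sum pdvd_bernoulli_term' pdvd_bernoulli_small) auto
  ultimately show ?thesis by (simp add: power2_eq_square algebra_simps)
qed

lemma power_sum_mod_p4:
  assumes "even m" "4 \<le> m"
  shows "pdvd p 4 (power_sum p m - (of_nat p * bernoulli m + of_nat (m choose 2) * of_nat p ^ 3 / 3 * bernoulli (m - 2)))"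
proof -
  let ?t = "\<lambda>i. of_nat (m choose i) * bernoulli (m - i) * of_nat p ^ (i + 1) / of_nat (i + 1)"
  have "power_sum p m = sum ?t {0, 2} + sum ?t {1,3} + sum ?t {4..m}"
  proof -
    have "{..m} = ({0, 2} \<union> {1, 3}) \<union> {4..m}" using assms by auto
    thus ?thesis unfolding power_sum_bernoulli
      by (simp only:) (subst sum.union_disjoint, simp, simp, simp, subst sum.union_disjoint, auto)
  qed
  moreover have "pdvd p 4 (sum ?t {4..m})" by (intro pdvd_sum pdvd_bernoulli_term) auto
  \<comment> \<open>For even m these two terms involve Bernoulli numbers of odd index. All vanish
    except B_1 at m = 4, i = 3, and there p^4/4 already suffices.\<close>
  moreover have "pdvd p 4 (sum ?t {1, 3})"
  proof -
    have "pdvd p 4 (?t 3)"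
    proof (rule pdvd_bernoulli_term')
      show "pdvd p 0 (bernoulli (m - 3))"
        using assms p_ge_11 bernoulli_odd[of "m - 3"] pdvd_bernoulli_small[of 1] pdvd_zero
        by (cases "m - 3 = 1") auto
    qed auto
    moreover have "?t 1 = 0" using assms bernoulli_odd[of "m - 1"] by auto
    moreover have "sum ?t {1, 3} = ?t 1 + ?t 3" by (subst sum.insert) auto
    ultimately show ?thesis by (simp only: add_0_left)
  qed
  ultimately have "pdvd p 4 (power_sum p m - sum ?t {0, 2})"
    by (simp only: add.assoc add_diff_cancel_left' pdvd_add)
  thus ?thesis by (simp add: power3_eq_cube power2_eq_square algebra_simps numeral_3_eq_3)
qed

end

section \<open>The logarithm of the product of the $1 - aX$\<close>

definition pdvd_fps :: "nat \<Rightarrow> nat \<Rightarrow> nat \<Rightarrow> rat fps \<Rightarrow> bool"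
  where "pdvd_fps p k n F \<longleftrightarrow> (\<forall>i\<le>n. pdvd p k (F $ i))"

text \<open>Cut off after the cube: it is applied to series divisible by p, to precision
  p^4.\<close>

definition log_trunc :: "rat fps \<Rightarrow> rat fps"
  where "log_trunc y = y - fps_const (1 / 2) * y ^ 2 + fps_const (1 / 3) * y ^ 3"

text \<open>The factor a = 0 equals 1, so for N = p the degree is p - 1.\<close>

definition power_sum_poly :: "nat \<Rightarrow> rat fps"
  where "power_sum_poly N = (\<Prod>a<N. 1 - fps_const (of_nat a) * fps_X)"

text \<open>The formal logarithm of \<open>power_sum_poly N\<close>; its constant term is 0 because
  division by 0 gives 0.\<close>

definition power_sum_log :: "nat \<Rightarrow> rat fps"
  where "power_sum_log N = Abs_fps (\<lambda>m. - power_sum N m / of_nat m)"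

text \<open>The logarithm is used only through its derivative, which avoids composing power series.
  A new factor 1 - N X adds to L' the expansion \<open>?g\<close> of -N/(1 - N X).\<close>

lemma power_sum_log_deriv:
  "fps_deriv (power_sum_log N) * power_sum_poly N = fps_deriv (power_sum_poly N)"
proof (induction N)
  case 0
  show ?case by (simp add: power_sum_log_def power_sum_poly_def power_sum_def fps_eq_iff fps_mult_nth)
next
  case (Suc N)
  let ?g = "Abs_fps (\<lambda>m. - (of_nat N ^ (m + 1))) :: rat fps"
  have 1: "fps_deriv (power_sum_log (Suc N)) = fps_deriv (power_sum_log N) + ?g"
    by (rule fps_ext) (simp add: power_sum_log_def power_sum_def)
  have 2: "?g * (1 - fps_const (of_nat N) * fps_X) = - fps_const (of_nat N)"
  proof (rule fps_ext)
    have expand: "?g * (1 - fps_const (of_nat N) * fps_X) = ?g - fps_const (of_nat N) * (?g * fps_X)"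
      by (simp add: right_diff_distrib mult.left_commute)
    fix k
    show "(?g * (1 - fps_const (of_nat N) * fps_X)) $ k = (- fps_const (of_nat N)) $ k"
      unfolding expand by (cases k) simp_all
  qed
  have 3: "power_sum_poly (Suc N) = power_sum_poly N * (1 - fps_const (of_nat N) * fps_X)"
    by (simp add: power_sum_poly_def)
  have "fps_deriv (power_sum_log (Suc N)) * power_sum_poly (Suc N)
      = fps_deriv (power_sum_log N) * power_sum_poly N * (1 - fps_const (of_nat N) * fps_X)
        + power_sum_poly N * (?g * (1 - fps_const (of_nat N) * fps_X))"
    unfolding 1 3 by (simp only: algebra_simps)
  also have "\<dots> = fps_deriv (power_sum_poly (Suc N))"
    unfolding 2 3 Suc by (simp add: algebra_simps del: fps_const_neg)
  finally show ?case .
qed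

lemma power_sum_poly_nth_Suc:
  "power_sum_poly (Suc N) $ k = power_sum_poly N $ k - (if k = 0 then 0 else of_nat N * power_sum_poly N $ (k - 1))"
proof -
  have "power_sum_poly (Suc N) = power_sum_poly N - fps_const (of_nat N) * (power_sum_poly N * fps_X)"
    by (simp add: power_sum_poly_def algebra_simps)
  thus ?thesis by simp
qed

lemma power_sum_poly_nth_0: "power_sum_poly N $ 0 = 1"
  by (induction N) (auto simp: power_sum_poly_nth_Suc, auto simp: power_sum_poly_def)

lemma power_sum_poly_nth_top:
  "power_sum_poly (Suc N) $ N = (- 1) ^ N * fact N" "k > N \<Longrightarrow> power_sum_poly (Suc N) $ k = 0"
proof (induction N arbitrary: k)
  case 0
  {
    case 1 show ?case by (simp add: power_sum_poly_nth_0)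
  next
    case 2 thus ?case by (simp add: power_sum_poly_def)
  }
next
  case (Suc N)
  {
    case 1 show ?case using Suc(1) Suc(2)[of "Suc N"]
      by (subst power_sum_poly_nth_Suc) (simp add: algebra_simps)
  next
    case 2 thus ?case using Suc(2)[of k] Suc(2)[of "k - 1"]
      by (subst power_sum_poly_nth_Suc) simp
  }
qed

lemma geometric_shift_nth:
  fixes F G :: "rat fps"
  assumes "F * (1 - fps_X ^ N) = G"
  shows "F $ m = G $ m + (if m < N then 0 else F $ (m - N))"
proof -
  have "F = G + F * fps_X ^ N" using assms by (simp add: algebra_simps)
  hence "F $ m = (G + F * fps_X ^ N) $ m" by simp
  thus ?thesis by (simp add: fps_X_power_mult_right_nth)
qed

text \<open>Division by 1 - X^N sums coefficients within a residue class modulo N; these are the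
  first three positions of the class of n.\<close>

lemma geometric_shift_nths:
  fixes F G :: "rat fps"
  assumes "F * (1 - fps_X ^ N) = G" and n: "n < N"
  shows "F $ n = G $ n" "F $ (n + N) = G $ (n + N) + G $ n"
    "F $ (n + 2 * N) = G $ (n + 2 * N) + G $ (n + N) + G $ n"
proof -
  show 1: "F $ n = G $ n" using geometric_shift_nth[OF assms(1), of n] n by simp
  show 2: "F $ (n + N) = G $ (n + N) + G $ n" using geometric_shift_nth[OF assms(1), of "n + N"] 1 by simp
  have "n + 2 * N - N = n + N" by simp
  thus "F $ (n + 2 * N) = G $ (n + 2 * N) + G $ (n + N) + G $ n"
    using geometric_shift_nth[OF assms(1), of "n + 2 * N"] 2 n by (simp only:) simp
qed

context padic_prime
begin

lemma pdvd_fpsI: "(\<And>i. i \<le> n \<Longrightarrow> pdvd p k (F $ i)) \<Longrightarrow> pdvd_fps p k n F"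
  and pdvd_fpsD: "pdvd_fps p k n F \<Longrightarrow> i \<le> n \<Longrightarrow> pdvd p k (F $ i)"
  by (auto simp: pdvd_fps_def)

lemma pdvd_fps_mono: "pdvd_fps p k n F \<Longrightarrow> j \<le> k \<Longrightarrow> pdvd_fps p j n F"
  by (auto simp: pdvd_fps_def intro: pdvd_mono)

lemma pdvd_fps_add: "pdvd_fps p k n F \<Longrightarrow> pdvd_fps p k n G \<Longrightarrow> pdvd_fps p k n (F + G)"
  and pdvd_fps_diff: "pdvd_fps p k n F \<Longrightarrow> pdvd_fps p k n G \<Longrightarrow> pdvd_fps p k n (F - G)"
  by (auto simp: pdvd_fps_def intro: pdvd_add pdvd_diff)

lemma pdvd_fps_mult: "pdvd_fps p j n F \<Longrightarrow> pdvd_fps p k n G \<Longrightarrow> pdvd_fps p (j + k) n (F * G)"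
  by (auto simp: pdvd_fps_def fps_mult_nth intro!: pdvd_sum pdvd_mult)

lemma pdvd_fps_const: "pdvd p k c \<Longrightarrow> pdvd_fps p k n (fps_const c)"
  by (auto simp: pdvd_fps_def pdvd_zero)

lemma pdvd_fps_power: "pdvd_fps p k n F \<Longrightarrow> pdvd_fps p (k * m) n (F ^ m)"
proof (induction m)
  case 0 thus ?case using pdvd_fps_const[OF pdvd_of_int[of 1]] by simp
next
  case (Suc m) thus ?case using pdvd_fps_mult[of k n F "k * m" "F ^ m"] by simp
qed

lemma pdvd_fps_deriv: "pdvd_fps p k (Suc n) F \<Longrightarrow> pdvd_fps p k n (fps_deriv F)"
  by (auto simp: pdvd_fps_def simp del: of_nat_Suc intro!: pdvd_lmult[OF pdvd_of_nat])

text \<open>The quotient by \<open>1 + y\<close> is integral because \<open>y\<close> has no constant term.\<close>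

lemma log_deriv_trunc:
  assumes y: "pdvd_fps p 1 (Suc n) y" "y $ 0 = 0" and H: "H * (1 + y) = fps_deriv y"
  shows "pdvd_fps p 4 n (H - fps_deriv (log_trunc y))"
proof -
  define D where "D = H - fps_deriv y * (1 - y + y ^ 2)"
  have "fps_deriv (log_trunc y) = fps_deriv y - fps_const (1 / 2) * (2 * y * fps_deriv y)
      + fps_const (1 / 3) * (3 * y ^ 2 * fps_deriv y)"
    by (simp add: log_trunc_def fps_deriv_power power2_eq_square mult_ac fps_numeral_fps_const)
  also have "\<dots> = fps_deriv y - (fps_const (1 / 2) * 2) * y * fps_deriv y
      + (fps_const (1 / 3) * 3) * y ^ 2 * fps_deriv y" by (simp only: mult.assoc)
  also have "\<dots> = fps_deriv y * (1 - y + y ^ 2)"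
    by (simp add: fps_numeral_fps_const algebra_simps)
  finally have D: "H - fps_deriv (log_trunc y) = D" by (simp add: D_def)
  \<comment> \<open>Multiplying the truncated derivative y'(1 - y + y^2) by 1 + y leaves only the
    error y' y^3, a product of four factors divisible by p. Working with derivatives keeps the
    denominators of y^k/k out.\<close>
  have "D * (1 + y) = fps_deriv y - fps_deriv y * ((1 - y + y ^ 2) * (1 + y))"
    using H by (simp add: D_def algebra_simps)
  also have "(1 - y + y ^ 2) * (1 + y) = 1 + y ^ 3"
    by (simp add: algebra_simps power2_eq_square power3_eq_cube)
  finally have rec: "D = - (fps_deriv y * y ^ 3) - D * y" by (simp add: algebra_simps)
  have base: "pdvd_fps p 4 n (fps_deriv y * y ^ 3)"
  proof -
    have "pdvd_fps p 1 n y" using y by (auto simp: pdvd_fps_def)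
    from pdvd_fps_mult[OF pdvd_fps_deriv[OF y(1)] pdvd_fps_power[OF this, of 3]] show ?thesis by simp
  qed
  have "pdvd p 4 (D $ i)" if "i \<le> n" for i using that
  proof (induction i rule: less_induct)
    case (less i)
    have "pdvd p 4 ((D * y) $ i)"
      unfolding fps_mult_nth
    proof (rule pdvd_sum)
      fix j assume j: "j \<in> {0..i}"
      show "pdvd p 4 (D $ j * y $ (i - j))"
      proof (cases "j = i")
        case False
        hence "pdvd p 4 (D $ j)" using less j by auto
        moreover have "pdvd p 0 (y $ (i - j))"
          using pdvd_mono[OF pdvd_fpsD[OF y(1)]] less.prems by simp
        ultimately show ?thesis by (rule pdvd_rmult)
      qed (simp add: y pdvd_zero)
    qed
    with pdvd_fpsD[OF base less.prems] have "pdvd p 4 ((- (fps_deriv y * y ^ 3) - D * y) $ i)"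
      by (simp add: pdvd_diff pdvd_uminus)
    thus ?case by (simp flip: rec)
  qed
  thus ?thesis unfolding D by (rule pdvd_fpsI)
qed

lemma pdvd_wilson_quotient: "pdvd p 0 (wilson_quotient p)"
proof -
  have "[fact (p - 1) = - 1] (mod int p)" using wilson_theorem[OF p] by simp
  hence "int p dvd fact (p - 1) + 1" by (simp add: cong_iff_dvd_diff)
  then obtain k where "fact (p - 1) + 1 = int p * k" by blast
  hence "of_int (fact (p - 1) + 1) = (of_int (int p * k) :: rat)" by (simp only:)
  hence "wilson_quotient p = of_int k" using p_nonzero by (simp add: wilson_quotient_def)
  thus ?thesis by (simp add: pdvd_of_int)
qed

lemma pdvd_power_sum_poly: "pdvd p 0 (power_sum_poly N $ k)"
proof (induction N arbitrary: k)
  case 0 show ?case by (cases k) (auto simp: power_sum_poly_def pdvd_zero pdvd_numeral)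
next
  case (Suc N) thus ?case
    by (auto simp: power_sum_poly_nth_Suc intro!: pdvd_diff pdvd_lmult pdvd_of_nat pdvd_zero)
qed

end

section \<open>Factoring 1 - X^(p-1) out of P\<close>

context padic_large_prime
begin

text \<open>
  In the notation below, $P = 1 - u + z$ with $z = s + p w u$ divisible by $p$, where $w$ is the Wilson quotient and $s$
  collects the terms of degree $1, \dots, p-2$, and $\log P = \log (1 - u) + \log (1 + y)$.
\<close>

abbreviation P where "P \<equiv> power_sum_poly p"
abbreviation L where "L \<equiv> power_sum_log p"
definition u :: "rat fps" where "u = fps_X ^ (p - 1)"
definition v :: "rat fps" where "v = inverse (1 - u)"
definition z where "z = P - (1 - u)"
definition y where "y = z * v"
definition s :: "rat fps" where "s = Abs_fps (\<lambda>k. if k \<in> {1..p - 2} then P $ k else 0)"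
abbreviation w where "w \<equiv> wilson_quotient p"

lemma even_p: "even (p - 1)"
  using prime_odd_nat[OF p] p_ge_11 by simp

lemma s_nth_eq_0: "k \<ge> p - 1 \<Longrightarrow> s $ k = 0" "s $ 0 = 0"
  using p_ge_11 by (auto simp: s_def)

text \<open>The leading coefficient of P is (p-1)! = p w - 1, with positive sign since p - 1 is
  even; subtracting 1 - u cancels the -1.\<close>

lemma z_eq: "z = s + fps_const (of_nat p * w) * u"
proof (rule fps_ext)
  fix k
  have "\<exists>N. p = Suc N" using p_ge_11 by (intro exI[of _ "p - 1"]) simp
  then obtain N where N: "p = Suc N" by blast
  have "P $ (p - 1) = fact (p - 1)" "k > p - 1 \<Longrightarrow> P $ k = 0"
    using power_sum_poly_nth_top[of N] power_sum_poly_nth_top(2)[of N k] even_p N by auto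
  moreover have "of_nat p * w = fact (p - 1) + 1" using p_nonzero by (simp add: wilson_quotient_def)
  ultimately show "z $ k = (s + fps_const (of_nat p * w) * u) $ k"
    using p_ge_11 by (cases "k = 0"; cases "k < p - 1"; cases "k = p - 1")
      (auto simp: s_def z_def u_def fps_X_power_nth power_sum_poly_nth_0)
qed

text \<open>Newton's identities, read off from L' P = P': the power sums with exponents 1 to p - 2
  are divisible by p, and the factor k < p can be cancelled.\<close>

lemma pdvd_s: "pdvd p 1 (s $ k)"
proof (cases "k \<in> {1..p - 2}")
  case True
  have "fps_deriv P $ (k - 1) = (fps_deriv L * P) $ (k - 1)" by (simp add: power_sum_log_deriv)
  also have "fps_deriv P $ (k - 1) = of_nat k * P $ k" using True by simp
  finally have "of_nat k * P $ k = (\<Sum>i = 0..k - 1. fps_deriv L $ i * P $ (k - 1 - i))"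
    by (simp add: fps_mult_nth)
  moreover have "pdvd p 1 (\<dots>)"
  proof (rule pdvd_sum, rule pdvd_rmult)
    fix i assume "i \<in> {0..k - 1}"
    hence "\<not> p - 1 dvd i + 1" using True by (auto dest!: dvd_imp_le)
    hence "pdvd p 1 (- power_sum p (i + 1))" by (intro pdvd_uminus pdvd_1_power_sum)
    thus "pdvd p 1 (fps_deriv L $ i)" by (simp add: power_sum_log_def)
  qed (rule pdvd_power_sum_poly)
  ultimately have "pdvd p 1 (of_nat k * P $ k)" by simp
  moreover have "\<not> p dvd k" using True by (intro not_dvd_small) auto
  ultimately have "pdvd p 1 (P $ k)" using pdvd_divide_nat_iff by blast
  thus ?thesis using True by (simp add: s_def)
qed (auto simp: s_def pdvd_zero)

lemma pdvd_z: "pdvd p 1 (z $ k)"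
  unfolding z_eq using pdvd_s[of k] pdvd_rmult[OF pdvd_self pdvd_wilson_quotient] pdvd_zero
  by (auto simp: u_def fps_X_power_nth intro!: pdvd_add)

lemma one_minus_u_nth_0: "(1 - u) $ 0 = 1"
  using p_ge_11 by (simp add: u_def)

lemma v_inverse: "v * (1 - u) = 1"
  unfolding v_def using one_minus_u_nth_0 by (intro inverse_mult_eq_1) simp

lemma y_mult: "y * (1 - u) = z"
  using v_inverse by (simp add: y_def mult.assoc)

lemma pdvd_y: "pdvd p 1 (y $ m)"
proof (induction m rule: less_induct)
  case (less m)
  thus ?case unfolding geometric_shift_nth[OF y_mult[unfolded u_def], of m]
    using pdvd_z p_ge_11 by (auto intro!: pdvd_add pdvd_zero)
qed

lemma y_nth_0: "y $ 0 = 0"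
  using p_ge_11 by (simp add: power_sum_poly_nth_0 y_def z_def u_def)

lemma v_nth_eq_0: "\<not> p - 1 dvd m \<Longrightarrow> v $ m = 0"
proof (induction m rule: less_induct)
  case (less m)
  have "m \<noteq> 0" using less.prems by (metis dvd_0_right)
  moreover have "v $ (m - (p - 1)) = 0" if "m \<ge> p - 1"
  proof (rule less.IH)
    show "m - (p - 1) < m" using \<open>m \<noteq> 0\<close> p_ge_11 by simp
    show "\<not> p - 1 dvd m - (p - 1)" using less.prems that by (simp only: dvd_minus_self) simp
  qed
  ultimately show ?case unfolding geometric_shift_nth[OF v_inverse[unfolded u_def], of m] by simp
qed

text \<open>Since 1 + y = P v, its logarithmic derivative is L' + v'/v, and v' = u' v^2.\<close>

lemma log_deriv_quotient: "(fps_deriv L + fps_deriv u * v) * (1 + y) = fps_deriv y"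
proof -
  have y1: "1 + y = P * v" using v_inverse by (simp add: y_def z_def algebra_simps)
  have "fps_deriv v * (1 - u) = v * fps_deriv u"
    using arg_cong[OF v_inverse, of fps_deriv] by (simp add: algebra_simps)
  hence "fps_deriv v * (v * (1 - u)) = fps_deriv u * v * v" by (simp only: mult_ac)
  hence "fps_deriv v = fps_deriv u * v * v" by (simp add: v_inverse)
  moreover have "fps_deriv y = fps_deriv (P * v)"
    using arg_cong[OF y1, of fps_deriv] by simp
  moreover have "fps_deriv (P * v) = fps_deriv L * P * v + P * fps_deriv v"
    by (simp add: power_sum_log_deriv add.commute)
  ultimately show ?thesis unfolding y1 by (auto simp: algebra_simps)
qed

text \<open>The contribution of log(1 - u) lives in degrees divisible by p - 1, which are excluded.
  As the comparison is one of derivatives, its coefficient is m times the wanted one, and p must not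
  divide m.\<close>

lemma power_sum_log_nth:
  assumes m: "\<not> p - 1 dvd m" "\<not> p dvd m"
  shows "pdvd p 4 (L $ m - log_trunc y $ m)"
proof -
  have m0: "m \<noteq> 0" using m by (metis dvd_0_right)
  have "pdvd_fps p 1 (Suc (m - 1)) y" by (intro pdvd_fpsI pdvd_y)
  from pdvd_fpsD[OF log_deriv_trunc[OF this y_nth_0 log_deriv_quotient], of "m - 1"]
  have "pdvd p 4 ((fps_deriv L + fps_deriv u * v - fps_deriv (log_trunc y)) $ (m - 1))" by simp
  moreover have "(fps_deriv u * v) $ (m - 1) = 0"
  proof -
    have "fps_deriv u = fps_const (of_nat (p - 1)) * fps_X ^ (p - 2)"
      unfolding u_def fps_deriv_power by (simp add: numeral_2_eq_2)
    hence eq: "fps_deriv u * v = fps_X ^ (p - 2) * (fps_const (of_nat (p - 1)) * v)"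
      by (simp only: mult_ac)
    moreover have "v $ (m - 1 - (p - 2)) = 0" if "\<not> m - 1 < p - 2"
    proof -
      have "m - 1 - (p - 2) = m - (p - 1)" "m \<ge> p - 1" using that p_ge_11 by auto
      thus ?thesis using m p_ge_11 by (metis v_nth_eq_0 dvd_minus_self not_le)
    qed
    ultimately show ?thesis unfolding eq by (simp add: fps_X_power_mult_nth)
  qed
  ultimately have "pdvd p 4 (of_nat m * (L $ m - log_trunc y $ m))"
    using m0 by (simp add: algebra_simps)
  thus ?thesis using pdvd_divide_nat_iff[OF m(2)] by blast
qed

end

section \<open>Coefficients at n, n + (p - 1) and n + 2(p - 1)\<close>

lemma square_cube_add:
  fixes f g c :: "'a :: comm_ring_1"
  shows "(f + c * g) ^ 2 = f ^ 2 + (2 * c) * (f * g) + c ^ 2 * g ^ 2"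
    and "(f + c * g) ^ 3 = f ^ 3 + (3 * c) * (f ^ 2 * g) + (3 * c ^ 2) * (f * g ^ 2) + c ^ 3 * g ^ 3"
  by (simp_all add: power2_eq_square power3_eq_cube algebra_simps)

lemma fps_square_cube_add:
  fixes f g :: "rat fps"
  shows "(f + fps_const c * g) ^ 2 = f ^ 2 + fps_const (2 * c) * (f * g) + fps_const (c ^ 2) * g ^ 2"
    and "(f + fps_const c * g) ^ 3
      = f ^ 3 + fps_const (3 * c) * (f ^ 2 * g) + fps_const (3 * c ^ 2) * (f * g ^ 2) + fps_const (c ^ 3) * g ^ 3"
  unfolding square_cube_add by (simp_all add: fps_numeral_fps_const fps_const_power)

lemma fps_mult_nth_eq_0:
  fixes F G :: "rat fps"
  assumes "\<And>i. i > a \<Longrightarrow> F $ i = 0" "\<And>i. i > b \<Longrightarrow> G $ i = 0" "m > a + b"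
  shows "(F * G) $ m = 0"
  unfolding fps_mult_nth
proof (rule sum.neutral, rule ballI)
  fix i assume "i \<in> {0..m}"
  show "F $ i * G $ (m - i) = 0"
    using assms by (cases "i > a") auto
qed

lemma log_trunc_nth: "log_trunc F $ m = F $ m - (F ^ 2) $ m / 2 + (F ^ 3) $ m / 3"
  by (simp add: log_trunc_def)

text \<open>With \<open>g\<close> one has log_trunc F = F + F^2 g, so both differences are exact
  multiples of F^4; the 2/3 comes from 2g + 1 = (2/3) F.\<close>

lemma log_trunc_powers:
  fixes F :: "rat fps"
  defines "g \<equiv> fps_const (1 / 3) * F - fps_const (1 / 2)"
  shows "log_trunc F ^ 2 - (F ^ 2 - F ^ 3) = F ^ 4 * (fps_const (2 / 3) + g ^ 2)"
    and "log_trunc F ^ 3 - F ^ 3 = F ^ 4 * (g * (3 + 3 * (F * g) + (F * g) ^ 2))"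
proof -
  have lt: "log_trunc F = F + F * (F * g)"
    by (simp add: log_trunc_def g_def power2_eq_square power3_eq_cube algebra_simps)
  have g2: "2 * g = fps_const (2 / 3) * F - 1"
    by (simp add: g_def algebra_simps fps_numeral_fps_const)
  have "log_trunc F ^ 2 - (F ^ 2 - F ^ 3) = F ^ 3 * (2 * g) + F ^ 4 * g ^ 2 + F ^ 3"
    unfolding lt by (simp add: power2_eq_square power3_eq_cube power4_eq_xxxx algebra_simps)
  also have "\<dots> = F ^ 4 * (fps_const (2 / 3) + g ^ 2)"
    unfolding g2 by (simp add: power2_eq_square power3_eq_cube power4_eq_xxxx algebra_simps)
  finally show "log_trunc F ^ 2 - (F ^ 2 - F ^ 3) = F ^ 4 * (fps_const (2 / 3) + g ^ 2)" .
  show "log_trunc F ^ 3 - F ^ 3 = F ^ 4 * (g * (3 + 3 * (F * g) + (F * g) ^ 2))"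
    unfolding lt by (simp add: power2_eq_square power3_eq_cube power4_eq_xxxx algebra_simps)
qed

context padic_large_prime
begin

abbreviation pw where "pw \<equiv> of_nat p * w"

lemma pdvd_pw: "pdvd p 1 pw"
  using pdvd_rmult[OF pdvd_self pdvd_wilson_quotient] .

lemma pdvd_fps_s: "pdvd_fps p 1 m s"
  by (intro pdvd_fpsI pdvd_s)

lemma pdvd_s_powers: "pdvd p 2 ((s ^ 2) $ m)" "pdvd p 3 ((s ^ 3) $ m)"
  using pdvd_fpsD[OF pdvd_fps_power[OF pdvd_fps_s, of 2], of m m]
    pdvd_fpsD[OF pdvd_fps_power[OF pdvd_fps_s, of 3], of m m] by simp_all

lemma s_square_nth_eq_0: "m > 2 * (p - 2) \<Longrightarrow> (s ^ 2) $ m = 0"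
  unfolding power2_eq_square by (rule fps_mult_nth_eq_0[of "p - 2" _ "p - 2"]) (auto intro!: s_nth_eq_0)

context
  fixes n n' n'' :: nat
  assumes n: "3 \<le> n" "n < p - 1"
  defines "n' \<equiv> n + (p - 1)" and "n'' \<equiv> n + 2 * (p - 1)"
begin

lemma z_nths: "z $ n = s $ n" "z $ n' = 0" "z $ n'' = 0"
  using n by (auto simp: z_eq u_def n'_def n''_def fps_X_power_nth s_nth_eq_0)

lemma z_square_nths: "(z ^ 2) $ n = (s ^ 2) $ n" "(z ^ 2) $ n' = (s ^ 2) $ n' + 2 * pw * s $ n" "(z ^ 2) $ n'' = 0"
proof -
  have z2: "z ^ 2 = s ^ 2 + fps_const (2 * pw) * (s * fps_X ^ (p - 1)) + fps_const (pw ^ 2) * fps_X ^ ((p - 1) * 2)"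
    unfolding z_eq u_def fps_square_cube_add by (simp only: power_mult)
  show "(z ^ 2) $ n = (s ^ 2) $ n" "(z ^ 2) $ n' = (s ^ 2) $ n' + 2 * pw * s $ n" "(z ^ 2) $ n'' = 0"
    unfolding z2 using n
    by (auto simp: n'_def n''_def fps_X_power_mult_right_nth fps_X_power_nth s_nth_eq_0 s_square_nth_eq_0)
qed

lemma z_cube_nths: "(z ^ 3) $ n = (s ^ 3) $ n" "(z ^ 3) $ n' = (s ^ 3) $ n' + 3 * pw * (s ^ 2) $ n"
  "(z ^ 3) $ n'' = (s ^ 3) $ n'' + 3 * pw * (s ^ 2) $ n' + 3 * pw ^ 2 * s $ n"
proof -
  have z3: "z ^ 3 = s ^ 3 + fps_const (3 * pw) * (s ^ 2 * fps_X ^ (p - 1))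
      + fps_const (3 * pw ^ 2) * (s * fps_X ^ ((p - 1) * 2)) + fps_const (pw ^ 3) * fps_X ^ ((p - 1) * 3)"
    unfolding z_eq u_def fps_square_cube_add by (simp only: power_mult)
  have "n + 2 * (p - 1) - (p - 1) = n + (p - 1)" by simp
  thus "(z ^ 3) $ n = (s ^ 3) $ n" "(z ^ 3) $ n' = (s ^ 3) $ n' + 3 * pw * (s ^ 2) $ n"
    "(z ^ 3) $ n'' = (s ^ 3) $ n'' + 3 * pw * (s ^ 2) $ n' + 3 * pw ^ 2 * s $ n"
    unfolding z3 using n
    by (auto simp: n'_def n''_def fps_X_power_mult_right_nth fps_X_power_nth s_nth_eq_0)
qed

text \<open>Here y^j = z^j/(1 - u)^j, and the factors 1, 2, 3 and 1, 3, 6 are the coefficients of (1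
  - u)^(-2) and (1 - u)^(-3). One factor 1 - u is divided out at a time, through y z, y^2 and
  through y z^2, y^2 z, y^3.\<close>

lemma log_trunc_y_nths:
  "log_trunc y $ n = s $ n - (s ^ 2) $ n / 2 + (s ^ 3) $ n / 3"
  "log_trunc y $ n' = s $ n - (2 * (s ^ 2) $ n + (s ^ 2) $ n' + 2 * pw * s $ n) / 2 + (3 * (s ^ 3) $ n + (s ^ 3) $ n' + 3 * pw * (s ^ 2) $ n) / 3"
  "log_trunc y $ n'' = s $ n - (3 * (s ^ 2) $ n + 2 * (s ^ 2) $ n' + 4 * pw * s $ n) / 2
     + (6 * (s ^ 3) $ n + 3 * (s ^ 3) $ n' + 9 * pw * (s ^ 2) $ n + (s ^ 3) $ n'' + 3 * pw * (s ^ 2) $ n' + 3 * pw ^ 2 * s $ n) / 3"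
proof -
  have yz: "y * (1 - fps_X ^ (p - 1)) = z" using y_mult by (simp only: u_def)
  have "y * z * (1 - fps_X ^ (p - 1)) = y * (1 - fps_X ^ (p - 1)) * z"
    "y ^ 2 * (1 - fps_X ^ (p - 1)) = y * (y * (1 - fps_X ^ (p - 1)))"
    "y * z ^ 2 * (1 - fps_X ^ (p - 1)) = y * (1 - fps_X ^ (p - 1)) * z ^ 2"
    "y ^ 2 * z * (1 - fps_X ^ (p - 1)) = y * (y * (1 - fps_X ^ (p - 1))) * z"
    "y ^ 3 * (1 - fps_X ^ (p - 1)) = y ^ 2 * (y * (1 - fps_X ^ (p - 1)))"
    by (simp_all only: power2_eq_square power3_eq_cube mult_ac)
  note this[unfolded yz, folded power2_eq_square]
  hence "y * z * (1 - fps_X ^ (p - 1)) = z ^ 2" "y ^ 2 * (1 - fps_X ^ (p - 1)) = y * z"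
    "y * z ^ 2 * (1 - fps_X ^ (p - 1)) = z ^ 3" "y ^ 2 * z * (1 - fps_X ^ (p - 1)) = y * z ^ 2"
    "y ^ 3 * (1 - fps_X ^ (p - 1)) = y ^ 2 * z"
    by (simp_all add: power2_eq_square power3_eq_cube mult_ac)
  note shifts = this[THEN geometric_shift_nths(1), OF n(2)]
    this[THEN geometric_shift_nths(2), OF n(2), folded n'_def]
    this[THEN geometric_shift_nths(3), OF n(2), folded n''_def n'_def]
    geometric_shift_nths[OF yz n(2), folded n''_def n'_def]
  show "log_trunc y $ n = s $ n - (s ^ 2) $ n / 2 + (s ^ 3) $ n / 3"
    unfolding log_trunc_nth shifts z_nths z_square_nths z_cube_nths ..
  show "log_trunc y $ n' = s $ n - (2 * (s ^ 2) $ n + (s ^ 2) $ n' + 2 * pw * s $ n) / 2 + (3 * (s ^ 3) $ n + (s ^ 3) $ n' + 3 * pw * (s ^ 2) $ n) / 3"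
    unfolding log_trunc_nth shifts z_nths z_square_nths z_cube_nths by (simp add: field_simps)
  show "log_trunc y $ n'' = s $ n - (3 * (s ^ 2) $ n + 2 * (s ^ 2) $ n' + 4 * pw * s $ n) / 2
     + (6 * (s ^ 3) $ n + 3 * (s ^ 3) $ n' + 9 * pw * (s ^ 2) $ n + (s ^ 3) $ n'' + 3 * pw * (s ^ 2) $ n' + 3 * pw ^ 2 * s $ n) / 3"
    unfolding log_trunc_nth shifts z_nths z_square_nths z_cube_nths by (simp add: field_simps)
qed

text \<open>The bound n \<ge> 3 enters here: modulo p the three indices are n, n - 1 and n - 2, all
  nonzero.\<close>

lemma log_nths:
  "pdvd p 4 (L $ n - log_trunc y $ n)" "pdvd p 4 (L $ n' - log_trunc y $ n')"
  "pdvd p 4 (L $ n'' - log_trunc y $ n'')"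
proof -
  have dvd: "p - 1 dvd a \<longleftrightarrow> p - 1 dvd n" if "a \<in> {n, n', n''}" for a
    using that by (auto simp: n'_def n''_def)
  have "\<not> p - 1 dvd n" using n by (auto dest: dvd_imp_le)
  moreover have "\<not> p dvd n" using n by (intro not_dvd_small) auto
  moreover have "\<not> p dvd n'"
  proof -
    have "n' = p + (n - 1)" using n p_ge_11 by (simp add: n'_def)
    thus ?thesis using not_dvd_small[of "n - 1"] n by (simp only: dvd_add_triv_left_iff) auto
  qed
  moreover have "\<not> p dvd n''"
  proof -
    have "n'' = p + (p + (n - 2))" using n p_ge_11 by (simp add: n''_def)
    thus ?thesis using not_dvd_small[of "n - 2"] n by (simp only: dvd_add_triv_left_iff) auto
  qed
  ultimately show "pdvd p 4 (L $ n - log_trunc y $ n)" "pdvd p 4 (L $ n' - log_trunc y $ n')"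
    "pdvd p 4 (L $ n'' - log_trunc y $ n'')"
    using dvd by (auto intro!: power_sum_log_nth)
qed

end

text \<open>Below degree p - 1 the factor 1 - u is invisible, so y agrees with s there.\<close>

lemma pdvd_fps_log_diff:
  assumes "n < p - 1" shows "pdvd_fps p 4 n (L - log_trunc s)"
proof (rule pdvd_fpsI)
  fix i assume i: "i \<le> n"
  show "pdvd p 4 ((L - log_trunc s) $ i)"
  proof (cases "i = 0")
    case True
    have "power_sum p 0 / of_nat 0 = 0" by simp
    thus ?thesis using True by (simp add: power_sum_log_def log_trunc_nth s_nth_eq_0 pdvd_zero power2_eq_square power3_eq_cube)
  next
    case False
    have "\<not> p - 1 dvd i" "\<not> p dvd i" using i assms False by (auto dest!: dvd_imp_le)
    hence 1: "pdvd p 4 (L $ i - log_trunc y $ i)" by (rule power_sum_log_nth)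
    have low: "F $ j = G $ j" if "F * (1 - u) = G" "j \<le> n" for F G :: "rat fps" and j
      using geometric_shift_nths(1)[OF that(1)[unfolded u_def], of j] that(2) assms by simp
    have eq: "y $ j = s $ j" if "j \<le> n" for j
      using low[OF y_mult that] that assms by (simp add: z_eq u_def fps_X_power_nth)
    hence "(y ^ k) $ j = (s ^ k) $ j" if "j \<le> n" for j k using that
    proof (induction k arbitrary: j)
      case (Suc k)
      thus ?case by (auto simp: fps_mult_nth intro!: sum.cong)
    qed simp
    with 1 eq i show ?thesis by (simp add: log_trunc_nth)
  qed
qed

lemma pdvd_fps_log: "n < p - 1 \<Longrightarrow> pdvd_fps p 1 n L"
proof -
  assume "n < p - 1"
  hence "pdvd_fps p 1 n (L - log_trunc s)"
    using pdvd_fps_mono[OF pdvd_fps_log_diff, of n 1] by simp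
  moreover have "pdvd_fps p 1 n (log_trunc s)"
    unfolding pdvd_fps_def log_trunc_nth
    using pdvd_mono[OF pdvd_s_powers(1), of 1] pdvd_mono[OF pdvd_s_powers(2), of 1]
    by (intro allI impI pdvd_add pdvd_diff pdvd_2 pdvd_3 pdvd_s) simp_all
  ultimately show ?thesis using pdvd_fps_add by fastforce
qed

text \<open>Factoring L^2 - l^2 and L^3 - l^3 with l = \<open>log_trunc s\<close> reduces this to
  \<open>log_trunc_powers\<close>, and s^4 is divisible by p^4.\<close>

lemma log_powers:
  assumes n: "n < p - 1"
  shows "pdvd p 4 ((L ^ 2) $ n - ((s ^ 2) $ n - (s ^ 3) $ n))" "pdvd p 4 ((L ^ 3) $ n - (s ^ 3) $ n)"
proof -
  let ?l = "log_trunc s"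
  have L: "pdvd_fps p 0 n L" using pdvd_fps_log[OF n] by (rule pdvd_fps_mono) simp
  have l: "pdvd_fps p 0 n ?l"
    using pdvd_fps_diff[OF L pdvd_fps_mono[OF pdvd_fps_log_diff[OF n], of 0]] by simp
  have s4: "pdvd_fps p 4 n (s ^ 4)" using pdvd_fps_power[OF pdvd_fps_s, of 4] by simp
  have s0: "pdvd_fps p 0 n s" using pdvd_fps_s by (rule pdvd_fps_mono) simp
  define g where "g = fps_const (1 / 3) * s - fps_const (1 / 2)"
  have mult0: "pdvd_fps p 0 n (F * G)" if "pdvd_fps p 0 n F" "pdvd_fps p 0 n G" for F G
    using pdvd_fps_mult[OF that] by simp
  have mult4: "pdvd_fps p 4 n (F * G)" if "pdvd_fps p 4 n F" "pdvd_fps p 0 n G" for F G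
    using pdvd_fps_mult[OF that] by simp
  have "pdvd_fps p 0 n (fps_const (1 / 3))" "pdvd_fps p 0 n (fps_const (1 / 2))"
    by (intro pdvd_fps_const pdvd_2 pdvd_3 pdvd_numeral)+
  hence g: "pdvd_fps p 0 n g" unfolding g_def by (intro pdvd_fps_diff mult0 s0)
  have three: "pdvd_fps p 0 n 3" and c: "pdvd_fps p 0 n (fps_const (2 / 3))"
    using pdvd_fps_const[OF pdvd_numeral(1)[of "num.Bit1 num.One"]] pdvd_fps_const[OF pdvd_3[OF pdvd_numeral(1)]]
    by (auto simp: fps_numeral_fps_const)
  have "L ^ 2 - (s ^ 2 - s ^ 3) = (L - ?l) * (L + ?l) + (?l ^ 2 - (s ^ 2 - s ^ 3))"
    by (simp add: power2_eq_square algebra_simps)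
  also have "pdvd_fps p 4 n \<dots>"
    unfolding log_trunc_powers g_def[symmetric] power2_eq_square[of g]
    by (intro pdvd_fps_add mult4 mult0 pdvd_fps_log_diff n L l s4 c g)
  finally have "pdvd_fps p 4 n (L ^ 2 - (s ^ 2 - s ^ 3))" .
  from pdvd_fpsD[OF this, of n] show "pdvd p 4 ((L ^ 2) $ n - ((s ^ 2) $ n - (s ^ 3) $ n))" by simp
  have "L ^ 3 - s ^ 3 = (L - ?l) * (L * L + L * ?l + ?l * ?l) + (?l ^ 3 - s ^ 3)"
    by (simp add: power3_eq_cube algebra_simps)
  also have "pdvd_fps p 4 n \<dots>"
    unfolding log_trunc_powers g_def[symmetric] power2_eq_square[of "s * g"]
    by (intro pdvd_fps_add mult4 mult0 pdvd_fps_log_diff n L l s4 s0 g three)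
  finally have "pdvd_fps p 4 n (L ^ 3 - s ^ 3)" .
  from pdvd_fpsD[OF this, of n] show "pdvd p 4 ((L ^ 3) $ n - (s ^ 3) $ n)" by simp
qed

text \<open>The second difference removes s and s^2 up to multiples of p w. The weights in the last
  relation are chosen so that s, s^2, s^3 at n and s^3 at n + (p - 1) cancel modulo p^4. What
  resists elimination is \<open>t\<close> and s^3 at n + 2(p - 1); the former is kept, the latter
  assumed to vanish.\<close>

lemma log_relations:
  assumes n: "3 \<le> n" "n < p - 1"
  defines "l0 \<equiv> L $ n" and "l1 \<equiv> L $ (n + (p - 1))" and "l2 \<equiv> L $ (n + 2 * (p - 1))"
    and "q \<equiv> (L ^ 2) $ n" and "k \<equiv> (L ^ 3) $ n" and "t \<equiv> (s ^ 2) $ (n + (p - 1))"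
  shows "pdvd p 1 l0" "pdvd p 2 (l1 - l0)" "pdvd p 3 (l2 - 2 * l1 + l0)"
    "pdvd p 3 (l1 - l0 + q / 2 + t / 2 + pw * l0)"
    "pdvd p 4 ((s ^ 3) $ (n + 2 * (p - 1))) \<Longrightarrow> pdvd p 4
       (k / 6 + (l1 - l0) - (l2 - 2 * l1 + l0) + q / 2 - pw * (l1 - l0) + pw * l0 + (1 + pw) * t / 2)"
proof -
  define e0 e1 e2 where "e0 = l0 - log_trunc y $ n" and "e1 = l1 - log_trunc y $ (n + (p - 1))"
    and "e2 = l2 - log_trunc y $ (n + 2 * (p - 1))"
  define S1 S2 S3 S3' S3'' where "S1 = s $ n" and "S2 = (s ^ 2) $ n" and "S3 = (s ^ 3) $ n"
    and "S3' = (s ^ 3) $ (n + (p - 1))" and "S3'' = (s ^ 3) $ (n + 2 * (p - 1))"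
  define f g where "f = q - (S2 - S3)" and "g = k - S3"
  have e: "pdvd p 4 e0" "pdvd p 4 e1" "pdvd p 4 e2"
    using log_nths[OF n] by (simp_all add: e0_def e1_def e2_def l0_def l1_def l2_def)
  have fg: "pdvd p 4 f" "pdvd p 4 g"
    using log_powers[OF n(2)] by (simp_all add: f_def g_def q_def k_def S2_def S3_def)
  have S: "pdvd p 1 S1" "pdvd p 2 S2" "pdvd p 2 t" "pdvd p 3 S3" "pdvd p 3 S3'" "pdvd p 3 S3''"
    by (simp_all only: S1_def S2_def S3_def S3'_def S3''_def t_def pdvd_s pdvd_s_powers)
    have c0: "pdvd p 0 pw" using pdvd_pw by (rule pdvd_mono) simp
  have cS: "pdvd p 2 (pw * S1)" "pdvd p 3 (pw * S2)" "pdvd p 3 (pw * t)" "pdvd p 4 (pw * S3)"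
      "pdvd p 4 (pw * S3')" "pdvd p 3 (pw * (pw * S1))" "pdvd p 4 (pw * (pw * S2))"
    using pdvd_mult[OF pdvd_pw S(1)] pdvd_mult[OF pdvd_pw S(2)] pdvd_mult[OF pdvd_pw S(3)] pdvd_mult[OF pdvd_pw S(4)]
      pdvd_mult[OF pdvd_pw S(5)] pdvd_mult[OF pdvd_pw pdvd_mult[OF pdvd_pw S(1)]] pdvd_mult[OF pdvd_pw pdvd_mult[OF pdvd_pw S(2)]]
    by (simp_all add: numeral_eq_Suc)
  note m = pdvd_mono[OF e(1)] pdvd_mono[OF e(2)] pdvd_mono[OF e(3)] pdvd_mono[OF fg(1)]
    pdvd_mono[OF S(2)] pdvd_mono[OF S(3)] pdvd_mono[OF S(4)] pdvd_mono[OF S(5)] pdvd_mono[OF S(6)]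
    pdvd_mono[OF cS(1)] pdvd_mono[OF cS(2)] pdvd_mono[OF cS(3)] pdvd_mono[OF cS(4)]
  note lmult = pdvd_lmult[OF pdvd_numeral(1)]
  note lin = pdvd_add pdvd_diff pdvd_uminus pdvd_2 pdvd_3 pdvd_6 lmult
  have l0: "l0 = e0 + (S1 - S2 / 2 + S3 / 3)"
    using log_trunc_y_nths(1)[OF n] by (simp add: e0_def S1_def S2_def S3_def)
  have l1: "l1 = e1 + (S1 - (2 * S2 + t + 2 * pw * S1) / 2 + (3 * S3 + S3' + 3 * pw * S2) / 3)"
    using log_trunc_y_nths(2)[OF n] by (simp add: e1_def S1_def S2_def S3_def S3'_def t_def)
  have l2: "l2 = e2 + (S1 - (3 * S2 + 2 * t + 4 * pw * S1) / 2
     + (6 * S3 + 3 * S3' + 9 * pw * S2 + S3'' + 3 * pw * t + 3 * pw ^ 2 * S1) / 3)"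
    using log_trunc_y_nths(3)[OF n]
    by (simp add: e2_def S1_def S2_def S3_def S3'_def S3''_def t_def)
  have q: "q = f + (S2 - S3)" and k: "k = g + S3" by (simp_all add: f_def g_def)
  show "pdvd p 1 l0"
    unfolding l0 by (intro lin S m) auto
  have "l1 - l0 = e1 - e0 - S2 / 2 - t / 2 - pw * S1 + 2 * (S3 / 3) + S3' / 3 + pw * S2"
    unfolding l0 l1 by (simp add: field_simps)
  also have "pdvd p 2 \<dots>" by (intro lin S cS m) auto
  finally show "pdvd p 2 (l1 - l0)" .
  have "l2 - 2 * l1 + l0 = e2 - 2 * e1 + e0 + (S3 + S3' + S3'') / 3 + pw * S2 + pw * t + pw * (pw * S1)"
    unfolding l0 l1 l2 by (simp add: field_simps power2_eq_square)
  also have "pdvd p 3 \<dots>" by (intro lin S cS m) auto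
  finally show "pdvd p 3 (l2 - 2 * l1 + l0)" .
  have "l1 - l0 + q / 2 + t / 2 + pw * l0
      = e1 - e0 + f / 2 + pw * e0 + S3 / 6 + S3' / 3 + (pw * S2) / 2 + (pw * S3) / 3"
    unfolding l0 l1 q by (simp add: field_simps)
  also have "pdvd p 3 \<dots>" by (intro lin S cS m pdvd_lmult[OF c0]) auto
  finally show "pdvd p 3 (l1 - l0 + q / 2 + t / 2 + pw * l0)" .
  assume S3'': "pdvd p 4 ((s ^ 3) $ (n + 2 * (p - 1)))"
  have "k / 6 + (l1 - l0) - (l2 - 2 * l1 + l0) + q / 2 - pw * (l1 - l0) + pw * l0 + (1 + pw) * t / 2
      = g / 6 + f / 2 + (3 * e1 - 2 * e0 - e2) - pw * e1 + pw * (2 * e0) - S3'' / 3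
        - (pw * S3) / 3 - (pw * S3') / 3 - pw * (pw * S2)"
    unfolding l0 l1 l2 q k by (simp add: field_simps power2_eq_square)
  also have "pdvd p 4 \<dots>"
    using S3'' by (intro lin cS e fg pdvd_lmult[OF c0]) (simp_all add: S3''_def)
  finally show "pdvd p 4
       (k / 6 + (l1 - l0) - (l2 - 2 * l1 + l0) + q / 2 - pw * (l1 - l0) + pw * l0 + (1 + pw) * t / 2)" .
qed

end

section \<open>Products of Bernoulli numbers modulo powers of $p$\<close>

text \<open>Parity is the means to separate B_1: the sums \<C> and \<T> start at index 2, whereas
  the logarithm produces products of the full Bernoulli series.\<close>

definition even_fps :: "rat fps \<Rightarrow> bool"
  where "even_fps F \<longleftrightarrow> (\<forall>i. odd i \<longrightarrow> F $ i = 0)"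

lemma even_fps_mult:
  assumes "even_fps F" "even_fps G" shows "even_fps (F * G)"
  unfolding even_fps_def fps_mult_nth
proof (intro allI impI sum.neutral ballI)
  fix m i :: nat assume "odd m" "i \<in> {0..m}"
  hence "odd i \<or> odd (m - i)" by (metis atLeastAtMost_iff even_add le_add_diff_inverse)
  hence "F $ i = 0 \<or> G $ (m - i) = 0" using assms unfolding even_fps_def by blast
  thus "F $ i * G $ (m - i) = 0" by (simp only: mult_eq_0_iff)
qed

definition bernoulli_fps :: "rat fps"
  where "bernoulli_fps = Abs_fps bernoulli"

definition bernoulli_fps_even :: "rat fps"
  where "bernoulli_fps_even = Abs_fps (\<lambda>i. if even i then bernoulli i else 0)"

definition divided_bernoulli_fps :: "rat fps"
  where "divided_bernoulli_fps = Abs_fps \<B>"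

definition divided_bernoulli_fps_even :: "rat fps"
  where "divided_bernoulli_fps_even = Abs_fps (\<lambda>i. if even i then \<B> i else 0)"

lemma bernoulli_1: "bernoulli 1 = - (1 / 2)"
  by (simp add: numeral_2_eq_2)

lemma even_fps_bernoulli: "even_fps bernoulli_fps_even" "even_fps divided_bernoulli_fps_even"
  by (simp_all add: even_fps_def bernoulli_fps_even_def divided_bernoulli_fps_even_def)

lemma bernoulli_fps_split:
  "bernoulli_fps = bernoulli_fps_even - fps_const (1 / 2) * fps_X"
  "divided_bernoulli_fps = divided_bernoulli_fps_even - fps_const (1 / 2) * fps_X"
proof -
  have "bernoulli i = - (1 / 2) * fps_X $ i" "\<B> i = - (1 / 2) * fps_X $ i" if "odd i" for i
    using that bernoulli_odd[of i] bernoulli_1 by (cases "i = 1"; simp add: divided_bernoulli_def)+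
  thus "bernoulli_fps = bernoulli_fps_even - fps_const (1 / 2) * fps_X"
    "divided_bernoulli_fps = divided_bernoulli_fps_even - fps_const (1 / 2) * fps_X"
    by (auto simp: fps_eq_iff bernoulli_fps_def bernoulli_fps_even_def divided_bernoulli_fps_def
        divided_bernoulli_fps_even_def fps_X_nth)
qed

text \<open>\<B> 0 is 0 through division by zero, so the full Cauchy product has no boundary
  terms.\<close>

lemma conv2_eq: "\<C> m = (divided_bernoulli_fps_even ^ 2) $ m"
proof -
  let ?E = "divided_bernoulli_fps_even"
  have E: "?E $ 0 = 0" "?E $ 1 = 0" "i \<ge> 2 \<Longrightarrow> ?E $ i = \<B> i" for i
    using bernoulli_odd[of i] by (auto simp: divided_bernoulli_fps_even_def divided_bernoulli_def)
  have "(?E ^ 2) $ m = (\<Sum>i = 0..m. ?E $ i * ?E $ (m - i))"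
    by (simp add: power2_eq_square fps_mult_nth)
  also have "\<dots> = (\<Sum>i = 2..m - 2. ?E $ i * ?E $ (m - i))"
  proof (rule sum.mono_neutral_right)
    show "\<forall>i\<in>{0..m} - {2..m - 2}. ?E $ i * ?E $ (m - i) = 0"
    proof
      fix i assume i: "i \<in> {0..m} - {2..m - 2}"
      hence "i = 0 \<or> i = 1 \<or> m - i = 0 \<or> m - i = 1" by auto
      thus "?E $ i * ?E $ (m - i) = 0" using E(1,2) by auto
    qed
  qed auto
  also have "\<dots> = \<C> m" unfolding conv2_def
    by (rule sum.cong) (auto simp: E(3))
  finally show ?thesis ..
qed

lemma conv3_eq: "\<T> m = (divided_bernoulli_fps_even ^ 3) $ m"
proof -
  let ?E = "divided_bernoulli_fps_even"
  have E: "?E $ 0 = 0" "?E $ 1 = 0" "i \<ge> 2 \<Longrightarrow> ?E $ i = \<B> i" for i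
    using bernoulli_odd[of i] by (auto simp: divided_bernoulli_fps_even_def divided_bernoulli_def)
  have C: "\<C> i = 0" if "i \<le> 3" for i using that by (simp add: conv2_def)
  have "(?E ^ 3) $ m = (\<Sum>i = 0..m. ?E $ i * \<C> (m - i))"
    unfolding conv2_eq by (simp add: power3_eq_cube power2_eq_square fps_mult_nth mult.assoc)
  also have "\<dots> = (\<Sum>i = 2..m - 4. ?E $ i * \<C> (m - i))"
  proof (rule sum.mono_neutral_right)
    show "\<forall>i\<in>{0..m} - {2..m - 4}. ?E $ i * \<C> (m - i) = 0"
    proof
      fix i assume i: "i \<in> {0..m} - {2..m - 4}"
      hence "i = 0 \<or> i = 1 \<or> m - i \<le> 3" by auto
      thus "?E $ i * \<C> (m - i) = 0" using E(1,2) C by auto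
    qed
  qed auto
  also have "\<dots> = \<T> m" unfolding conv3_def
    by (rule sum.cong) (auto simp: E(3))
  finally show ?thesis ..
qed

text \<open>The term -X/2 from B_1 is expanded; products that fall on an odd index vanish, and 3/4
  is 3 (1/2)^2. The factor n - 1 arises from B_(n-2) = (n - 2) \<B>(n - 2) together with one more
  \<B>(n - 2).\<close>

lemma divided_bernoulli_products_nth:
  assumes n: "even n" "4 \<le> n"
  shows "(divided_bernoulli_fps ^ 2) $ n = \<C> n"
    "(divided_bernoulli_fps * (fps_X * bernoulli_fps)) $ n = - (of_nat n - 1) / 2 * \<B> (n - 2)"
    "(divided_bernoulli_fps ^ 3) $ n = \<T> n + 3 / 4 * \<B> (n - 2)"
proof -
  let ?E = "divided_bernoulli_fps_even" and ?B = bernoulli_fps_even and ?h = "fps_const (1 / 2) :: rat fps"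
  have h: "?h * 2 = 1" by (simp add: fps_numeral_fps_const)
  have odd_0: "F $ (n - 1) = 0" if "even_fps F" for F
    using that n by (auto simp: even_fps_def)
  note E = even_fps_bernoulli(2) and B = even_fps_bernoulli(1)
  have EE: "even_fps (?E ^ 2)" unfolding power2_eq_square by (intro even_fps_mult E)
  have "divided_bernoulli_fps ^ 2 = ?E ^ 2 - (?h * 2) * (fps_X * ?E) + ?h ^ 2 * fps_X ^ 2"
    unfolding bernoulli_fps_split by (simp add: power2_eq_square algebra_simps)
  also have "\<dots> = ?E ^ 2 - fps_X * ?E + fps_const (1 / 4) * fps_X ^ 2"
    unfolding h by (simp add: fps_const_power power2_eq_square)
  finally show "(divided_bernoulli_fps ^ 2) $ n = \<C> n"
    using n odd_0[OF E] by (simp add: conv2_eq fps_X_power_nth)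
  have "divided_bernoulli_fps ^ 3 = ?E ^ 3 - ?h * 3 * (fps_X * ?E ^ 2) + ?h ^ 2 * 3 * (fps_X ^ 2 * ?E)
      - ?h ^ 3 * fps_X ^ 3"
    unfolding bernoulli_fps_split by (simp add: power2_eq_square power3_eq_cube algebra_simps)
  also have "\<dots> = ?E ^ 3 - fps_const (3 / 2) * (fps_X * ?E ^ 2) + fps_const (3 / 4) * (fps_X ^ 2 * ?E)
      - fps_const (1 / 8) * fps_X ^ 3"
    by (simp add: fps_const_power power2_eq_square power3_eq_cube fps_numeral_fps_const)
  finally show "(divided_bernoulli_fps ^ 3) $ n = \<T> n + 3 / 4 * \<B> (n - 2)"
    using n odd_0[OF EE]
    by (simp add: conv3_eq fps_X_power_nth fps_X_power_mult_nth divided_bernoulli_fps_even_def)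
  have "divided_bernoulli_fps * (fps_X * bernoulli_fps)
      = fps_X * (?E * ?B - ?h * (fps_X * ?E) - ?h * (fps_X * ?B) + ?h ^ 2 * fps_X ^ 2)"
    unfolding bernoulli_fps_split by (simp add: power2_eq_square algebra_simps)
  also have "\<dots> $ n = - (1 / 2) * ?E $ (n - 2) - 1 / 2 * ?B $ (n - 2)"
    using n odd_0[OF even_fps_mult[OF E B]]
    by (simp add: fps_const_power fps_X_power_nth numeral_2_eq_2)
  also have "\<dots> = - (1 / 2) * \<B> (n - 2) - 1 / 2 * (of_nat (n - 2) * \<B> (n - 2))"
    using n by (simp add: bernoulli_fps_even_def divided_bernoulli_fps_even_def divided_bernoulli_def)
  also have "\<dots> = - (of_nat n - 1) / 2 * \<B> (n - 2)"
    using n by (simp add: of_nat_diff field_simps)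
  finally show "(divided_bernoulli_fps * (fps_X * bernoulli_fps)) $ n = - (of_nat n - 1) / 2 * \<B> (n - 2)" .
qed

section \<open>The logarithm in terms of divided Bernoulli numbers\<close>

context padic_large_prime
begin

lemma pdvd_divided_bernoulli:
  assumes "\<not> p - 1 dvd m" "\<not> p dvd m" shows "pdvd p 0 (\<B> m)"
  unfolding divided_bernoulli_def using assms by (intro pdvd_divide_nat pdvd_bernoulli)

lemma pdvd_divided_bernoulli_small: "m < p - 1 \<Longrightarrow> pdvd p 0 (\<B> m)"
proof (cases "m = 0")
  case False
  assume "m < p - 1"
  with False show ?thesis by (intro pdvd_divided_bernoulli) (auto dest!: dvd_imp_le)
qed (simp add: divided_bernoulli_def pdvd_zero)

lemma pdvd_fps_bernoulli:
  assumes "n < p - 1"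
  shows "pdvd_fps p 0 n divided_bernoulli_fps" "pdvd_fps p 0 n (fps_X * bernoulli_fps)"
  using assms
  by (auto simp: pdvd_fps_def divided_bernoulli_fps_def bernoulli_fps_def
      intro!: pdvd_divided_bernoulli_small pdvd_bernoulli_small pdvd_zero)

text \<open>The terms i = 0 and i = 1 of Faulhaber's formula divided by k; the second becomes
  (p^2/2) B_(k-1), a shift of the undivided series.\<close>

lemma pdvd_fps_log_bernoulli:
  assumes "n < p - 1"
  shows "pdvd_fps p 3 n (L + fps_const (of_nat p) * (divided_bernoulli_fps
           + fps_const (of_nat p / 2) * (fps_X * bernoulli_fps)))"
proof (rule pdvd_fpsI)
  fix k assume k: "k \<le> n"
  show "pdvd p 3 ((L + fps_const (of_nat p) * (divided_bernoulli_fps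
           + fps_const (of_nat p / 2) * (fps_X * bernoulli_fps))) $ k)"
  proof (cases "k = 0")
    case True
    thus ?thesis by (simp add: power_sum_log_def divided_bernoulli_fps_def divided_bernoulli_def pdvd_zero)
  next
    case False
    hence "pdvd p 3 ((power_sum p k - (of_nat p * bernoulli k + of_nat k * of_nat p ^ 2 / 2 * bernoulli (k - 1)))
        / of_nat k)"
      using k assms by (intro pdvd_divide_nat power_sum_mod_p3 not_dvd_small) auto
    moreover have "(L + fps_const (of_nat p) * (divided_bernoulli_fps
        + fps_const (of_nat p / 2) * (fps_X * bernoulli_fps))) $ k
      = - ((power_sum p k - (of_nat p * bernoulli k + of_nat k * of_nat p ^ 2 / 2 * bernoulli (k - 1)))
        / of_nat k)"
      using False by (simp add: power_sum_log_def divided_bernoulli_fps_def divided_bernoulli_def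
          bernoulli_fps_def power2_eq_square field_simps)
    ultimately show ?thesis by (simp only: pdvd_uminus_iff)
  qed
qed

text \<open>L is known only modulo p^3, but it is divisible by p, so its powers are known at least
  modulo p^4: L^2 - M^2 = (L + M)(L - M), and similarly for cubes, with \<open>M\<close> close to
  -L.\<close>

lemma log_powers_bernoulli:
  assumes n: "even n" "4 \<le> n" "n < p - 1"
  shows "pdvd p 4 ((L ^ 2) $ n - (of_nat p ^ 2 * \<C> n - of_nat p ^ 3 * ((of_nat n - 1) / 2 * \<B> (n - 2))))"
    "pdvd p 4 ((L ^ 3) $ n + of_nat p ^ 3 * (\<T> n + 3 / 4 * \<B> (n - 2)))"
proof -
  let ?b = divided_bernoulli_fps and ?g = "fps_X * bernoulli_fps" and ?p = "fps_const (of_nat p) :: rat fps"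
    and ?h = "fps_const (1 / 2) :: rat fps"
  define M where "M = ?p * (?b + fps_const (of_nat p / 2) * ?g)"
  have hp: "fps_const (of_nat p / 2) = ?h * ?p" by simp
  have h2: "2 * ?h = 1" by (simp add: fps_numeral_fps_const)
  have mult: "pdvd_fps p k n (F * G)" if "pdvd_fps p i n F" "pdvd_fps p j n G" "k = i + j" for F G i j k
    using pdvd_fps_mult[OF that(1,2)] that(3) by simp
  have mult0: "pdvd_fps p 0 n (F * G)" if "pdvd_fps p 0 n F" "pdvd_fps p 0 n G" for F G
    using pdvd_fps_mult[OF that] by simp
  have b: "pdvd_fps p 0 n ?b" and g: "pdvd_fps p 0 n ?g" using pdvd_fps_bernoulli[OF n(3)] by auto
  have p1: "pdvd_fps p 1 n ?p" by (intro pdvd_fps_const pdvd_self)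
  have p0: "pdvd_fps p 0 n ?p" using p1 by (rule pdvd_fps_mono) simp
  have h0: "pdvd_fps p 0 n ?h" by (intro pdvd_fps_const pdvd_2 pdvd_numeral)
  have three: "pdvd_fps p 0 n 3"
    using pdvd_fps_const[OF pdvd_numeral(1)[of "num.Bit1 num.One"]] by (simp add: fps_numeral_fps_const)
  have p4: "pdvd_fps p 4 n (?p ^ 4)" using pdvd_fps_power[OF p1, of 4] by simp
  have LM: "pdvd_fps p 3 n (L + M)" unfolding M_def by (rule pdvd_fps_log_bernoulli[OF n(3)])
  have L: "pdvd_fps p 1 n L" by (rule pdvd_fps_log[OF n(3)])
  have M: "pdvd_fps p 1 n M" using pdvd_fps_diff[OF pdvd_fps_mono[OF LM, of 1] L] by simp
  have L0: "pdvd_fps p 0 n L" and M0: "pdvd_fps p 0 n M"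
    using pdvd_fps_mono[OF L, of 0] pdvd_fps_mono[OF M, of 0] by auto
  have "L ^ 2 - (?p ^ 2 * ?b ^ 2 + ?p ^ 3 * (2 * ?h) * (?b * ?g))
      = (L + M) * (L - M) + ?p ^ 4 * (?h * ?h * (?g * ?g))"
    unfolding M_def hp by (simp add: power2_eq_square power3_eq_cube power4_eq_xxxx algebra_simps)
  also have "pdvd_fps p 4 n \<dots>"
  proof (rule pdvd_fps_add)
    show "pdvd_fps p 4 n ((L + M) * (L - M))" by (rule mult[OF LM pdvd_fps_diff[OF L M]]) simp
    show "pdvd_fps p 4 n (?p ^ 4 * (?h * ?h * (?g * ?g)))"
      by (rule mult[OF p4, of 0]) (intro mult0 h0 g, simp)
  qed
  finally have "pdvd_fps p 4 n (L ^ 2 - (?p ^ 2 * ?b ^ 2 + ?p ^ 3 * (?b * ?g)))" unfolding h2 by simp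
  from pdvd_fpsD[OF this, of n]
  have "pdvd p 4 ((L ^ 2) $ n - (of_nat p ^ 2 * (?b ^ 2) $ n + of_nat p ^ 3 * (?b * ?g) $ n))"
    by (simp add: fps_const_power)
  moreover have "a + of_nat p ^ 3 * (- x / 2 * b) = a - of_nat p ^ 3 * (x / 2 * b)" for a b x :: rat
    by simp
  ultimately show "pdvd p 4 ((L ^ 2) $ n - (of_nat p ^ 2 * \<C> n - of_nat p ^ 3 * ((of_nat n - 1) / 2 * \<B> (n - 2))))"
    unfolding divided_bernoulli_products_nth[OF n(1,2)] by (simp only:)
  have "L ^ 3 + ?p ^ 3 * ?b ^ 3 = (L + M) * (L * L - L * M + M * M)
      - ?p ^ 4 * (?h * (3 * (?b * ?b * ?g) + ?h * ?p * (3 * (?b * ?g * ?g)) + ?h * ?h * ?p * ?p * (?g * ?g * ?g)))"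
    unfolding M_def hp by (simp add: power2_eq_square power3_eq_cube power4_eq_xxxx algebra_simps)
  also have "pdvd_fps p 4 n \<dots>"
  proof (rule pdvd_fps_diff)
    have "pdvd_fps p 1 n (L * L - L * M + M * M)"
      by (intro pdvd_fps_add pdvd_fps_diff mult[OF L L0] mult[OF L M0] mult[OF M M0]) simp_all
    thus "pdvd_fps p 4 n ((L + M) * (L * L - L * M + M * M))" by (rule mult[OF LM]) simp
    show "pdvd_fps p 4 n (?p ^ 4 * (?h * (3 * (?b * ?b * ?g) + ?h * ?p * (3 * (?b * ?g * ?g))
        + ?h * ?h * ?p * ?p * (?g * ?g * ?g))))"
      by (rule mult[OF p4, of 0]) (intro pdvd_fps_add mult0 h0 g b p0 three, simp)
  qed
  finally have "pdvd_fps p 4 n (L ^ 3 + ?p ^ 3 * ?b ^ 3)" .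
  from pdvd_fpsD[OF this, of n]
  have "pdvd p 4 ((L ^ 3) $ n + of_nat p ^ 3 * (?b ^ 3) $ n)" by (simp add: fps_const_power)
  thus "pdvd p 4 ((L ^ 3) $ n + of_nat p ^ 3 * (\<T> n + 3 / 4 * \<B> (n - 2)))"
    unfolding divided_bernoulli_products_nth[OF n(1,2)] .
qed

lemma log_nth_bernoulli:
  assumes "even m" "4 \<le> m" "\<not> p dvd m"
  shows "pdvd p 4 (L $ m + of_nat p * \<B> m
    + of_nat p ^ 3 * ((of_nat m - 1) * (of_nat m - 2) / 6 * \<B> (m - 2)))"
proof -
  have choose: "(of_nat (m choose 2) :: rat) = of_nat m * (of_nat m - 1) / 2"
  proof -
    have "2 * (m choose 2) = m * (m - 1)" unfolding choose_two by (intro dvd_mult_div_cancel) auto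
    hence "of_nat (2 * (m choose 2)) = (of_nat (m * (m - 1)) :: rat)" by (simp only:)
    thus ?thesis using assms(2) by (simp add: of_nat_diff)
  qed
  have b: "bernoulli (m - 2) = (of_nat m - 2) * \<B> (m - 2)"
    using assms(2) by (simp add: divided_bernoulli_def of_nat_diff)
  have "pdvd p 4 ((power_sum p m - (of_nat p * bernoulli m
      + of_nat (m choose 2) * of_nat p ^ 3 / 3 * bernoulli (m - 2))) / of_nat m)"
    by (intro pdvd_divide_nat power_sum_mod_p4 assms)
  moreover have "L $ m + of_nat p * \<B> m + of_nat p ^ 3 * ((of_nat m - 1) * (of_nat m - 2) / 6 * \<B> (m - 2))
      = - ((power_sum p m - (of_nat p * bernoulli m
      + of_nat (m choose 2) * of_nat p ^ 3 / 3 * bernoulli (m - 2))) / of_nat m)"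
    unfolding choose b using assms(2)
    by (simp add: power_sum_log_def divided_bernoulli_def[of m] field_simps)
  ultimately show ?thesis by (simp only: pdvd_uminus_iff)
qed

text \<open>Modulo p the index n + r(p - 1) is n - r, which fixes the coefficient of the correction.
  Kummer's congruence at n - 2 is a hypothesis of the second claim because it is itself derived from
  the first.\<close>

lemma log_progression_bernoulli:
  assumes n: "even n" "4 \<le> n" "n < p - 1" and r: "r \<le> 2"
  shows "pdvd p 3 (L $ (n + r * (p - 1)) + of_nat p * \<B> (n + r * (p - 1)))"
    "pdvd p 1 (\<B> (n + r * (p - 1) - 2) - \<B> (n - 2)) \<Longrightarrow>
     pdvd p 4 (L $ (n + r * (p - 1)) + of_nat p * \<B> (n + r * (p - 1))
       + of_nat p ^ 3 * ((of_nat n - of_nat r - 1) * (of_nat n - of_nat r - 2) / 6 * \<B> (n - 2)))"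
proof -
  define m where "m = n + r * (p - 1)"
  define N R :: rat where "N = of_nat n" and "R = of_nat r"
  have m: "even m" "4 \<le> m" using n even_p by (simp_all add: m_def)
  have pm: "\<not> p dvd m"
  proof -
    have "m = p * r + (n - r)" using n r p_ge_11 by (simp add: m_def algebra_simps diff_mult_distrib)
    moreover have "\<not> p dvd n - r" using n r by (intro not_dvd_small) auto
    ultimately show ?thesis by (simp only: dvd_add_right_iff[OF dvd_triv_left] not_False_eq_True)
  qed
  have m_rat: "of_nat m = N - R + of_nat p * R"
    using p_ge_11 unfolding m_def N_def R_def by (simp add: of_nat_diff right_diff_distrib)
  have NR: "pdvd p 0 N" "pdvd p 0 R" "pdvd p 0 (of_nat m)" by (simp_all only: N_def R_def pdvd_of_nat)
  have Bn: "pdvd p 0 (\<B> (n - 2))" using n by (intro pdvd_divided_bernoulli_small) auto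
  \<comment> \<open>\<B>(m - 2) alone need not be p-integral, as p may divide m - 2 (for n = 4, r =
    2); its product with m - 2 is.\<close>
  have "pdvd p 0 (bernoulli (m - 2))"
  proof (rule pdvd_bernoulli)
    have eq: "m - 2 = r * (p - 1) + (n - 2)" using n by (simp add: m_def)
    have "\<not> p - 1 dvd n - 2" using n by (auto dest: dvd_imp_le)
    thus "\<not> p - 1 dvd m - 2" unfolding eq by (simp only: dvd_add_times_triv_left_iff) simp
  qed
  also have "bernoulli (m - 2) = (of_nat m - 2) * \<B> (m - 2)"
    using m(2) by (simp add: divided_bernoulli_def of_nat_diff)
  finally have Bm: "pdvd p 0 ((of_nat m - 2) * \<B> (m - 2))" .
  note log = log_nth_bernoulli[OF m pm]
  have "pdvd p 0 ((of_nat m - 1) * (((of_nat m - 2) * \<B> (m - 2)) / 6))"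
    by (intro pdvd_lmult pdvd_diff pdvd_6 NR Bm pdvd_numeral)
  from pdvd_mult[OF pdvd_power_self[of 3] this]
  have "pdvd p 3 (of_nat p ^ 3 * ((of_nat m - 1) * (of_nat m - 2) / 6 * \<B> (m - 2)))" by (simp add: mult.assoc)
  from pdvd_diff[OF pdvd_mono[OF log, of 3] this]
  show "pdvd p 3 (L $ (n + r * (p - 1)) + of_nat p * \<B> (n + r * (p - 1)))"
    by (simp add: m_def)
  assume cong: "pdvd p 1 (\<B> (n + r * (p - 1) - 2) - \<B> (n - 2))"
  define D where "D = \<B> (m - 2) - \<B> (n - 2)"
  have D: "pdvd p 1 D" using cong by (simp only: D_def m_def)
  have Bm': "\<B> (m - 2) = \<B> (n - 2) + D" by (simp add: D_def)
  have "(of_nat m - 1) * (of_nat m - 2) * \<B> (m - 2) - (N - R - 1) * (N - R - 2) * \<B> (n - 2)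
      = (of_nat m - 1) * (of_nat m - 2) * D + of_nat p * (R * (of_nat m + N - R - 3) * \<B> (n - 2))"
    unfolding Bm' m_rat by (simp add: algebra_simps)
  also have "pdvd p 1 \<dots>"
    by (intro pdvd_add pdvd_rmult[OF pdvd_self] pdvd_lmult pdvd_diff NR D Bn pdvd_numeral)
  finally have diff: "pdvd p 1 ((of_nat m - 1) * (of_nat m - 2) * \<B> (m - 2) - (N - R - 1) * (N - R - 2) * \<B> (n - 2))" .
  have "pdvd p 4 (of_nat p ^ 3 * (((of_nat m - 1) * (of_nat m - 2) * \<B> (m - 2)
      - (N - R - 1) * (N - R - 2) * \<B> (n - 2)) / 6))"
    using pdvd_mult[OF pdvd_power_self[of 3] pdvd_6[OF diff]] by simp
  note pdvd_diff[OF log this]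
  moreover have "x + x' + q * (a / 6 * b) - q * ((a * b - a' * b') / 6) = x + x' + q * (a' / 6 * b')"
    for x x' q a b a' b' :: rat by (simp add: field_simps)
  ultimately have "pdvd p 4 (L $ m + of_nat p * \<B> m + of_nat p ^ 3 * ((N - R - 1) * (N - R - 2) / 6 * \<B> (n - 2)))"
    by (simp only:)
  thus "pdvd p 4 (L $ (n + r * (p - 1)) + of_nat p * \<B> (n + r * (p - 1))
       + of_nat p ^ 3 * ((of_nat n - of_nat r - 1) * (of_nat n - of_nat r - 2) / 6 * \<B> (n - 2)))"
    by (simp only: m_def N_def R_def)
qed

text \<open>The first and second differences of L along the progression vanish modulo p^2, while L
  is -p \<B> modulo p^2 at each of the three indices.\<close>

lemma kummer_congruence:
  assumes n: "even n" "4 \<le> n" "n < p - 1"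
  shows "pdvd p 1 (\<B> (n + (p - 1)) - \<B> n)" "pdvd p 1 (\<B> (n + 2 * (p - 1)) - \<B> n)"
proof -
  let ?m = "\<lambda>r. n + r * (p - 1)"
  have rel: "pdvd p 2 (L $ ?m 1 - L $ ?m 0)" "pdvd p 2 (L $ ?m 2 - 2 * L $ ?m 1 + L $ ?m 0)"
    using log_relations(2,3)[of n] n pdvd_mono[OF log_relations(3)[of n], of 2] by simp_all
  have step: "pdvd p 1 (\<B> (?m r) - \<B> (?m 0))" if "pdvd p 2 (L $ ?m r - L $ ?m 0)" "r \<le> 2" for r
  proof -
    have "pdvd p 2 (L $ ?m r + of_nat p * \<B> (?m r))" "pdvd p 2 (L $ ?m 0 + of_nat p * \<B> (?m 0))"
      using pdvd_mono[OF log_progression_bernoulli(1)[OF n, of r], of 2]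
        pdvd_mono[OF log_progression_bernoulli(1)[OF n, of 0], of 2] that by simp_all
    from pdvd_diff[OF pdvd_diff[OF this] that(1)]
    have "pdvd p (1 + 1) (of_nat p ^ 1 * (\<B> (?m r) - \<B> (?m 0)))" by (simp add: algebra_simps numeral_2_eq_2)
    thus ?thesis by (simp only: pdvd_power_mult_iff)
  qed
  have "pdvd p 2 (L $ ?m 2 - L $ ?m 0)"
    using pdvd_add[OF rel(2) pdvd_lmult[OF pdvd_numeral(1)[of "num.Bit0 num.One"] rel(1)]]
    by (simp add: algebra_simps)
  from step[OF this] step[OF rel(1)]
  show "pdvd p 1 (\<B> (n + (p - 1)) - \<B> n)" "pdvd p 1 (\<B> (n + 2 * (p - 1)) - \<B> n)" by simp_all
qed

text \<open>\<open>log_relations\<close> rewritten in Bernoulli numbers and divided by p^2;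
  \<open>d\<close> and \<open>e\<close> are the normalized first and second differences. The bound 6
  \<le> n provides Kummer's congruence at n - 2.\<close>

lemma convolution_congruences:
  assumes n: "even n" "6 \<le> n" "n < p - 1"
  defines "b0 \<equiv> \<B> n" and "b1 \<equiv> \<B> (n + (p - 1))" and "b2 \<equiv> \<B> (n + 2 * (p - 1))"
    and "t \<equiv> (s ^ 2) $ (n + (p - 1)) / of_nat p ^ 2"
  defines "d \<equiv> (b0 - b1) / of_nat p" and "e \<equiv> (b2 - 2 * b1 + b0) / of_nat p ^ 2"
  shows "pdvd p 0 d" "pdvd p 0 e" "pdvd p 1 (\<C> n - (2 * w * b0 - 2 * d - t))"
    "pdvd p 4 ((s ^ 3) $ (n + 2 * (p - 1))) \<Longrightarrow>
     pdvd p 2 (of_nat p * \<T> n - (3 * \<C> n + 6 * d + 6 * of_nat p * e - 6 * w * b0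
       - 6 * of_nat p * w * d + 3 * (1 + of_nat p * w) * t + (of_nat n / 2 - 5 / 4) * of_nat p * \<B> (n - 2)))"
proof -
  define l0 l1 l2 where "l0 = L $ n" and "l1 = L $ (n + (p - 1))" and "l2 = L $ (n + 2 * (p - 1))"
  define q k where "q = (L ^ 2) $ n" and "k = (L ^ 3) $ n"
  define N q' where "N = (of_nat n :: rat)" and "q' = (of_nat p :: rat)"
  define b where "b = \<B> (n - 2)"
  have n3: "3 \<le> n" "4 \<le> n" using n by auto
  have q'0: "q' \<noteq> 0" using p_nonzero by (simp add: q'_def)
  have q'1: "pdvd p j (q' ^ j)" for j by (simp add: q'_def pdvd_power_self)
  have Nint: "pdvd p 0 N" and wint: "pdvd p 0 w" and bint: "pdvd p 0 b" and q'int: "pdvd p 0 q'"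
    using n pdvd_wilson_quotient by (simp_all add: N_def q'_def b_def pdvd_of_nat pdvd_divided_bernoulli_small)
  \<comment> \<open>The unit b/12 clears all denominators: the corrections of L along the
    progression have first difference -4(N - 2)B and second difference 4B, and those of L^2 and L^3
    involve 6(N - 1)B and 9B. Weighted as in the last relation they add up to (6N - 15)B = (N/2 -
    5/4) b.\<close>
  define B X0 X1 X2 where "B = b / 12" and "X0 = (N - 1) * (N - 2) / 6 * b"
    and "X1 = (N - 2) * (N - 3) / 6 * b" and "X2 = (N - 3) * (N - 4) / 6 * b"
  define h0 where "h0 = l0 + q' * b0 + q' ^ 3 * X0"
  define h1 where "h1 = l1 + q' * b1 + q' ^ 3 * X1"
  define h2 where "h2 = l2 + q' * b2 + q' ^ 3 * X2"
  have X: "X1 = X0 - 4 * (N - 2) * B" "X2 = 2 * X1 - X0 + 4 * B" "b = 12 * B"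
    by (simp_all add: X0_def X1_def X2_def B_def field_simps)
  define f g where "f = q - (q' ^ 2 * \<C> n - q' ^ 3 * (6 * (N - 1) * B))" and "g = k + q' ^ 3 * (\<T> n + 9 * B)"
  have h: "pdvd p 4 h0" "pdvd p 4 h1" "pdvd p 4 h2"
  proof -
    have eq: "n + (p - 1) - 2 = n - 2 + (p - 1)" "n + 2 * (p - 1) - 2 = n - 2 + 2 * (p - 1)" using n by auto
    have "pdvd p 1 (\<B> (n + 0 * (p - 1) - 2) - \<B> (n - 2))" by (simp add: pdvd_zero)
    moreover have "pdvd p 1 (\<B> (n + 1 * (p - 1) - 2) - \<B> (n - 2))" "pdvd p 1 (\<B> (n + 2 * (p - 1) - 2) - \<B> (n - 2))"
      using kummer_congruence[of "n - 2"] n unfolding mult_1 eq by auto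
    ultimately show "pdvd p 4 h0" "pdvd p 4 h1" "pdvd p 4 h2"
      using log_progression_bernoulli(2)[OF n(1) n3(2) n(3), of 0] log_progression_bernoulli(2)[OF n(1) n3(2) n(3), of 1]
        log_progression_bernoulli(2)[OF n(1) n3(2) n(3), of 2]
      by (simp_all add: h0_def h1_def h2_def X0_def X1_def X2_def l0_def l1_def l2_def q'_def N_def b_def b0_def b1_def b2_def)
  qed
  have fg: "pdvd p 4 f" "pdvd p 4 g"
  proof -
    have "6 * (N - 1) * B = (N - 1) / 2 * b" "9 * B = 3 / 4 * b" by (simp_all add: B_def field_simps)
    thus "pdvd p 4 f" "pdvd p 4 g"
      using log_powers_bernoulli[OF n(1) n3(2) n(3)] by (simp_all only: f_def g_def q_def k_def q'_def N_def b_def)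
  qed
  have L: "l0 = h0 - q' * b0 - q' ^ 3 * X0" "l1 = h1 - q' * b1 - q' ^ 3 * X1"
    "l2 = h2 - q' * b2 - q' ^ 3 * X2" "q = f + (q' ^ 2 * \<C> n - q' ^ 3 * (6 * (N - 1) * B))"
    "k = g - q' ^ 3 * (\<T> n + 9 * B)"
    by (simp_all add: h0_def h1_def h2_def f_def g_def)
  have s2: "(s ^ 2) $ (n + (p - 1)) = q' ^ 2 * t" using q'0 by (simp add: t_def q'_def)
  note rel = log_relations[OF n3(1) n(3), folded l0_def l1_def l2_def q_def k_def q'_def, unfolded s2]
  have bd: "b1 = b0 - q' * d" and be: "b2 = 2 * b1 - b0 + q' ^ 2 * e"
    using q'0 by (simp_all add: d_def e_def q'_def)
  note lin = pdvd_add pdvd_diff pdvd_uminus pdvd_2 pdvd_3 pdvd_6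
  note lmult = pdvd_lmult[OF pdvd_numeral(1)] pdvd_lmult[OF wint] pdvd_lmult[OF q'int] pdvd_lmult[OF pdvd_numeral(3)]
  have hm: "pdvd p j h0" "pdvd p j h1" "pdvd p j h2" "pdvd p j f" "pdvd p j g" if "j \<le> 4" for j
    using that h fg by (auto intro: pdvd_mono)
  have q'X: "pdvd p j (q' ^ i * x)" if "pdvd p 0 x" "j \<le> i" for i j x
    using pdvd_rmult[OF pdvd_mono[OF q'1[of i] that(2)] that(1)] .
  have Bint: "pdvd p 0 B" unfolding B_def using pdvd_3[OF pdvd_4[OF bint]] by simp
  have X0int: "pdvd p 0 X0" unfolding X0_def
    by (intro pdvd_rmult[OF _ bint] pdvd_6 pdvd_lmult pdvd_diff Nint pdvd_numeral)
  note int = pdvd_lmult pdvd_add pdvd_diff Nint pdvd_numeral wint Bint X0int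
  have "q' ^ 2 * d = (l1 - l0) - (h1 - h0) - q' ^ 3 * (4 * (N - 2) * B)"
    unfolding L bd X by (simp add: power2_eq_square power3_eq_cube algebra_simps)
  also have "pdvd p 2 \<dots>"
    by (intro lin rel(2) hm q'X int) simp_all
  finally have "pdvd p (2 + 0) (of_nat p ^ 2 * d)" by (simp add: q'_def)
  thus "pdvd p 0 d" by (simp only: pdvd_power_mult_iff)
  have "q' ^ 3 * e = (h2 - 2 * h1 + h0) - (l2 - 2 * l1 + l0) - q' ^ 3 * (4 * B)"
    unfolding L be X by (simp add: power2_eq_square power3_eq_cube algebra_simps)
  also have "pdvd p 3 \<dots>"
    by (intro lin lmult rel(3) hm q'X int) simp_all
  finally have "pdvd p (3 + 0) (of_nat p ^ 3 * e)" by (simp add: q'_def)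
  thus "pdvd p 0 e" by (simp only: pdvd_power_mult_iff)
  have rel4: "pdvd p 3 (2 * (l1 - l0) + q + q' ^ 2 * t + 2 * q' * w * l0)"
    using pdvd_lmult[OF pdvd_numeral(1)[of "num.Bit0 num.One"] rel(4)] by (simp add: algebra_simps)
  have "q' ^ 2 * (\<C> n - (2 * w * b0 - 2 * d - t))
      = (2 * (l1 - l0) + q + q' ^ 2 * t + 2 * q' * w * l0) - f - 2 * (h1 - h0) - 2 * (w * (q' * h0))
      + q' ^ 3 * (6 * (N - 1) * B - 8 * (N - 2) * B) + q' ^ 4 * (2 * w * X0)"
    unfolding L bd X by (simp add: power2_eq_square power3_eq_cube power4_eq_xxxx algebra_simps)
  also have "pdvd p 3 \<dots>"
    by (intro lin lmult rel4 hm q'X int) simp_all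
  finally have "pdvd p (2 + 1) (of_nat p ^ 2 * (\<C> n - (2 * w * b0 - 2 * d - t)))" by (simp add: q'_def)
  thus "pdvd p 1 (\<C> n - (2 * w * b0 - 2 * d - t))" by (simp only: pdvd_power_mult_iff)
  assume "pdvd p 4 ((s ^ 3) $ (n + 2 * (p - 1)))"
  note pdvd_lmult[OF pdvd_numeral(1)[of "num.Bit0 (num.Bit1 num.One)"] rel(5)[OF this]]
  moreover have "6 * (k' / 6 + x - x' + q / 2 - c * x + c * l + (1 + c) * t' / 2)
    = k' + 6 * x - 6 * x' + 3 * q - 6 * c * x + 6 * c * l + 3 * (1 + c) * t'" for k' x x' q c l t' :: rat
    by (simp add: field_simps)
  ultimately have rel5: "pdvd p 4 (k + 6 * (l1 - l0) - 6 * (l2 - 2 * l1 + l0) + 3 * q - 6 * (q' * w) * (l1 - l0)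
      + 6 * (q' * w) * l0 + 3 * (1 + q' * w) * (q' ^ 2 * t))" by (simp only:)
  have E1: "(N / 2 - 5 / 4) * q' * b = q' * (6 * N - 15) * B" by (simp add: X(3) algebra_simps)
  have E2: "q' ^ 2 * (q' * \<T> n - (3 * \<C> n + 6 * d + 6 * q' * e - 6 * w * b0
       - 6 * q' * w * d + 3 * (1 + q' * w) * t + q' * (6 * N - 15) * B))
    = g - (k + 6 * (l1 - l0) - 6 * (l2 - 2 * l1 + l0) + 3 * q - 6 * (q' * w) * (l1 - l0)
      + 6 * (q' * w) * l0 + 3 * (1 + q' * w) * (q' ^ 2 * t))
      + 6 * (h1 - h0) - 6 * (h2 - 2 * h1 + h0) + 3 * f - 6 * (w * (q' * (h1 - h0))) + 6 * (w * (q' * h0))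
      - q' ^ 4 * (w * (24 * (N - 2) * B + 6 * X0))"
    unfolding L bd be X by (simp add: power2_eq_square power3_eq_cube power4_eq_xxxx algebra_simps)
  have comb: "pdvd p 4 (g - Z + 6 * x1 - 6 * x2 + 3 * f - 6 * (w * (q' * x1)) + 6 * (w * (q' * h0)) - q' ^ 4 * x)"
    if "pdvd p 4 Z" "pdvd p 4 x1" "pdvd p 4 x2" "pdvd p 0 x" for Z x1 x2 x
    by (intro pdvd_add pdvd_diff lmult pdvd_rmult[OF q'1] that h fg)
  have P4: "pdvd p 4 (g - (k + 6 * (l1 - l0) - 6 * (l2 - 2 * l1 + l0) + 3 * q - 6 * (q' * w) * (l1 - l0)
      + 6 * (q' * w) * l0 + 3 * (1 + q' * w) * (q' ^ 2 * t))
      + 6 * (h1 - h0) - 6 * (h2 - 2 * h1 + h0) + 3 * f - 6 * (w * (q' * (h1 - h0))) + 6 * (w * (q' * h0))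
      - q' ^ 4 * (w * (24 * (N - 2) * B + 6 * X0)))"
  proof (rule comb[OF rel5])
    show "pdvd p 4 (h1 - h0)" "pdvd p 4 (h2 - 2 * h1 + h0)"
      by (intro pdvd_add pdvd_diff pdvd_lmult[OF pdvd_numeral(1)] h)+
    show "pdvd p 0 (w * (24 * (N - 2) * B + 6 * X0))" by (intro int)
  qed
  have shift: "pdvd p 4 (q' ^ 2 * x) \<longleftrightarrow> pdvd p 2 x" for x
    using pdvd_power_mult_iff[of 2 2 x] by (simp add: q'_def)
  have "pdvd p 2 (q' * \<T> n - (3 * \<C> n + 6 * d + 6 * q' * e - 6 * w * b0
       - 6 * q' * w * d + 3 * (1 + q' * w) * t + (N / 2 - 5 / 4) * q' * b))"
    unfolding E1 shift[symmetric] unfolding E2 by (rule P4)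
  thus "pdvd p 2 (of_nat p * \<T> n - (3 * \<C> n + 6 * d + 6 * of_nat p * e - 6 * w * b0
       - 6 * of_nat p * w * d + 3 * (1 + of_nat p * w) * t + (of_nat n / 2 - 5 / 4) * of_nat p * \<B> (n - 2)))"
    by (simp only: q'_def N_def b_def)
qed

section \<open>Top coefficients of s^2 and s^3\<close>

lemma pdvd_s_odd:
  assumes "odd k" "3 \<le> k" "k < p - 1" shows "pdvd p 2 (s $ k)"
proof -
  \<comment> \<open>For odd k the term p \<B>(k) is absent, so the logarithm starts with
    p^2.\<close>
  have "\<B> k = 0" using assms bernoulli_odd[of k] by (simp add: divided_bernoulli_def)
  hence "pdvd p 3 (L $ k + of_nat p ^ 2 * (bernoulli (k - 1) / 2))"
    using pdvd_fpsD[OF pdvd_fps_log_bernoulli[OF assms(3)], of k] assms(2)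
    by (simp add: divided_bernoulli_fps_def bernoulli_fps_def power2_eq_square mult.assoc)
  hence "pdvd p 2 (L $ k + of_nat p ^ 2 * (bernoulli (k - 1) / 2))" by (rule pdvd_mono) simp
  moreover have "pdvd p 2 (of_nat p ^ 2 * (bernoulli (k - 1) / 2))"
    using assms by (intro pdvd_rmult[OF pdvd_power_self] pdvd_2 pdvd_bernoulli_small) simp
  ultimately have "pdvd p 2 (L $ k + of_nat p ^ 2 * (bernoulli (k - 1) / 2)
      - of_nat p ^ 2 * (bernoulli (k - 1) / 2))" by (rule pdvd_diff)
  hence L: "pdvd p 2 (L $ k)" by simp
  have lt: "pdvd p 2 (L $ k - log_trunc y $ k)"
    using pdvd_mono[OF log_nths(1)[OF assms(2,3)], of 2] by simp
  have "pdvd p 2 (L $ k - (L $ k - log_trunc y $ k) + (s ^ 2) $ k / 2 - (s ^ 3) $ k / 3)"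
    by (intro pdvd_diff pdvd_add pdvd_2 pdvd_3 L lt pdvd_s_powers(1) pdvd_mono[OF pdvd_s_powers(2)]) simp
  thus ?thesis by (simp add: log_trunc_y_nths[OF assms(2,3)])
qed

lemma odd_p: "odd p"
  using even_p p_ge_11 by simp

text \<open>A nonzero product has both indices at most p - 2, so a sum of at least 2p - 5 forces one
  of them to be p - 2, which is odd and contributes p^2.\<close>

lemma s_square_top:
  assumes "j \<ge> 2 * p - 5" shows "pdvd p 3 ((s ^ 2) $ j)"
  unfolding power2_eq_square fps_mult_nth
proof (rule pdvd_sum)
  fix i assume i: "i \<in> {0..j}"
  consider "i > p - 2" | "j - i > p - 2" | "i = p - 2" | "j - i = p - 2" using i assms by fastforce
  thus "pdvd p 3 (s $ i * s $ (j - i))"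
  proof cases
    case 3
    have "pdvd p 2 (s $ i)" using 3 odd_p p_ge_11 by (intro pdvd_s_odd) auto
    from pdvd_mult[OF this pdvd_s] show ?thesis by (simp add: numeral_3_eq_3)
  next
    case 4
    have "pdvd p 2 (s $ (j - i))" using 4 odd_p p_ge_11 by (intro pdvd_s_odd) auto
    from pdvd_mult[OF pdvd_s this] show ?thesis by (simp add: numeral_3_eq_3)
  qed (simp_all add: s_nth_eq_0 pdvd_zero)
qed

text \<open>One factor s uses at most p - 2 of the index, leaving at least 3p - 7 - (p - 2) = 2p - 5
  for the other two. This discharges the assumption left open in
  \<open>log_relations\<close>.\<close>

lemma s_cube_top:
  assumes "p - 5 \<le> n" shows "pdvd p 4 ((s ^ 3) $ (n + 2 * (p - 1)))"
proof -
  have "(s ^ 3) $ (n + 2 * (p - 1)) = (\<Sum>i = 0..n + 2 * (p - 1). s $ i * (s ^ 2) $ (n + 2 * (p - 1) - i))"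
    by (simp add: power3_eq_cube power2_eq_square fps_mult_nth mult.assoc)
  also have "pdvd p 4 \<dots>"
  proof (rule pdvd_sum)
    fix i
    show "pdvd p 4 (s $ i * (s ^ 2) $ (n + 2 * (p - 1) - i))"
    proof (cases "i \<ge> p - 1")
      case False
      have "pdvd p 3 ((s ^ 2) $ (n + 2 * (p - 1) - i))"
        using False assms by (intro s_square_top) auto
      from pdvd_mult[OF pdvd_s this] show ?thesis by simp
    qed (simp add: s_nth_eq_0 pdvd_zero)
  qed
  finally show ?thesis .
qed

text \<open>The only pair of indices is (p - 2, p - 2), with p - 2 odd.\<close>

lemma s_square_2p_minus_4: "pdvd p 4 ((s ^ 2) $ (2 * p - 4))"
  unfolding power2_eq_square fps_mult_nth
proof (rule pdvd_sum)
  fix i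
  consider "i > p - 2" | "2 * p - 4 - i > p - 2" | "i = p - 2" "2 * p - 4 - i = p - 2" by fastforce
  thus "pdvd p 4 (s $ i * s $ (2 * p - 4 - i))"
  proof cases
    case 3
    have "pdvd p 2 (s $ (p - 2))" using odd_p p_ge_11 by (intro pdvd_s_odd) auto
    from pdvd_mult[OF this this] show ?thesis unfolding 3(2) unfolding 3(1) by simp
  qed (simp_all add: s_nth_eq_0 pdvd_zero)
qed

text \<open>Apart from the middle pair only p - 2 and p - 4 combine; both are odd, and each
  coefficient is divisible by p^2.\<close>

lemma s_square_2p_minus_6: "pdvd p 4 ((s ^ 2) $ (2 * p - 6) - (s $ (p - 3)) ^ 2)"
proof -
  have "(s ^ 2) $ (2 * p - 6) = (\<Sum>i = 0..2 * p - 6. s $ i * s $ (2 * p - 6 - i))"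
    by (simp add: power2_eq_square fps_mult_nth)
  also have "\<dots> = s $ (p - 3) * s $ (2 * p - 6 - (p - 3)) + (\<Sum>i\<in>{0..2 * p - 6} - {p - 3}. s $ i * s $ (2 * p - 6 - i))"
    by (rule sum.remove) auto
  also have "2 * p - 6 - (p - 3) = p - 3" by simp
  finally have "(s ^ 2) $ (2 * p - 6) - (s $ (p - 3)) ^ 2 = (\<Sum>i\<in>{0..2 * p - 6} - {p - 3}. s $ i * s $ (2 * p - 6 - i))"
    by (simp add: power2_eq_square)
  also have "pdvd p 4 \<dots>"
  proof (rule pdvd_sum)
    fix i assume i: "i \<in> {0..2 * p - 6} - {p - 3}"
    consider "i > p - 2" | "2 * p - 6 - i > p - 2" | "i = p - 2" "2 * p - 6 - i = p - 4"
      | "i = p - 4" "2 * p - 6 - i = p - 2" using i p_ge_11 by fastforce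
    moreover have "pdvd p 2 (s $ (p - 2))" "pdvd p 2 (s $ (p - 4))"
      using odd_p p_ge_11 by (intro pdvd_s_odd; auto)+
    from pdvd_mult[OF this] pdvd_mult[OF this(2,1)]
    have "pdvd p 4 (s $ (p - 2) * s $ (p - 4))" "pdvd p 4 (s $ (p - 4) * s $ (p - 2))" by simp_all
    ultimately show "pdvd p 4 (s $ i * s $ (2 * p - 6 - i))"
      by cases (simp_all add: s_nth_eq_0 pdvd_zero)
  qed
  finally show ?thesis .
qed

lemma pdvd_conv2: "n < p - 1 \<Longrightarrow> pdvd p 0 (\<C> n)"
  unfolding conv2_def by (intro pdvd_sum pdvd_lmult pdvd_divided_bernoulli_small) auto

lemma pdvd_conv3: "n < p - 1 \<Longrightarrow> pdvd p 0 (\<T> n)"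
  unfolding conv3_def by (intro pdvd_sum pdvd_lmult pdvd_divided_bernoulli_small pdvd_conv2) auto

lemma s_square_2p_minus_6_bernoulli:
  "pdvd p 4 ((s ^ 2) $ (2 * p - 6)
     - of_nat p ^ 2 * ((\<B> (p - 3)) ^ 2 - of_nat p * \<B> (p - 3) * \<C> (p - 3)))"
proof -
  define a C q where "a = \<B> (p - 3)" and "C = \<C> (p - 3)" and "q = (of_nat p :: rat)"
  have n: "even (p - 3)" "4 \<le> p - 3" "3 \<le> p - 3" "p - 3 < p - 1" using odd_p p_ge_11 by auto
  have a: "pdvd p 0 a" and C: "pdvd p 0 C" and q: "pdvd p 0 q"
    using n by (simp_all add: a_def C_def q_def pdvd_divided_bernoulli_small pdvd_conv2 pdvd_of_nat)
  have qj: "pdvd p j (q ^ j)" for j by (simp add: q_def pdvd_power_self)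
  \<comment> \<open>Modulo p^3 one has s = L + s^2/2 at p - 3, with L = -p a and s^2 = p^2 C.
    Squaring gives p^2 a^2 - p^3 a C modulo p^4.\<close>
  define \<epsilon> where "\<epsilon> = s $ (p - 3) - (q ^ 2 * (C / 2) - q * a)"
  have b: "pdvd p 0 (\<B> (p - 3 - 2))" using p_ge_11 by (intro pdvd_divided_bernoulli_small) auto
  have L: "pdvd p 3 (L $ (p - 3) + q * a)"
    using log_progression_bernoulli(1)[OF n(1,2,4), of 0] by (simp add: q_def a_def)
  have lt: "pdvd p 3 (L $ (p - 3) - log_trunc y $ (p - 3))"
    using pdvd_mono[OF log_nths(1)[OF n(3,4)], of 3] by simp
  have x: "pdvd p 3 (of_nat p ^ 3 * ((of_nat (p - 3) - 1) / 2 * \<B> (p - 3 - 2)))"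
    by (intro pdvd_rmult[OF pdvd_power_self] pdvd_lmult pdvd_2 pdvd_diff pdvd_of_nat pdvd_numeral b)
  have Q: "pdvd p 3 ((L ^ 2) $ (p - 3) - (q ^ 2 * C))"
    using pdvd_diff[OF pdvd_mono[OF log_powers_bernoulli(1)[OF n(1,2,4)], of 3] x]
    by (simp add: q_def C_def)
  have S: "pdvd p 3 ((L ^ 2) $ (p - 3) - ((s ^ 2) $ (p - 3) - (s ^ 3) $ (p - 3)))"
    using pdvd_mono[OF log_powers(1)[OF n(4)], of 3] by simp
  have "\<epsilon> = (L $ (p - 3) + q * a) - (L $ (p - 3) - log_trunc y $ (p - 3))
      - ((L ^ 2) $ (p - 3) - ((s ^ 2) $ (p - 3) - (s ^ 3) $ (p - 3))) / 2
      + ((L ^ 2) $ (p - 3) - (q ^ 2 * C)) / 2 + (s ^ 3) $ (p - 3) / 6"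
    unfolding log_trunc_y_nths(1)[OF n(3,4)] \<epsilon>_def by (simp add: field_simps)
  also have "pdvd p 3 \<dots>"
    by (intro pdvd_add pdvd_diff pdvd_2 pdvd_6 L lt Q S pdvd_s_powers)
  finally have \<epsilon>: "pdvd p 3 \<epsilon>" .
  have \<epsilon>1: "pdvd p 1 \<epsilon>" using \<epsilon> by (rule pdvd_mono) simp
  have s: "s $ (p - 3) = q ^ 2 * (C / 2) - q * a + \<epsilon>" by (simp add: \<epsilon>_def)
  have "(s ^ 2) $ (2 * p - 6) - q ^ 2 * (a ^ 2 - q * a * C)
      = ((s ^ 2) $ (2 * p - 6) - (s $ (p - 3)) ^ 2) + q ^ 4 * (C / 2 * (C / 2))
        + \<epsilon> * (2 * (q ^ 1 * (q * (C / 2) - a)) + \<epsilon>)"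
    unfolding s by (simp add: power2_eq_square power4_eq_xxxx algebra_simps)
  also have "pdvd p 4 \<dots>"
  proof (intro pdvd_add s_square_2p_minus_6)
    show "pdvd p 4 (q ^ 4 * (C / 2 * (C / 2)))" by (intro pdvd_rmult[OF qj] pdvd_lmult pdvd_2 C)
    have "pdvd p 1 (2 * (q ^ 1 * (q * (C / 2) - a)) + \<epsilon>)"
      by (intro pdvd_add pdvd_lmult[OF pdvd_numeral(1)] pdvd_rmult[OF qj] pdvd_diff pdvd_lmult q pdvd_2 C a \<epsilon>1)
    from pdvd_mult[OF \<epsilon> this] show "pdvd p 4 (\<epsilon> * (2 * (q ^ 1 * (q * (C / 2) - a)) + \<epsilon>))" by simp
  qed
  finally show ?thesis by (simp only: a_def C_def q_def)
qed

section \<open>From congruences to digits\<close>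

lemma pdvd_dig_0_diff: "pdvd p 0 x \<Longrightarrow> pdvd p 1 (dig p x 0 - x)"
  using pdvd_uminus[OF dig_cong(1)[of x]] by simp

text \<open>The combination b2 - 3 b1 + 2 a is the second difference plus a - b1, that is p(d + p
  e). Its digit 1 is therefore that of a - b1, and its digit 2 completes d + p e modulo p^2.\<close>

lemma second_difference_digits:
  fixes a b1 b2 d e :: rat
  assumes d: "a - b1 = of_nat p * d" and e: "b2 - 2 * b1 + a = of_nat p ^ 2 * e"
    and int: "pdvd p 0 d" "pdvd p 0 e"
  shows "pdvd p 1 (d - dig p (a - b1) 1)" "pdvd p 1 (dig p (b1 - a) 1 + d)"
    "pdvd p 2 (of_nat p * e + d - dig p (a - b1) 1 - of_nat p * dig p (b2 - 3 * b1 + 2 * a) 2)"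
proof -
  have cancel: "pdvd p k x" if "pdvd p (Suc k) (of_nat p * x)" for k x
    using pdvd_power_mult_iff[of 1 k x] that by simp
  have pm: "pdvd p 1 (of_nat p * x)" if "pdvd p 0 x" for x using pdvd_rmult[OF pdvd_self that] .
  have digit1: "pdvd p 1 (x - dig p (of_nat p * x) 1)" if "pdvd p 0 x" for x
    using dig_1_cong[OF pm[OF that]] unfolding right_diff_distrib[symmetric] numeral_2_eq_2 One_nat_def[symmetric]
    by (rule cancel)
  show d1: "pdvd p 1 (d - dig p (a - b1) 1)" using digit1[OF int(1)] unfolding d .
  have "b1 - a = of_nat p * (- d)" using d by simp
  with pdvd_uminus[OF digit1[OF pdvd_uminus[OF int(1)]]]
  show "pdvd p 1 (dig p (b1 - a) 1 + d)" by simp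
  let ?x = "b2 - 3 * b1 + 2 * a" and ?y = "of_nat p * e + d"
  have x: "?x = of_nat p * ?y" using d e by (simp add: power2_eq_square algebra_simps)
  have y: "pdvd p 0 ?y" using pm[OF int(2)] int(1) by (intro pdvd_add) (auto intro: pdvd_mono)
  have "pdvd p 1 (dig p (a - b1) 1 - dig p ?x 1)"
    using pdvd_diff[OF pdvd_diff[OF digit1[OF y] d1] pm[OF int(2)]] unfolding x by simp
  hence eq: "hensel_digit p (a - b1) 1 = hensel_digit p ?x 1" by (rule hensel_digit_eqI)
  have x1: "pdvd p 1 ?x" unfolding x by (rule pm[OF y])
  have "pdvd p (Suc 2) (of_nat p * (?y - dig p ?x 1 - of_nat p * dig p ?x 2))"
    using dig_cong(3)[OF pdvd_mono[OF x1, of 0]] dig_0_eq_0[OF x1] unfolding x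
    by (simp add: power2_eq_square algebra_simps numeral_3_eq_3)
  from cancel[OF this]
  show "pdvd p 2 (of_nat p * e + d - dig p (a - b1) 1 - of_nat p * dig p ?x 2)" unfolding eq .
qed

text \<open>In the congruence for p \<T> modulo p^2 every quantity is replaced by two digits. The
  lowest ones enter as 6 d1 + w0 H + 3 Q, which is divisible by p; \<open>R\<close> is the quotient,
  made of digits of index 1 and a carry.\<close>

lemma conv3_cong_p_minus_3:
  "pdvd p 1 (\<T> (p - 3) -
       (3 * dig p (\<C> (p - 3)) 1 - 11 / 4 * \<B> (p - 5)
        + 6 * dig p (\<B> (3 * p - 5) - 3 * \<B> (2 * p - 4) + 2 * \<B> (p - 3)) 2
        + dig p (6 * dig p (\<B> (p - 3) - \<B> (2 * p - 4)) 1) 1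
        + dig p (3 * dig p (2 * dig p (\<B> (2 * p - 4) - \<B> (p - 3)) 1 + 2 * wdig p 0 * \<B> (p - 3)) 0) 1
        + wdig p 1 * dig p (- 6 * \<B> (p - 3)) 0
        + wdig p 0 * dig p (6 * (\<B> (2 * p - 4) - 2 * \<B> (p - 3))) 1
        + dig p (wdig p 0 * dig p (- 6 * \<B> (p - 3)) 0) 1
        + dig p (dig p (6 * dig p (\<B> (p - 3) - \<B> (2 * p - 4)) 1) 0
                 + dig p (- 6 * wdig p 0 * \<B> (p - 3)) 0
                 + dig p (3 * dig p (2 * dig p (\<B> (2 * p - 4) - \<B> (p - 3)) 1
                                     + 2 * wdig p 0 * \<B> (p - 3)) 0) 0) 1))"
proof -
  define q' a b1 b2 T C \<beta> where "q' = (of_nat p :: rat)" and "a = \<B> (p - 3)" and "b1 = \<B> (2 * p - 4)"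
    and "b2 = \<B> (3 * p - 5)" and "T = \<T> (p - 3)" and "C = \<C> (p - 3)" and "\<beta> = \<B> (p - 5)"
  define d e where "d = (a - b1) / q'" and "e = (b2 - 2 * b1 + a) / q' ^ 2"
  define d1 dm x2 w0 w1 where "d1 = dig p (a - b1) 1" and "dm = dig p (b1 - a) 1"
    and "x2 = dig p (b2 - 3 * b1 + 2 * a) 2" and "w0 = wdig p 0" and "w1 = wdig p 1"
  define Q H K where "Q = dig p (2 * dm + 2 * w0 * a) 0" and "H = dig p (- 6 * a) 0"
    and "K = dig p (6 * (b1 - 2 * a)) 1"
  define t where "t = (s ^ 2) $ (2 * p - 4) / q' ^ 2"
  define r1 r2 r3 r4 where "r1 = dig p (6 * d1) 1" and "r2 = dig p (3 * Q) 1" and "r3 = dig p (w0 * H) 1"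
    and "r4 = dig p (dig p (6 * d1) 0 + dig p (- 6 * w0 * a) 0 + dig p (3 * Q) 0) 1"
  define R where "R = r1 + r3 + r2 + r4"
  have q'0: "q' \<noteq> 0" using p_nonzero by (simp add: q'_def)
  have n: "even (p - 3)" "6 \<le> p - 3" "p - 3 < p - 1" using odd_p p_ge_11 by auto
  have idx: "p - 3 + (p - 1) = 2 * p - 4" "p - 3 + 2 * (p - 1) = 3 * p - 5" "p - 3 - 2 = p - 5"
    using p_ge_11 by auto
  have Np: "of_nat (p - 3) = q' - 3" using p_ge_11 by (simp add: q'_def of_nat_diff)
  note conv = convolution_congruences[OF n, unfolded idx, folded q'_def, folded a_def b1_def b2_def,
      folded d_def e_def, folded C_def T_def \<beta>_def t_def, unfolded Np]
  have dint: "pdvd p 0 d" and eint: "pdvd p 0 e" by (rule conv)+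
  have aint: "pdvd p 0 a" and Cint: "pdvd p 0 C" and \<beta>int: "pdvd p 0 \<beta>"
    using n pdvd_divided_bernoulli_small[of "p - 3"] pdvd_divided_bernoulli_small[of "p - 5"] pdvd_conv2[of "p - 3"]
    by (simp_all add: a_def C_def \<beta>_def)
  have q'1: "pdvd p 1 q'" by (simp only: q'_def pdvd_self)
  have q'int: "pdvd p 0 q'" by (simp only: q'_def pdvd_of_nat)
  have wint: "pdvd p 0 w" by (rule pdvd_wilson_quotient)
  have digint: "pdvd p 0 d1" "pdvd p 0 dm" "pdvd p 0 x2" "pdvd p 0 w0" "pdvd p 0 w1" "pdvd p 0 Q"
    "pdvd p 0 H" "pdvd p 0 K"
    by (simp_all only: d1_def dm_def x2_def w0_def w1_def Q_def H_def K_def pdvd_dig)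
  note int = pdvd_add pdvd_diff pdvd_lmult pdvd_numeral dint eint aint Cint wint digint q'int
  have q'm: "pdvd p 1 (q' * x)" if "pdvd p 0 x" for x using pdvd_rmult[OF q'1 that] .
  have q'm2: "pdvd p 2 (q' * x)" if "pdvd p 1 x" for x
    using pdvd_mult[OF q'1 that] by (simp add: numeral_2_eq_2)
  have q'c: "pdvd p 1 x" if "pdvd p 2 (q' * x)" for x
    using pdvd_power_mult_iff[of 1 1 x] that by (simp add: q'_def numeral_2_eq_2)
  have tt: "pdvd p 2 t" using pdvd_divide_power[of 2 2 "(s ^ 2) $ (2 * p - 4)"] s_square_2p_minus_4
    by (simp add: t_def q'_def)
  have t1: "pdvd p 1 t" using tt by (rule pdvd_mono) simp
  have ab: "a - b1 = q' * d" and ba: "b1 - a = q' * (- d)" using q'0 by (simp_all add: d_def)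
  have F2: "pdvd p 1 (C - (2 * w * a - 2 * d))"
    using pdvd_diff[OF conv(3) t1] by (simp add: algebra_simps)
  \<comment> \<open>Since t vanishes modulo p^2 and n = p - 3, the factor n/2 - 5/4 becomes -11/4 +
    p/2, and the p/2 drops out after multiplication by p.\<close>
  have main: "pdvd p 2 (q' * T - (3 * C + 6 * d + 6 * q' * e - 6 * w * a - 6 * q' * w * d - 11 / 4 * q' * \<beta>))"
  proof -
    have "pdvd p 2 (3 * (1 + q' * w) * t + q' * (q' * (\<beta> / 2)))"
      by (intro pdvd_add pdvd_lmult pdvd_numeral q'int wint tt q'm2 q'm pdvd_2 \<beta>int)
    moreover have "pdvd p 4 ((s ^ 3) $ (3 * p - 5))" using s_cube_top[of "p - 3"] unfolding idx by (simp add: diff_le_mono2)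
    note conv(4)[OF this]
    ultimately have "pdvd p 2 (q' * T - (3 * C + 6 * d + 6 * q' * e - 6 * w * a - 6 * q' * w * d
        + 3 * (1 + q' * w) * t + ((q' - 3) / 2 - 5 / 4) * q' * \<beta>) + (3 * (1 + q' * w) * t + q' * (q' * (\<beta> / 2))))"
      by (rule pdvd_add[rotated])
    moreover have "X - (Y + Z + ((q' - 3) / 2 - 5 / 4) * q' * \<beta>) + (Z + q' * (q' * (\<beta> / 2))) = X - (Y - 11 / 4 * q' * \<beta>)"
      for X Y Z by (simp add: field_simps)
    ultimately show ?thesis by (simp only:)
  qed
  have "b2 - 2 * b1 + a = q' ^ 2 * e" using q'0 by (simp add: e_def)
  note digits = second_difference_digits[of a b1 d b2 e, folded q'_def, OF ab this dint eint,
      folded d1_def dm_def x2_def]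
  note d1 = digits(1) and dm = digits(2) and c2 = digits(3)
  have w0: "pdvd p 1 (w - w0)" and c4: "pdvd p 2 (w - w0 - q' * w1)"
    using dig_cong(1,2)[OF wint] by (simp_all add: w0_def w1_def q'_def algebra_simps)
  \<comment> \<open>\<open>Q\<close> is the lowest digit of \<C>(p - 3) in disguise, by \<C>(p - 3)
    = 2wa - 2d modulo p.\<close>
  have Qx: "pdvd p 1 (Q - C)"
  proof -
    have "Q - C = (Q - (2 * dm + 2 * w0 * a)) + 2 * (dm + d) - 2 * (a * (w - w0)) - (C - (2 * w * a - 2 * d))"
      by (simp add: algebra_simps)
    also have "pdvd p 1 \<dots>" unfolding Q_def
      by (intro pdvd_add pdvd_diff pdvd_dig_0_diff pdvd_lmult pdvd_numeral digint aint dm w0 F2)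
    finally show ?thesis .
  qed
  have Q: "Q = dig p C 0"
  proof -
    have "pdvd p 1 (Q - dig p C 0)" using pdvd_add[OF Qx dig_cong(1)[OF Cint]] by simp
    thus ?thesis unfolding Q_def using hensel_digit_eqI by simp
  qed
  have c1: "pdvd p 2 (C - Q - q' * dig p C 1)"
    using dig_cong(2)[OF Cint] unfolding Q q'_def by (simp add: algebra_simps)
  have H: "pdvd p 1 (H + 6 * a)"
    using pdvd_dig_0_diff[of "- 6 * a"] pdvd_lmult[OF pdvd_numeral(3) aint] by (simp add: H_def)
  \<comment> \<open>As b1 = a - p d, the number 6(b1 - 2a) is -6a - 6pd, so its product with w
    contains both terms -6wa and -6pwd.\<close>
  have c5: "pdvd p 2 (6 * (b1 - 2 * a) - H - q' * K)"
  proof -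
    have x: "6 * (b1 - 2 * a) = - 6 * a - q' * (6 * d)" using ba by (simp add: algebra_simps)
    have xint: "pdvd p 0 (6 * (b1 - 2 * a))" unfolding x by (intro int)
    have "hensel_digit p (6 * (b1 - 2 * a)) 0 = hensel_digit p (- 6 * a) 0"
    proof (rule dig_0_eqI[OF xint])
      have "6 * (b1 - 2 * a) - (- 6 * a) = - (q' * (6 * d))" unfolding x by simp
      thus "pdvd p 1 (6 * (b1 - 2 * a) - (- 6 * a))" by (simp only:) (intro pdvd_uminus q'm int)
    qed (intro int)
    thus ?thesis using dig_cong(2)[OF xint] by (simp add: H_def K_def q'_def algebra_simps)
  qed
  have c3: "pdvd p 2 (6 * d1 + w0 * H + 3 * Q - q' * R)"
  proof -
    have "6 * d1 + w0 * H + 3 * Q = w0 * (H + 6 * a) + 6 * (a * (w - w0)) - 6 * (d - d1) + 3 * (Q - C)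
        + 3 * (C - (2 * w * a - 2 * d))" by (simp add: algebra_simps)
    also have "pdvd p 1 \<dots>" by (intro pdvd_add pdvd_diff pdvd_lmult pdvd_numeral digint aint H w0 d1 Qx F2)
    finally have sum: "pdvd p 1 (0 + 6 * d1 + w0 * H + 3 * Q)" by simp
    \<comment> \<open>The brace contains the digit of -6 w0 a, the carry lemma that of w0 H; they
      agree because H = -6a modulo p.\<close>
    have "hensel_digit p (- 6 * w0 * a) 0 = hensel_digit p (w0 * H) 0"
    proof (rule dig_0_eqI)
      have "- 6 * w0 * a - w0 * H = - (w0 * (H + 6 * a))" by (simp add: algebra_simps)
      thus "pdvd p 1 (- 6 * w0 * a - w0 * H)" by (simp only:) (intro pdvd_uminus pdvd_lmult digint H)
    qed (intro int)+
    hence eq: "r4 = dig p (dig p 0 0 + dig p (6 * d1) 0 + dig p (w0 * H) 0 + dig p (3 * Q) 0) 1"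
      by (simp add: r4_def dig_zero)
    have "pdvd p 0 (6 * d1)" "pdvd p 0 (w0 * H)" "pdvd p 0 (3 * Q)" by (intro int)+
    from digit_carry[OF pdvd_zero this sum] show ?thesis
      unfolding R_def eq by (simp add: dig_zero r1_def r2_def r3_def q'_def)
  qed
  have "q' * (T - (3 * dig p C 1 - 11 / 4 * \<beta> + 6 * x2 + R + w1 * H + w0 * K))
      = (q' * T - (3 * C + 6 * d + 6 * q' * e - 6 * w * a - 6 * q' * w * d - 11 / 4 * q' * \<beta>))
      + 3 * (C - Q - q' * dig p C 1) + 6 * (q' * e + d - d1 - q' * x2) + (6 * d1 + w0 * H + 3 * Q - q' * R)
      + H * (w - w0 - q' * w1) + w0 * (6 * (b1 - 2 * a) - H - q' * K)
      - (w - w0) * (H + 6 * a) - q' * ((w - w0) * (6 * d))"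
  proof -
    have b1: "b1 = a - q' * d" using ab by simp
    show ?thesis unfolding b1 by (simp add: algebra_simps)
  qed
  also have "pdvd p 2 \<dots>"
  proof -
    have comb: "pdvd p 2 (E0 + 3 * E1 + 6 * E2 + E3 + H * E4 + w0 * E5 - E6 - q' * E7)"
      if "pdvd p 2 E0" "pdvd p 2 E1" "pdvd p 2 E2" "pdvd p 2 E3" "pdvd p 2 E4" "pdvd p 2 E5" "pdvd p 2 E6" "pdvd p 1 E7"
      for E0 E1 E2 E3 E4 E5 E6 E7
      by (intro pdvd_add pdvd_diff q'm2 pdvd_lmult pdvd_numeral digint that)
    have "pdvd p 2 ((w - w0) * (H + 6 * a))" using pdvd_mult[OF w0 H] by (simp add: numeral_2_eq_2)
    from comb[OF main c1 c2 c3 c4 c5 this pdvd_rmult[OF w0 pdvd_lmult[OF pdvd_numeral(1) dint]]]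
    show ?thesis .
  qed
  finally have "pdvd p 1 (T - (3 * dig p C 1 - 11 / 4 * \<beta> + 6 * x2 + R + w1 * H + w0 * K))"
    by (rule q'c)
  also have "3 * dig p C 1 - 11 / 4 * \<beta> + 6 * x2 + R + w1 * H + w0 * K
      = 3 * dig p C 1 - 11 / 4 * \<beta> + 6 * x2 + r1 + r2 + w1 * H + w0 * K + r3 + r4"
    by (simp add: R_def)
  finally show ?thesis
    unfolding r4_def r3_def r2_def r1_def H_def K_def Q_def d1_def dm_def x2_def w0_def w1_def
      T_def C_def \<beta>_def a_def b1_def b2_def .
qed

text \<open>As for p - 3, except that t now contributes the square of a = \<B>(p - 3), which brings
  in digits of a. Moreover \<open>K\<close> belongs to -6f alone, so that the order-p terms with w
  need the two extra digits \<open>R1\<close> and \<open>R2\<close>.\<close>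

lemma conv3_cong_p_minus_5:
  "pdvd p 1 (\<T> (p - 5) -
       (3 * dig p (\<C> (p - 5)) 1 - 15 / 4 * \<B> (p - 7)
        + dig p (3 * (dig p (\<B> (p - 3)) 0)\<^sup>2) 1
        + 6 * \<B> (p - 3) * dig p (2 * \<B> (p - 3) - \<B> (2 * p - 4)) 1
        + 6 * dig p (\<B> (3 * p - 7) - 3 * \<B> (2 * p - 6) + 2 * \<B> (p - 5)) 2
        + dig p (6 * dig p (\<B> (p - 5) - \<B> (2 * p - 6)) 1) 1
        + wdig p 0 * dig p (- 6 * \<B> (p - 5)) 1
        + wdig p 1 * dig p (- 6 * \<B> (p - 5)) 0
        + dig p (wdig p 0 * dig p (- 6 * \<B> (p - 5)) 0) 1
        + dig p (- 6 * (wdig p 0)\<^sup>2 * \<B> (p - 5)) 0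
        + dig p (3 * wdig p 0 * dig p (2 * wdig p 0 * \<B> (p - 5) + 2 * dig p (\<B> (2 * p - 6) - \<B> (p - 5)) 1
                                 - (\<B> (p - 3))\<^sup>2) 0) 0
        + dig p (3 * dig p (2 * wdig p 0 * \<B> (p - 5) + 2 * dig p (\<B> (2 * p - 6) - \<B> (p - 5)) 1
                            - (\<B> (p - 3))\<^sup>2) 0) 1
        + dig p (dig p (3 * (dig p (\<B> (p - 3)) 0)\<^sup>2) 0
                 + dig p (6 * dig p (\<B> (p - 5) - \<B> (2 * p - 6)) 1) 0
                 + dig p (- 6 * wdig p 0 * dig p (\<B> (p - 5)) 0) 0
                 + dig p (3 * dig p (2 * wdig p 0 * \<B> (p - 5)
                                     + 2 * dig p (\<B> (2 * p - 6) - \<B> (p - 5)) 1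
                                     - (\<B> (p - 3))\<^sup>2) 0) 0) 1))"
proof -
  define q' f b1 b2 T C \<beta> where "q' = (of_nat p :: rat)" and "f = \<B> (p - 5)" and "b1 = \<B> (2 * p - 6)"
    and "b2 = \<B> (3 * p - 7)" and "T = \<T> (p - 5)" and "C = \<C> (p - 5)" and "\<beta> = \<B> (p - 7)"
  define a a1 C3 where "a = \<B> (p - 3)" and "a1 = \<B> (2 * p - 4)" and "C3 = \<C> (p - 3)"
  define d e D where "d = (f - b1) / q'" and "e = (b2 - 2 * b1 + f) / q' ^ 2" and "D = (a - a1) / q'"
  define d1 dm x2 w0 w1 where "d1 = dig p (f - b1) 1" and "dm = dig p (b1 - f) 1"
    and "x2 = dig p (b2 - 3 * b1 + 2 * f) 2" and "w0 = wdig p 0" and "w1 = wdig p 1"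
  define Q H K a0 y1 f0 where "Q = dig p (2 * w0 * f + 2 * dm - a ^ 2) 0" and "H = dig p (- 6 * f) 0"
    and "K = dig p (- 6 * f) 1" and "a0 = dig p a 0" and "y1 = dig p (2 * a - a1) 1" and "f0 = dig p f 0"
  define R1 R2 where "R1 = dig p (- 6 * w0 ^ 2 * f) 0" and "R2 = dig p (3 * w0 * Q) 0"
  define t where "t = (s ^ 2) $ (2 * p - 6) / q' ^ 2"
  define r0 r1 r2 r3 r4 where "r0 = dig p (3 * a0 ^ 2) 1" and "r1 = dig p (6 * d1) 1"
    and "r2 = dig p (3 * Q) 1" and "r3 = dig p (w0 * H) 1"
    and "r4 = dig p (dig p (3 * a0 ^ 2) 0 + dig p (6 * d1) 0 + dig p (- 6 * w0 * f0) 0 + dig p (3 * Q) 0) 1"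
  define R where "R = r0 + r1 + r3 + r2 + r4"
  have q'0: "q' \<noteq> 0" using p_nonzero by (simp add: q'_def)
  have n: "even (p - 5)" "6 \<le> p - 5" "p - 5 < p - 1" and m: "even (p - 3)" "6 \<le> p - 3" "p - 3 < p - 1"
    using odd_p p_ge_11 by auto
  have idx: "p - 5 + (p - 1) = 2 * p - 6" "p - 5 + 2 * (p - 1) = 3 * p - 7" "p - 5 - 2 = p - 7"
    and idx3: "p - 3 + (p - 1) = 2 * p - 4"
    using p_ge_11 by auto
  have Np: "of_nat (p - 5) = q' - 5" using p_ge_11 by (simp add: q'_def of_nat_diff)
  note conv = convolution_congruences[OF n, unfolded idx, folded q'_def, folded f_def b1_def b2_def,
      folded d_def e_def, folded C_def T_def \<beta>_def t_def, unfolded Np]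
  note conv' = convolution_congruences(1,3)[OF m, unfolded idx3, folded q'_def, folded a_def a1_def,
      folded D_def, folded C3_def]
  have dint: "pdvd p 0 d" and eint: "pdvd p 0 e" and Dint: "pdvd p 0 D" by (rule conv conv')+
  have aint: "pdvd p 0 a" and fint: "pdvd p 0 f" and Cint: "pdvd p 0 C" and C3int: "pdvd p 0 C3"
    and \<beta>int: "pdvd p 0 \<beta>"
    using p_ge_11 by (simp_all add: a_def f_def C_def C3_def \<beta>_def pdvd_divided_bernoulli_small pdvd_conv2)
  have q'1: "pdvd p 1 q'" by (simp only: q'_def pdvd_self)
  have q'int: "pdvd p 0 q'" by (simp only: q'_def pdvd_of_nat)
  have wint: "pdvd p 0 w" by (rule pdvd_wilson_quotient)
  have digint: "pdvd p 0 d1" "pdvd p 0 dm" "pdvd p 0 x2" "pdvd p 0 w0" "pdvd p 0 w1" "pdvd p 0 Q"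
    "pdvd p 0 H" "pdvd p 0 K" "pdvd p 0 a0" "pdvd p 0 y1" "pdvd p 0 f0"
    by (simp_all only: d1_def dm_def x2_def w0_def w1_def Q_def H_def K_def a0_def y1_def f0_def pdvd_dig)
  note int = pdvd_add pdvd_diff pdvd_lmult pdvd_numeral dint eint Dint aint fint Cint wint digint q'int
  have q'm: "pdvd p 1 (q' * x)" if "pdvd p 0 x" for x using pdvd_rmult[OF q'1 that] .
  have q'm2: "pdvd p 2 (q' * x)" if "pdvd p 1 x" for x
    using pdvd_mult[OF q'1 that] by (simp add: numeral_2_eq_2)
  have q'c: "pdvd p 1 x" if "pdvd p 2 (q' * x)" for x
    using pdvd_power_mult_iff[of 1 1 x] that by (simp add: q'_def numeral_2_eq_2)
  have prod2: "pdvd p 2 (x * x')" if "pdvd p 1 x" "pdvd p 1 x'" for x x'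
    using pdvd_mult[OF that] by (simp add: numeral_2_eq_2)
  have fb: "f - b1 = q' * d" and ab: "a - a1 = q' * D" using q'0 by (simp_all add: d_def D_def)
  have "pdvd p 4 ((s ^ 2) $ (2 * p - 4))" by (rule s_square_2p_minus_4)
  hence "pdvd p 1 ((s ^ 2) $ (2 * p - 4) / q' ^ 2)"
    using pdvd_mono[OF pdvd_divide_power[of 2 2 "(s ^ 2) $ (2 * p - 4)"], of 1] by (simp add: q'_def)
  from pdvd_diff[OF conv'(2) this] have C3: "pdvd p 1 (C3 - (2 * w * a - 2 * D))"
    by (simp add: algebra_simps)
  have t: "pdvd p 2 (t - (a ^ 2 - q' * a * C3))"
  proof -
    have "(s ^ 2) $ (2 * p - 6) - q' ^ 2 * (a ^ 2 - q' * a * C3) = q' ^ 2 * (t - (a ^ 2 - q' * a * C3))"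
      using q'0 by (simp add: t_def right_diff_distrib)
    with s_square_2p_minus_6_bernoulli pdvd_power_mult_iff[of 2 2 "t - (a ^ 2 - q' * a * C3)"]
    show ?thesis by (simp add: q'_def a_def C3_def)
  qed
  have t1: "pdvd p 1 (t - a ^ 2)"
  proof -
    have "t - a ^ 2 = (t - (a ^ 2 - q' * a * C3)) - q' * (a * C3)" by simp
    also have "pdvd p 1 \<dots>"
      by (intro pdvd_diff q'm pdvd_lmult aint C3int pdvd_mono[OF t]) simp
    finally show ?thesis .
  qed
  have F2: "pdvd p 1 (C - (2 * w * f - 2 * d - a ^ 2))"
    using pdvd_diff[OF conv(3) t1] by (simp add: algebra_simps)
  \<comment> \<open>Inserting \<C>(p - 3) = 2wa - 2D into t = a^2 - p a \<C>(p - 3) gives (1 + pw) t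
    = a^2 - pw a^2 + 2p a D modulo p^2.\<close>
  have main: "pdvd p 2 (q' * T - (3 * C + 6 * d + 6 * q' * e - 6 * w * f - 6 * q' * w * d
      + 3 * (a ^ 2 - q' * w * a ^ 2 + 2 * q' * a * D) - 15 / 4 * q' * \<beta>))"
  proof -
    have "3 * (1 + q' * w) * t - 3 * (a ^ 2 - q' * w * a ^ 2 + 2 * q' * a * D)
      = 3 * (1 + q' * w) * (t - (a ^ 2 - q' * a * C3)) - q' * (3 * a * (C3 - (2 * w * a - 2 * D)))
        - q' * (q' * (3 * w * a * C3))"
      by (simp add: power2_eq_square algebra_simps)
    also have "pdvd p 2 \<dots>"
      by (intro pdvd_diff pdvd_lmult pdvd_add pdvd_numeral q'int wint t q'm2 q'm aint C3 C3int)
    finally have "pdvd p 2 ((3 * (1 + q' * w) * t - 3 * (a ^ 2 - q' * w * a ^ 2 + 2 * q' * a * D)) + q' * (q' * (\<beta> / 2)))"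
      by (intro pdvd_add q'm2 q'm pdvd_2 \<beta>int)
    moreover have "pdvd p 4 ((s ^ 3) $ (3 * p - 7))" using s_cube_top[of "p - 5"] unfolding idx by simp
    note conv(4)[OF this]
    ultimately have "pdvd p 2 (q' * T - (3 * C + 6 * d + 6 * q' * e - 6 * w * f - 6 * q' * w * d
        + 3 * (1 + q' * w) * t + ((q' - 5) / 2 - 5 / 4) * q' * \<beta>)
        + ((3 * (1 + q' * w) * t - 3 * (a ^ 2 - q' * w * a ^ 2 + 2 * q' * a * D)) + q' * (q' * (\<beta> / 2))))"
      by (rule pdvd_add[rotated])
    moreover have "X - (Y + Z + ((q' - 5) / 2 - 5 / 4) * q' * \<beta>) + ((Z - Z') + q' * (q' * (\<beta> / 2)))
        = X - (Y + Z' - 15 / 4 * q' * \<beta>)" for X Y Z Z' by (simp add: field_simps)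
    ultimately show ?thesis by (simp only:)
  qed
  have "b2 - 2 * b1 + f = q' ^ 2 * e" using q'0 by (simp add: e_def)
  note digits = second_difference_digits[of f b1 d b2 e, folded q'_def, OF fb this dint eint,
      folded d1_def dm_def x2_def]
  note d1 = digits(1) and dm = digits(2) and c2 = digits(3)
  have w0: "pdvd p 1 (w - w0)" and c4: "pdvd p 2 (w - w0 - q' * w1)"
    using dig_cong(1,2)[OF wint] by (simp_all add: w0_def w1_def q'_def algebra_simps)
  have Qint: "pdvd p 0 (2 * w0 * f + 2 * dm - a ^ 2)" unfolding power2_eq_square by (intro int)
  have Qx: "pdvd p 1 (Q - C)"
  proof -
    have "Q - C = (Q - (2 * w0 * f + 2 * dm - a ^ 2)) + 2 * (dm + d) - 2 * (f * (w - w0))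
        - (C - (2 * w * f - 2 * d - a ^ 2))"
      by (simp add: algebra_simps)
    also have "pdvd p 1 \<dots>" unfolding Q_def
      by (intro pdvd_add pdvd_diff pdvd_dig_0_diff[OF Qint] pdvd_lmult pdvd_numeral fint dm w0 F2)
    finally show ?thesis .
  qed
  have Q: "Q = dig p C 0"
  proof -
    have "pdvd p 1 (Q - dig p C 0)" using pdvd_add[OF Qx dig_cong(1)[OF Cint]] by simp
    thus ?thesis unfolding Q_def using hensel_digit_eqI by simp
  qed
  have c1: "pdvd p 2 (C - Q - q' * dig p C 1)"
    using dig_cong(2)[OF Cint] unfolding Q q'_def by (simp add: algebra_simps)
  have Hint: "pdvd p 0 (- 6 * f)" by (intro int)
  have H: "pdvd p 1 (H + 6 * f)" using pdvd_dig_0_diff[OF Hint] by (simp add: H_def)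
  have c5: "pdvd p 2 (- 6 * f - H - q' * K)"
    using dig_cong(2)[OF Hint] by (simp add: H_def K_def q'_def diff_diff_eq)
  have a0: "pdvd p 1 (a - a0)" using dig_cong(1)[OF aint] by (simp add: a0_def)
  \<comment> \<open>Because 2a - a1 = a + pD, the digit \<open>y1\<close> combines the second digit
    of a with D. It gives 3a^2 + 6p a D = 3 a0^2 + 6p a y1 modulo p^2, up to a multiple of (a -
    a0)^2.\<close>
  have c6: "pdvd p 2 (a + q' * D - a0 - q' * y1)"
  proof -
    have x: "2 * a - a1 = a + q' * D" using ab by (simp add: algebra_simps)
    have xint: "pdvd p 0 (2 * a - a1)" unfolding x by (intro int)
    have "hensel_digit p (2 * a - a1) 0 = hensel_digit p a 0"
      by (rule dig_0_eqI[OF xint aint]) (simp add: x q'm Dint del: One_nat_def)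
    thus ?thesis using dig_cong(2)[OF xint] unfolding a0_def y1_def x[symmetric]
      by (simp add: q'_def algebra_simps)
  qed
  \<comment> \<open>R1 + R2 is 3 w0 (Q - 2 w0 f) modulo p, which by \<C>(p - 5) = 2wf - 2d - a^2
    equals w(-6d - 3a^2).\<close>
  have c7: "pdvd p 1 (R1 - - 6 * w0 ^ 2 * f)" unfolding R1_def power2_eq_square
    by (intro pdvd_dig_0_diff int)
  have c8: "pdvd p 1 (R2 - 3 * w0 * Q)" unfolding R2_def by (intro pdvd_dig_0_diff int)
  have c3: "pdvd p 2 (3 * a0 ^ 2 + 6 * d1 + w0 * H + 3 * Q - q' * R)"
  proof -
    have "3 * a0 ^ 2 + 6 * d1 + w0 * H + 3 * Q = w0 * (H + 6 * f) + 6 * (f * (w - w0)) - 6 * (d - d1)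
        + 3 * (Q - C) + 3 * (C - (2 * w * f - 2 * d - a ^ 2)) - 3 * ((a + a0) * (a - a0))"
      by (simp add: power2_eq_square algebra_simps)
    also have "pdvd p 1 \<dots>"
      by (intro pdvd_diff[of 1 _ "3 * ((a + a0) * (a - a0))"] pdvd_lmult[of "a + a0"] pdvd_add pdvd_diff pdvd_lmult
          pdvd_numeral digint aint fint H w0 d1 Qx F2 a0)
    finally have sum: "pdvd p 1 (3 * a0 ^ 2 + 6 * d1 + w0 * H + 3 * Q)" .
    have fe: "pdvd p 1 (f - f0)" using dig_cong(1)[OF fint] by (simp add: f0_def)
    have eq: "hensel_digit p (- 6 * w0 * f0) 0 = hensel_digit p (w0 * H) 0"
    proof (rule dig_0_eqI)
      have "- 6 * w0 * f0 - w0 * H = 6 * (w0 * (f - f0)) - w0 * (H + 6 * f)" by (simp add: algebra_simps)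
      also have "pdvd p 1 \<dots>" by (intro pdvd_diff pdvd_lmult pdvd_numeral digint H fe)
      finally show "pdvd p 1 (- 6 * w0 * f0 - w0 * H)" .
    qed (intro int)+
    have "pdvd p 0 (3 * a0 ^ 2)" "pdvd p 0 (6 * d1)" "pdvd p 0 (w0 * H)" "pdvd p 0 (3 * Q)"
      unfolding power2_eq_square by (intro int)+
    from digit_carry[OF this sum] show ?thesis
      unfolding R_def r0_def r1_def r2_def r3_def r4_def q'_def eq .
  qed
  have "q' * (T - (3 * dig p C 1 - 15 / 4 * \<beta> + 6 * a * y1 + 6 * x2 + R + w0 * K + w1 * H + R1 + R2))
      = (q' * T - (3 * C + 6 * d + 6 * q' * e - 6 * w * f - 6 * q' * w * d
          + 3 * (a ^ 2 - q' * w * a ^ 2 + 2 * q' * a * D) - 15 / 4 * q' * \<beta>))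
      + 3 * (C - Q - q' * dig p C 1) + 6 * (q' * e + d - d1 - q' * x2)
      + (3 * a0 ^ 2 + 6 * d1 + w0 * H + 3 * Q - q' * R)
      + H * (w - w0 - q' * w1) + w0 * (- 6 * f - H - q' * K) + 6 * (a * (a + q' * D - a0 - q' * y1))
      - q' * (R1 - - 6 * w0 ^ 2 * f) - q' * (R2 - 3 * w0 * Q)
      - 3 * ((a - a0) * (a - a0)) - (w - w0) * (H + 6 * f) - q' * (6 * (d * (w - w0)))
      - q' * (3 * (a * (a * (w - w0)))) - q' * (6 * (w0 * (f * (w - w0))))
      - q' * (3 * (w0 * ((Q - C) + (C - (2 * w * f - 2 * d - a ^ 2)))))"
    by (simp add: power2_eq_square algebra_simps)
  also have "pdvd p 2 \<dots>"
  proof -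
    have comb: "pdvd p 2 (E0 + 3 * E1 + 6 * E2 + E3 + H * E4 + w0 * E5 + 6 * (a * E6) - q' * E7 - q' * E8
        - 3 * E9 - E10 - q' * (6 * (d * E11)) - q' * (3 * (a * (a * E11))) - q' * (6 * (w0 * (f * E11)))
        - q' * (3 * (w0 * E12)))"
      if "pdvd p 2 E0" "pdvd p 2 E1" "pdvd p 2 E2" "pdvd p 2 E3" "pdvd p 2 E4" "pdvd p 2 E5" "pdvd p 2 E6"
        "pdvd p 1 E7" "pdvd p 1 E8" "pdvd p 2 E9" "pdvd p 2 E10" "pdvd p 1 E11" "pdvd p 1 E12"
      for E0 E1 E2 E3 E4 E5 E6 E7 E8 E9 E10 E11 E12
      by (intro pdvd_add pdvd_diff q'm2 pdvd_lmult pdvd_numeral digint aint fint dint that)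
    show ?thesis
      by (rule comb[OF main c1 c2 c3 c4 c5 c6 c7 c8 prod2[OF a0 a0] prod2[OF w0 H] w0 pdvd_add[OF Qx F2]])
  qed
  finally have "pdvd p 1 (T - (3 * dig p C 1 - 15 / 4 * \<beta> + 6 * a * y1 + 6 * x2 + R + w0 * K + w1 * H + R1 + R2))"
    by (rule q'c)
  also have "3 * dig p C 1 - 15 / 4 * \<beta> + 6 * a * y1 + 6 * x2 + R + w0 * K + w1 * H + R1 + R2
      = 3 * dig p C 1 - 15 / 4 * \<beta> + r0 + 6 * a * y1 + 6 * x2 + r1 + w0 * K + w1 * H + r3 + R1 + R2 + r2 + r4"
    by (simp add: R_def)
  finally show ?thesis
    unfolding r4_def r3_def r2_def r1_def r0_def R1_def R2_def H_def K_def Q_def d1_def dm_def x2_def w0_def w1_def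
      a0_def y1_def f0_def T_def C_def \<beta>_def a_def a1_def f_def b1_def b2_def .
qed

end

theorem theorem1:
  fixes p :: nat
  assumes "prime p" and "p \<ge> 11"
  shows
    "11 / 4 * \<B> (p - 5) \<in> padic_integers p \<and>
     padic_cong p (\<T> (p - 3))
       (3 * dig p (\<C> (p - 3)) 1 - 11 / 4 * \<B> (p - 5)
        + 6 * dig p (\<B> (3 * p - 5) - 3 * \<B> (2 * p - 4) + 2 * \<B> (p - 3)) 2
        + dig p (6 * dig p (\<B> (p - 3) - \<B> (2 * p - 4)) 1) 1
        + dig p (3 * dig p (2 * dig p (\<B> (2 * p - 4) - \<B> (p - 3)) 1 + 2 * wdig p 0 * \<B> (p - 3)) 0) 1
        + wdig p 1 * dig p (- 6 * \<B> (p - 3)) 0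
        + wdig p 0 * dig p (6 * (\<B> (2 * p - 4) - 2 * \<B> (p - 3))) 1
        + dig p (wdig p 0 * dig p (- 6 * \<B> (p - 3)) 0) 1
        + dig p (dig p (6 * dig p (\<B> (p - 3) - \<B> (2 * p - 4)) 1) 0
                 + dig p (- 6 * wdig p 0 * \<B> (p - 3)) 0
                 + dig p (3 * dig p (2 * dig p (\<B> (2 * p - 4) - \<B> (p - 3)) 1
                                     + 2 * wdig p 0 * \<B> (p - 3)) 0) 0) 1) \<and>
     15 / 4 * \<B> (p - 7) \<in> padic_integers p \<and>
     6 * \<B> (p - 3) * dig p (2 * \<B> (p - 3) - \<B> (2 * p - 4)) 1 \<in> padic_integers p \<and>
     padic_cong p (\<T> (p - 5))
       (3 * dig p (\<C> (p - 5)) 1 - 15 / 4 * \<B> (p - 7)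
        + dig p (3 * (dig p (\<B> (p - 3)) 0)\<^sup>2) 1
        + 6 * \<B> (p - 3) * dig p (2 * \<B> (p - 3) - \<B> (2 * p - 4)) 1
        + 6 * dig p (\<B> (3 * p - 7) - 3 * \<B> (2 * p - 6) + 2 * \<B> (p - 5)) 2
        + dig p (6 * dig p (\<B> (p - 5) - \<B> (2 * p - 6)) 1) 1
        + wdig p 0 * dig p (- 6 * \<B> (p - 5)) 1
        + wdig p 1 * dig p (- 6 * \<B> (p - 5)) 0
        + dig p (wdig p 0 * dig p (- 6 * \<B> (p - 5)) 0) 1
        + dig p (- 6 * (wdig p 0)\<^sup>2 * \<B> (p - 5)) 0
        + dig p (3 * wdig p 0 * dig p (2 * wdig p 0 * \<B> (p - 5) + 2 * dig p (\<B> (2 * p - 6) - \<B> (p - 5)) 1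
                                 - (\<B> (p - 3))\<^sup>2) 0) 0
        + dig p (3 * dig p (2 * wdig p 0 * \<B> (p - 5) + 2 * dig p (\<B> (2 * p - 6) - \<B> (p - 5)) 1
                            - (\<B> (p - 3))\<^sup>2) 0) 1
        + dig p (dig p (3 * (dig p (\<B> (p - 3)) 0)\<^sup>2) 0
                 + dig p (6 * dig p (\<B> (p - 5) - \<B> (2 * p - 6)) 1) 0
                 + dig p (- 6 * wdig p 0 * dig p (\<B> (p - 5)) 0) 0
                 + dig p (3 * dig p (2 * wdig p 0 * \<B> (p - 5)
                                     + 2 * dig p (\<B> (2 * p - 6) - \<B> (p - 5)) 1
                                     - (\<B> (p - 3))\<^sup>2) 0) 0) 1)"
proof -
  interpret padic_large_prime p using assms by unfold_locales
  have 1: "pdvd p 0 (11 / 4 * \<B> (p - 5))" "pdvd p 0 (15 / 4 * \<B> (p - 7))"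
    by (intro pdvd_lmult pdvd_4 pdvd_numeral pdvd_divided_bernoulli_small; use p_ge_11 in simp)+
  have 2: "pdvd p 0 (6 * \<B> (p - 3) * dig p (2 * \<B> (p - 3) - \<B> (2 * p - 4)) 1)"
    by (intro pdvd_lmult pdvd_numeral pdvd_dig pdvd_divided_bernoulli_small) (use p_ge_11 in simp)
  have 3: "pdvd p 0 (\<T> (p - 3))" "pdvd p 0 (\<T> (p - 5))"
    by (intro pdvd_conv3; use p_ge_11 in simp)+
  \<comment> \<open>Integrality of the right-hand side comes for free from that of the left-hand
    side and of the difference.\<close>
  have cong: "padic_cong p x x'" if "pdvd p 1 (x - x')" "pdvd p 0 x" for x x'
    using that pdvd_diff[OF that(2) pdvd_mono[OF that(1), of 0]] by (simp add: padic_cong_iff)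
  show ?thesis
    unfolding pdvd_0_iff[symmetric]
    by (intro conjI 1 2 cong conv3_cong_p_minus_3 conv3_cong_p_minus_5 3)
qed

end
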